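(* Let $X$ be a finitely irreducible countable Markov shift and let $\phi\colon X\to\mathbb R$ be a summable function with summable variations satisfying $\beta_\infty(\phi)<1$. Let $I\colon\mathcal M\to[0,\infty]$ be the rate function $I(\mu)=-\inf_{\mathcal G\ni\mu}\sup_{\mathcal G}F$ associated with $\phi$. Then the minimizer of $I$ is unique, i.e. there is exactly one $\mu\in\mathcal M$ with $I(\mu)=0$. It coincides with the unique shift-invariant Gibbs state for the potential $\phi$, and with the unique equilibrium state for the potential $\phi$.
   Context: Markov shifts. Let $S$ be a countably infinite set, let $\mathbb N$ be the set of non-negative integers, and give $S^{\mathbb N}$ the product of the discrete topologies. Let $T=(t_{ij})_{S\times S}$ be a matrix of zeros and ones with no row or column made only of zeros. The countable Markov shift generated by $T$ is $X=\{x\in S^{\mathbb N}: t_{x_ix_{i+1}}=1\ \forall i\in\mathbb N\}$; $\sigma$ is the left shift, $(\sigma x)_i=x_{i+1}$, and $\sigma|_X$ its restriction to $X$. A string $\omega_0\cdots\omega_{n-1}$ of elements of $S$ is admissible if $n=1$, or $n\ge2$ and $t_{\omega_i\omega_{i+1}}=1$ for $0\le i\le n-2$. $E^n$ is the set of admissible strings of length $n$, $E^*=\bigcup_{n\ge1}E^n$. $X$ is finitely irreducible if there is a finite set $\Lambda\subset E^*$ such that for all $\omega,\omega'\in E^*$ there is $\lambda\in\Lambda$ with the concatenation $\omega\lambda\omega'\in E^*$ (for the full shift, where all $t_{ij}=1$, one may also use the empty string). For $\omega=\omega_0\cdots\omega_{n-1}\in E^n$ the $n$-cylinder is $[\omega]=[\omega_0,\ldots,\omega_{n-1}]=\{x\in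 X: x_i=\omega_i,\ 0\le i\le n-1\}$. Potentials. $S_n\phi=\sum_{i=0}^{n-1}\phi\circ\sigma^i$ and $Z_n(\phi)=\sum_{\omega\in E^n}\sup_{[\omega]}\exp S_n\phi$. $\phi\colon X\to\mathbb R$ is summable if $Z_1(\phi)<\infty$. For summable $\phi$, $\beta_\infty(\phi)=\inf\{\beta\in\mathbb R:\beta\phi\text{ is summable}\}$. $\phi$ has summable variations if $\sum_{n=1}^\infty\sup_{\omega\in E^n}\sup_{x,y\in[\omega]}(\phi(x)-\phi(y))<\infty$. Measures. $\mathcal M$ is the space of Borel probability measures on $X$ with the weak*-topology (convergence of integrals of bounded continuous functions), $\mathcal M(\sigma|_X)$ its subset of shift-invariant measures, $h(\mu)$ the Kolmogorov–Sinai entropy of $\mu\in\mathcal M(\sigma|_X)$ with respect to $\sigma|_X$, $\mathcal M_\phi(\sigma|_X)=\{\mu\in\mathcal M(\sigma|_X):\int\phi\,d\mu>-\infty\}$, and $P(\phi)=\sup\{h(\mu)+\int\phi\,d\mu:\mu\in\mathcal M_\phi(\sigma|_X)\}$. Equilibrium states for $\phi$ are the measures in $\mathcal M_\phi(\sigma|_X)$ attaining this supremum (the terminology is used when $P(\phi)<\infty$ and the variational principle $P(\phi)=\lim_n\frac1n\log Z_n(\phi)$ holds). A Borel probability measure $\mu_\phi$ on $X$ is a Gibbs state for $\phi$ if there are $c\ge1$ and $P\in\mathbb R$ such that for all $n\ge1$ and $x\in X$, $c^{-1}\le\mu_\phi[x_0,\ldots,x_{n-1}]/\exp(-Pn+S_n\phi(x))\le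 c$; it is a shift-invariant Gibbs state if it is moreover shift-invariant. Rate function. $F\colon\mathcal M\to[-\infty,0]$ is $F(\nu)=-P(\phi)+h(\nu)+\int\phi\,d\nu$ if $\nu\in\mathcal M_\phi(\sigma|_X)$ and $F(\nu)=-\infty$ otherwise. The rate function is $I(\mu)=-\inf_{\mathcal G\ni\mu}\sup_{\mathcal G}F$, the infimum being over all open subsets $\mathcal G$ of $\mathcal M$ containing $\mu$. A minimizer is a $\mu\in\mathcal M$ with $I(\mu)=0$. *)

theory Defs
  imports "HOL-Probability.Probability"
begin

section \<open>Countable Markov shifts\<close>

text \<open>The alphabet is a set \<open>S\<close> of an arbitrary type; functions on the shift space are total
  functions on \<open>nat \<Rightarrow> 'a\<close>, of which only the values on the shift space are ever used.\<close>

definition transition_matrix :: "'a set \<Rightarrow> ('a \<Rightarrow> 'a \<Rightarrow> nat) \<Rightarrow> bool" where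
  "transition_matrix S T \<longleftrightarrow>
     (\<forall>i\<in>S. \<forall>j\<in>S. T i j \<in> {0, 1}) \<and>
     (\<forall>i\<in>S. \<exists>j\<in>S. T i j \<noteq> 0) \<and>
     (\<forall>j\<in>S. \<exists>i\<in>S. T i j \<noteq> 0)"

definition markov_shift :: "'a set \<Rightarrow> ('a \<Rightarrow> 'a \<Rightarrow> nat) \<Rightarrow> (nat \<Rightarrow> 'a) set" where
  "markov_shift S T = {x. (\<forall>i. x i \<in> S) \<and> (\<forall>i. T (x i) (x (Suc i)) = 1)}"

definition left_shift :: "(nat \<Rightarrow> 'a) \<Rightarrow> nat \<Rightarrow> 'a" where
  "left_shift x = (\<lambda>i. x (Suc i))"

definition shift_topology :: "'a set \<Rightarrow> ('a \<Rightarrow> 'a \<Rightarrow> nat) \<Rightarrow> (nat \<Rightarrow> 'a) topology" where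
  "shift_topology S T =
     subtopology (product_topology (\<lambda>_. discrete_topology S) UNIV) (markov_shift S T)"

definition words :: "'a set \<Rightarrow> ('a \<Rightarrow> 'a \<Rightarrow> nat) \<Rightarrow> nat \<Rightarrow> 'a list set" where
  "words S T n = {w. length w = n \<and> n \<ge> 1 \<and> set w \<subseteq> S \<and>
     (\<forall>i. i + 1 < n \<longrightarrow> T (w ! i) (w ! (i + 1)) = 1)}"

definition all_words :: "'a set \<Rightarrow> ('a \<Rightarrow> 'a \<Rightarrow> nat) \<Rightarrow> 'a list set" where
  "all_words S T = (\<Union>n\<in>{1..}. words S T n)"

text \<open>The empty connecting string is allowed for the full shift only.\<close>

definition finitely_irreducible :: "'a set \<Rightarrow> ('a \<Rightarrow> 'a \<Rightarrow> nat) \<Rightarrow> bool" where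
  "finitely_irreducible S T \<longleftrightarrow>
     (\<exists>\<Lambda>. finite \<Lambda> \<and>
        \<Lambda> \<subseteq> all_words S T \<union> (if \<forall>i\<in>S. \<forall>j\<in>S. T i j = 1 then {[]} else {}) \<and>
        (\<forall>w\<in>all_words S T. \<forall>w'\<in>all_words S T. \<exists>l\<in>\<Lambda>. w @ l @ w' \<in> all_words S T))"

definition cylinder :: "'a set \<Rightarrow> ('a \<Rightarrow> 'a \<Rightarrow> nat) \<Rightarrow> 'a list \<Rightarrow> (nat \<Rightarrow> 'a) set" where
  "cylinder S T w = {x \<in> markov_shift S T. \<forall>i<length w. x i = w ! i}"


section \<open>Potentials\<close>

definition birkhoff_sum :: "nat \<Rightarrow> ((nat \<Rightarrow> 'a) \<Rightarrow> real) \<Rightarrow> (nat \<Rightarrow> 'a) \<Rightarrow> real" where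
  "birkhoff_sum n \<phi> x = (\<Sum>i<n. \<phi> ((left_shift ^^ i) x))"

definition partition_function ::
    "'a set \<Rightarrow> ('a \<Rightarrow> 'a \<Rightarrow> nat) \<Rightarrow> nat \<Rightarrow> ((nat \<Rightarrow> 'a) \<Rightarrow> real) \<Rightarrow> ennreal" where
  "partition_function S T n \<phi> =
     (\<Sum>\<^sub>\<infinity>w\<in>words S T n. SUP x\<in>cylinder S T w. ennreal (exp (birkhoff_sum n \<phi> x)))"

definition summable_potential ::
    "'a set \<Rightarrow> ('a \<Rightarrow> 'a \<Rightarrow> nat) \<Rightarrow> ((nat \<Rightarrow> 'a) \<Rightarrow> real) \<Rightarrow> bool" where
  "summable_potential S T \<phi> \<longleftrightarrow> partition_function S T 1 \<phi> < \<infinity>"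

definition beta_infinity ::
    "'a set \<Rightarrow> ('a \<Rightarrow> 'a \<Rightarrow> nat) \<Rightarrow> ((nat \<Rightarrow> 'a) \<Rightarrow> real) \<Rightarrow> ereal" where
  "beta_infinity S T \<phi> = (INF \<beta>\<in>{\<beta>. summable_potential S T (\<lambda>x. \<beta> * \<phi> x)}. ereal \<beta>)"

text \<open>The summands are nonnegative, as \<open>x = y\<close> is allowed.\<close>

definition summable_variations ::
    "'a set \<Rightarrow> ('a \<Rightarrow> 'a \<Rightarrow> nat) \<Rightarrow> ((nat \<Rightarrow> 'a) \<Rightarrow> real) \<Rightarrow> bool" where
  "summable_variations S T \<phi> \<longleftrightarrow>
     (\<Sum>n. SUP w\<in>words S T (Suc n). SUP x\<in>cylinder S T w. SUP y\<in>cylinder S T w.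
            ereal (\<phi> x - \<phi> y)) < \<infinity>"


section \<open>Borel probability measures and the weak* topology\<close>

definition borel_of_topology :: "'b topology \<Rightarrow> 'b measure" where
  "borel_of_topology X = sigma (topspace X) {U. openin X U}"

definition prob_measures :: "'b topology \<Rightarrow> 'b measure set" where
  "prob_measures X = {\<mu>. prob_space \<mu> \<and> sets \<mu> = sets (borel_of_topology X)}"

definition weak_star_topology :: "'b topology \<Rightarrow> 'b measure topology" where
  "weak_star_topology X = topology_generated_by
     {{\<mu> \<in> prob_measures X. (\<integral>x. f x \<partial>\<mu>) \<in> U} | f (U :: real set).
        continuous_map X euclideanreal f \<and> bounded (f ` topspace X) \<and> open U}"

definition invariant_measures ::
    "'a set \<Rightarrow> ('a \<Rightarrow> 'a \<Rightarrow> nat) \<Rightarrow> (nat \<Rightarrow> 'a) measure set" where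
  "invariant_measures S T = {\<mu> \<in> prob_measures (shift_topology S T).
     \<forall>A\<in>sets \<mu>. emeasure \<mu> (left_shift -` A \<inter> space \<mu>) = emeasure \<mu> A}"


section \<open>Kolmogorov--Sinai entropy\<close>

definition partition_entropy :: "'b measure \<Rightarrow> 'b set set \<Rightarrow> real" where
  "partition_entropy \<mu> \<P> = - (\<Sum>A\<in>\<P>. measure \<mu> A * ln (measure \<mu> A))"

text \<open>The join of the preimages of \<open>\<P>\<close> under the first \<open>n\<close> iterates of \<open>f\<close>. The empty set may
  occur as an element; it does not contribute to the entropy.\<close>

definition iterated_join :: "'b set \<Rightarrow> ('b \<Rightarrow> 'b) \<Rightarrow> 'b set set \<Rightarrow> nat \<Rightarrow> 'b set set" where
  "iterated_join \<Omega> f \<P> n =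
     (\<lambda>A. {x \<in> \<Omega>. \<forall>i<n. (f ^^ i) x \<in> A i}) ` ({..<n} \<rightarrow>\<^sub>E \<P>)"

text \<open>For \<open>f\<close>-invariant \<open>\<mu>\<close> the limit exists by subadditivity.\<close>

definition entropy_wrt_partition :: "'b measure \<Rightarrow> ('b \<Rightarrow> 'b) \<Rightarrow> 'b set set \<Rightarrow> real" where
  "entropy_wrt_partition \<mu> f \<P> =
     lim (\<lambda>n. partition_entropy \<mu> (iterated_join (space \<mu>) f \<P> n) / real n)"

definition ks_entropy :: "'b measure \<Rightarrow> ('b \<Rightarrow> 'b) \<Rightarrow> ereal" where
  "ks_entropy \<mu> f =
     (SUP \<P>\<in>{\<P>. finite \<P> \<and> \<P> \<subseteq> sets \<mu> \<and> partition_on (space \<mu>) \<P>}.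
        ereal (entropy_wrt_partition \<mu> f \<P>))"


section \<open>Pressure, equilibrium states, Gibbs states\<close>

text \<open>The integral with values in the extended reals: integral of the positive part minus integral
  of the negative part (\<open>ennreal\<close> maps negative reals to 0). Summable potentials
  are bounded above, so that the first term is finite.\<close>

definition ext_integral :: "'b measure \<Rightarrow> ('b \<Rightarrow> real) \<Rightarrow> ereal" where
  "ext_integral \<mu> \<phi> =
     enn2ereal (\<integral>\<^sup>+x. ennreal (\<phi> x) \<partial>\<mu>) - enn2ereal (\<integral>\<^sup>+x. ennreal (- \<phi> x) \<partial>\<mu>)"

definition invariant_measures_pot ::
    "'a set \<Rightarrow> ('a \<Rightarrow> 'a \<Rightarrow> nat) \<Rightarrow> ((nat \<Rightarrow> 'a) \<Rightarrow> real) \<Rightarrow> (nat \<Rightarrow> 'a) measure set" where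
  "invariant_measures_pot S T \<phi> = {\<mu> \<in> invariant_measures S T. ext_integral \<mu> \<phi> > -\<infinity>}"

definition pressure ::
    "'a set \<Rightarrow> ('a \<Rightarrow> 'a \<Rightarrow> nat) \<Rightarrow> ((nat \<Rightarrow> 'a) \<Rightarrow> real) \<Rightarrow> ereal" where
  "pressure S T \<phi> =
     (SUP \<mu>\<in>invariant_measures_pot S T \<phi>. ks_entropy \<mu> left_shift + ext_integral \<mu> \<phi>)"

definition ext_ln :: "ennreal \<Rightarrow> ereal" where
  "ext_ln z = (if z = 0 then -\<infinity> else if z = \<infinity> then \<infinity> else ereal (ln (enn2real z)))"

definition variational_principle ::
    "'a set \<Rightarrow> ('a \<Rightarrow> 'a \<Rightarrow> nat) \<Rightarrow> ((nat \<Rightarrow> 'a) \<Rightarrow> real) \<Rightarrow> bool" where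
  "variational_principle S T \<phi> \<longleftrightarrow>
     (\<lambda>n. ext_ln (partition_function S T n \<phi>) / ereal (real n)) \<longlonglongrightarrow> pressure S T \<phi>"

text \<open>The notion is only used for potentials of finite pressure that satisfy the variational
  principle; both requirements are part of the definition.\<close>

definition equilibrium_state ::
    "'a set \<Rightarrow> ('a \<Rightarrow> 'a \<Rightarrow> nat) \<Rightarrow> ((nat \<Rightarrow> 'a) \<Rightarrow> real) \<Rightarrow> (nat \<Rightarrow> 'a) measure \<Rightarrow> bool" where
  "equilibrium_state S T \<phi> \<mu> \<longleftrightarrow>
     pressure S T \<phi> < \<infinity> \<and> variational_principle S T \<phi> \<and>
     \<mu> \<in> invariant_measures_pot S T \<phi> \<and>
     ks_entropy \<mu> left_shift + ext_integral \<mu> \<phi> = pressure S T \<phi>"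

definition gibbs_state ::
    "'a set \<Rightarrow> ('a \<Rightarrow> 'a \<Rightarrow> nat) \<Rightarrow> ((nat \<Rightarrow> 'a) \<Rightarrow> real) \<Rightarrow> (nat \<Rightarrow> 'a) measure \<Rightarrow> bool" where
  "gibbs_state S T \<phi> \<mu> \<longleftrightarrow> \<mu> \<in> prob_measures (shift_topology S T) \<and>
     (\<exists>c P :: real. c \<ge> 1 \<and>
        (\<forall>n\<ge>1. \<forall>x\<in>markov_shift S T.
           inverse c \<le> measure \<mu> (cylinder S T (map x [0..<n]))
                         / exp (- P * real n + birkhoff_sum n \<phi> x) \<and>
           measure \<mu> (cylinder S T (map x [0..<n]))
             / exp (- P * real n + birkhoff_sum n \<phi> x) \<le> c))"

definition invariant_gibbs_state ::
    "'a set \<Rightarrow> ('a \<Rightarrow> 'a \<Rightarrow> nat) \<Rightarrow> ((nat \<Rightarrow> 'a) \<Rightarrow> real) \<Rightarrow> (nat \<Rightarrow> 'a) measure \<Rightarrow> bool" where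
  "invariant_gibbs_state S T \<phi> \<mu> \<longleftrightarrow> gibbs_state S T \<phi> \<mu> \<and> \<mu> \<in> invariant_measures S T"


section \<open>The rate function\<close>

definition free_energy ::
    "'a set \<Rightarrow> ('a \<Rightarrow> 'a \<Rightarrow> nat) \<Rightarrow> ((nat \<Rightarrow> 'a) \<Rightarrow> real) \<Rightarrow> (nat \<Rightarrow> 'a) measure \<Rightarrow> ereal" where
  "free_energy S T \<phi> \<nu> =
     (if \<nu> \<in> invariant_measures_pot S T \<phi>
      then - pressure S T \<phi> + ks_entropy \<nu> left_shift + ext_integral \<nu> \<phi>
      else -\<infinity>)"

definition rate_function ::
    "'a set \<Rightarrow> ('a \<Rightarrow> 'a \<Rightarrow> nat) \<Rightarrow> ((nat \<Rightarrow> 'a) \<Rightarrow> real) \<Rightarrow> (nat \<Rightarrow> 'a) measure \<Rightarrow> ereal" where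
  "rate_function S T \<phi> \<mu> =
     - (INF \<G>\<in>{\<G>. openin (weak_star_topology (shift_topology S T)) \<G> \<and> \<mu> \<in> \<G>}.
          SUP \<nu>\<in>\<G>. free_energy S T \<phi> \<nu>)"

definition minimizer ::
    "'a set \<Rightarrow> ('a \<Rightarrow> 'a \<Rightarrow> nat) \<Rightarrow> ((nat \<Rightarrow> 'a) \<Rightarrow> real) \<Rightarrow> (nat \<Rightarrow> 'a) measure \<Rightarrow> bool" where
  "minimizer S T \<phi> \<mu> \<longleftrightarrow>
     \<mu> \<in> prob_measures (shift_topology S T) \<and> rate_function S T \<phi> \<mu> = 0"

end

theory Submission
  imports Defs
begin

text \<open>Let \<open>\<mu>\<close> be an invariant Gibbs measure with constants \<open>c\<close> and \<open>P\<close>. Comparing the entropy of an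
  invariant \<open>\<nu>\<close> with test distributions on words built from \<open>\<mu>\<close> (Gibbs' inequality) gives, for every
  union \<open>C\<close> of \<open>n\<close>-cylinders, \<open>\<nu>(C) ln (1 / \<mu>(C)) \<le> ln (2 c) - n F(\<nu>)\<close>. For \<open>C = X\<close> this is
  \<open>F \<le> 0\<close>. The left-hand side is weak* continuous, so a minimizer \<open>\<nu>\<close> of the rate function is
  invariant and satisfies \<open>\<nu>(C) ln (1 / \<mu>(C)) \<le> ln (2 c)\<close> for all \<open>n\<close> and \<open>C\<close>. Hence
  \<open>\<nu>\<close> is absolutely continuous with respect to \<open>\<mu>\<close>, and \<open>\<nu> = \<mu>\<close> because \<open>\<mu>\<close> is ergodic by finite
  irreducibility. Conversely \<open>\<beta>\<^sub>\<infinity> < 1\<close> makes \<open>\<phi>\<close> integrable with respect to \<open>\<mu>\<close>, and a direct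
  estimate gives \<open>h(\<mu>) + \<integral>\<phi> d\<mu> \<ge> P\<close>, so that \<open>F(\<mu>) = 0\<close>. As this applies to every invariant Gibbs
  measure, there is at most one. One exists: average the position of a word in a random word of length
  \<open>2 N\<close> with weights \<open>exp S\<^sub>2\<^sub>N\<phi>\<close>; finite irreducibility bounds these averages above and below by
  constant multiples of \<open>exp (S\<^sub>n\<phi> - n P)\<close>, and a subsequential limit is a consistent, shift-invariant
  family of cylinder masses by dominated convergence.\<close>

section \<open>The shift space and its Borel sets\<close>

text \<open>With an infinite alphabet the space of measures is not compact and \<open>F\<close> need
  not be upper semicontinuous. A zero of the rate function is a priori only a point near which
  \<open>F\<close> comes arbitrarily close to 0, not an invariant measure with \<open>F = 0\<close>.
  The entropy estimate must therefore survive a weak* limit without control of \<open>\<phi>\<close>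
  or of the entropy in that limit; it does because \<open>\<nu>\<close> enters only through
  \<open>F\<close> and the mass of a clopen set. In \<open>ln (2 c)\<close> the 2 comes from mixing
  two test distributions with equal weights.

  Entropy is a supremum over finite partitions, while the natural generator, the one-letter
  cylinders, is infinite. The upper bound hence predicts the labels of an arbitrary finite partition
  from finitely many letters with small error; the lower bound merges all but finitely many letters
  into one tail set, whose cost is a tail of an integral.

  In a word of length \<open>2 N\<close> only positions below \<open>N\<close> are averaged, so that
  short words never run over the end and moving all positions by one changes the average by at most
  \<open>1 / N\<close>.\<close>

abbreviation prefix_word :: "nat \<Rightarrow> (nat \<Rightarrow> 'a) \<Rightarrow> 'a list" where
  "prefix_word n x \<equiv> map x [0..<n]"

lemma left_shift_iterate: "(left_shift ^^ n) x = (\<lambda>i. x (n + i))"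
  by (induction n arbitrary: x) (simp_all add: left_shift_def funpow_Suc_right del: funpow.simps(2))

lemma drop_prefix_word: "drop n (prefix_word (n + m) x) = prefix_word m ((left_shift ^^ n) x)"
  by (rule nth_equalityI) (auto simp: left_shift_iterate)

lemma take_prefix_word: "n \<le> m \<Longrightarrow> take n (prefix_word m x) = prefix_word n x"
  by (rule nth_equalityI) auto

lemma prefix_word_add:
  "prefix_word (n + m) x = prefix_word n x @ prefix_word m ((left_shift ^^ n) x)"
  by (metis append_take_drop_id drop_prefix_word le_add1 take_prefix_word)

lemma prefix_word_eq_iff: "prefix_word n x = w \<longleftrightarrow> length w = n \<and> (\<forall>i<n. x i = w ! i)"
  by (auto simp: list_eq_iff_nth_eq)

section \<open>Admissible words, cylinders and points of the shift\<close>

locale countable_shift =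
  fixes S :: "'a set" and T :: "'a \<Rightarrow> 'a \<Rightarrow> nat"
  assumes countable_alphabet: "countable S"
    and nonempty_alphabet: "S \<noteq> {}"
    and matrix: "transition_matrix S T"
begin

abbreviation X :: "(nat \<Rightarrow> 'a) set" where "X \<equiv> markov_shift S T"
abbreviation cyl :: "'a list \<Rightarrow> (nat \<Rightarrow> 'a) set" where "cyl \<equiv> cylinder S T"
abbreviation W :: "nat \<Rightarrow> 'a list set" where "W \<equiv> words S T"
abbreviation \<B> :: "(nat \<Rightarrow> 'a) measure" where "\<B> \<equiv> borel_of_topology (shift_topology S T)"

lemma cyl_iff: "x \<in> cyl w \<longleftrightarrow> x \<in> X \<and> prefix_word (length w) x = w"
  by (auto simp: cylinder_def prefix_word_eq_iff)

lemma cyl_prefix: "x \<in> X \<Longrightarrow> x \<in> cyl (prefix_word n x)"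
  by (simp add: cyl_iff)

lemma cyl_subset: "cyl w \<subseteq> X"
  by (auto simp: cyl_iff)

lemma cyl_Nil [simp]: "cyl [] = X"
  by (auto simp: cylinder_def)

lemma shift_in_X: "x \<in> X \<Longrightarrow> left_shift x \<in> X"
  by (auto simp: markov_shift_def left_shift_def)

lemma shift_iterate_in_X: "x \<in> X \<Longrightarrow> (left_shift ^^ n) x \<in> X"
  by (induction n) (auto simp: shift_in_X)

lemma set_prefix_word: "x \<in> X \<Longrightarrow> set (prefix_word n x) \<subseteq> S"
  by (auto simp: markov_shift_def)

lemma prefix_in_words: "x \<in> X \<Longrightarrow> n \<ge> 1 \<Longrightarrow> prefix_word n x \<in> W n"
  by (auto simp: words_def markov_shift_def)

lemma W_countable: "countable (W n)"
proof -
  have "W n \<subseteq> lists S" by (auto simp: words_def)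
  then show ?thesis using countable_alphabet countable_lists countable_subset by blast
qed

text \<open>No row of the matrix vanishes, so every letter has an admissible successor; iterating a
  choice of successors continues the word to a point.\<close>

lemma cyl_nonempty: assumes "w \<in> W n" shows "\<exists>x. x \<in> cyl w"
proof -
  from matrix have ex: "\<exists>j\<in>S. T i j = 1" if "i \<in> S" for i
    using that unfolding transition_matrix_def by (metis insertE singletonD)
  define nxt where "nxt i = (SOME j. j \<in> S \<and> T i j = 1)" for i
  have nxt: "nxt i \<in> S \<and> T i (nxt i) = 1" if "i \<in> S" for i
    unfolding nxt_def by (rule someI_ex) (use ex[OF that] in blast)
  have n: "length w = n" "n \<ge> 1" and wS: "set w \<subseteq> S"
    and adm: "\<And>i. i + 1 < n \<Longrightarrow> T (w ! i) (w ! (i + 1)) = 1"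
    using assms by (auto simp: words_def)
  \<comment> \<open>The exponent \<open>i + 1 - n\<close> is 1 at \<open>i = n\<close>, so the first
    letter after the word is the successor of its last letter.\<close>
  define x where "x i = (if i < n then w ! i else (nxt ^^ (i + 1 - n)) (w ! (n - 1)))" for i
  have last: "w ! (n - 1) \<in> S" using n wS by auto
  have inS: "(nxt ^^ k) (w ! (n - 1)) \<in> S" for k
    by (induction k) (use last nxt in auto)
  have "x i \<in> S" for i
    using n wS inS by (auto simp: x_def)
  moreover have "T (x i) (x (Suc i)) = 1" for i
  proof -
    consider "Suc i < n" | "Suc i = n" | "n \<le> i" by linarith
    then show ?thesis
    proof cases
      case 1 then show ?thesis using adm[of i] by (simp add: x_def)
    next
      case 2 then have "i = n - 1" by simp
      then show ?thesis using 2 nxt[OF last] by (simp add: x_def)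
    next
      case 3
      then have "Suc i + 1 - n = Suc (i + 1 - n)" by simp
      then show ?thesis using 3 nxt[OF inS] by (simp add: x_def)
    qed
  qed
  ultimately have "x \<in> cyl w"
    using n by (auto simp: cylinder_def markov_shift_def x_def)
  then show ?thesis by blast
qed

lemma X_nonempty: "X \<noteq> {}"
proof -
  obtain a where "a \<in> S" using nonempty_alphabet by auto
  then have "[a] \<in> W 1" by (auto simp: words_def)
  then show ?thesis using cyl_nonempty[of "[a]" 1] cyl_subset by blast
qed

section \<open>Topology and Borel sets\<close>

lemma topspace_shift [simp]: "topspace (shift_topology S T) = X"
  by (auto simp: shift_topology_def markov_shift_def)

lemma openin_cyl: "openin (shift_topology S T) (cyl w)"
proof -
  have "openin (product_topology (\<lambda>_. discrete_topology S) UNIV)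
      (PiE UNIV (\<lambda>i. if i < length w then {w ! i} \<inter> S else S))"
    by (subst openin_PiE_gen) (auto intro: finite_subset[of _ "{..<length w}"])
  moreover have "cyl w = PiE UNIV (\<lambda>i. if i < length w then {w ! i} \<inter> S else S) \<inter> X"
    by (auto simp: cylinder_def markov_shift_def PiE_iff split: if_splits) metis
  ultimately show ?thesis
    unfolding shift_topology_def openin_subtopology by blast
qed

lemma openin_shift_iff:
  "openin (shift_topology S T) U \<longleftrightarrow> U \<subseteq> X \<and> (\<forall>x\<in>U. \<exists>n. cyl (prefix_word n x) \<subseteq> U)"
proof safe
  fix x assume "openin (shift_topology S T) U" "x \<in> U"
  then show "x \<in> X" using openin_subset by fastforce
next
  fix x assume U: "openin (shift_topology S T) U" and x: "x \<in> U"
  obtain V where V: "openin (product_topology (\<lambda>_. discrete_topology S) UNIV) V" and UV: "U = V \<inter> X"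
    using U unfolding shift_topology_def openin_subtopology by auto
  obtain C where fin: "finite {i. C i \<noteq> S}" and C: "x \<in> Pi\<^sub>E UNIV C" "Pi\<^sub>E UNIV C \<subseteq> V"
    using V x UV unfolding openin_product_topology_alt by (auto simp: Ball_def)
  \<comment> \<open>The prefix reaches beyond every coordinate that the basic open set restricts;
    \<open>insert 0\<close> covers the case that there is none.\<close>
  define n where "n = Suc (Max (insert 0 {i. C i \<noteq> S}))"
  have n: "i < n" if "C i \<noteq> S" for i
    using that fin Max_ge[of "insert 0 {i. C i \<noteq> S}" i] by (auto simp: n_def less_Suc_eq_le)
  have "cyl (prefix_word n x) \<subseteq> U"
  proof
    fix y assume y: "y \<in> cyl (prefix_word n x)"
    then have "y \<in> X" and yx: "\<And>i. i < n \<Longrightarrow> y i = x i"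
      by (auto simp: cylinder_def)
    have "y i \<in> C i" for i
      using n[of i] yx[of i] C(1) \<open>y \<in> X\<close> by (cases "C i = S") (auto simp: markov_shift_def PiE_iff)
    then show "y \<in> U" using C(2) \<open>y \<in> X\<close> UV by auto
  qed
  then show "\<exists>n. cyl (prefix_word n x) \<subseteq> U" ..
next
  assume UX: "U \<subseteq> X" and n: "\<forall>x\<in>U. \<exists>n. cyl (prefix_word n x) \<subseteq> U"
  have "U = \<Union>{cyl w |w. cyl w \<subseteq> U}"
  proof
    show "U \<subseteq> \<Union>{cyl w |w. cyl w \<subseteq> U}"
    proof
      fix x assume x: "x \<in> U"
      then obtain k where "cyl (prefix_word k x) \<subseteq> U" using n by blast
      moreover have "x \<in> cyl (prefix_word k x)" using x UX by (intro cyl_prefix) auto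
      ultimately show "x \<in> \<Union>{cyl w |w. cyl w \<subseteq> U}" by blast
    qed
  qed auto
  moreover have "openin (shift_topology S T) (\<Union>{cyl w |w. cyl w \<subseteq> U})"
    by (intro openin_Union) (auto intro: openin_cyl)
  ultimately show "openin (shift_topology S T) U" by simp
qed

lemma space_borel [simp]: "space \<B> = X"
  by (simp add: borel_of_topology_def space_measure_of_conv)

lemma openin_sets: "openin (shift_topology S T) U \<Longrightarrow> U \<in> sets \<B>"
  unfolding borel_of_topology_def using openin_subset[of "shift_topology S T"]
  by (subst sets_measure_of) (auto intro: sigma_sets.Basic)

lemma cyl_sets [measurable, simp]: "cyl w \<in> sets \<B>"
  by (intro openin_sets openin_cyl)

text \<open>Over a countable alphabet there are only countably many cylinders. This is what lets
  them generate the Borel sets and not merely the topology.\<close>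

lemma openin_countable_union:
  assumes "openin (shift_topology S T) U"
  shows "U = (\<Union>w\<in>{w\<in>lists S. cyl w \<subseteq> U}. cyl w)"
proof -
  have "\<exists>w\<in>lists S. cyl w \<subseteq> U \<and> x \<in> cyl w" if x: "x \<in> U" for x
  proof -
    obtain n where n: "cyl (prefix_word n x) \<subseteq> U" and "x \<in> X"
      using assms x unfolding openin_shift_iff by blast
    moreover have "prefix_word n x \<in> lists S" using set_prefix_word[OF \<open>x \<in> X\<close>, of n] by auto
    ultimately show ?thesis using cyl_prefix by blast
  qed
  then show ?thesis by blast
qed

lemma sets_borel_cyl: "sets \<B> = sigma_sets X (insert {} (cyl ` lists S))"
proof
  have "openin (shift_topology S T) U \<Longrightarrow> U \<in> sigma_sets X (insert {} (cyl ` lists S))" for U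
  proof (subst openin_countable_union, assumption)
    have "countable {w \<in> lists S. cyl w \<subseteq> U}"
      using countable_alphabet countable_lists by (auto intro: countable_subset[of _ "lists S"])
    then show "(\<Union>w\<in>{w\<in>lists S. cyl w \<subseteq> U}. cyl w) \<in> sigma_sets X (insert {} (cyl ` lists S))"
      by (intro sigma_sets_UNION) (auto intro: sigma_sets.Basic)
  qed
  then have "sigma_sets X {U. openin (shift_topology S T) U} \<subseteq> sigma_sets X (insert {} (cyl ` lists S))"
    by (intro sigma_sets_mono) auto
  then show "sets \<B> \<subseteq> sigma_sets X (insert {} (cyl ` lists S))"
    unfolding borel_of_topology_def using openin_subset[of "shift_topology S T"]
    by (subst sets_measure_of) auto
  show "sigma_sets X (insert {} (cyl ` lists S)) \<subseteq> sets \<B>"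
    using sets.sigma_sets_subset[of "insert {} (cyl ` lists S)" \<B>] cyl_sets by (auto simp: image_subset_iff)
qed

text \<open>Two cylinders are nested or disjoint, according to whether one word is a prefix of the
  other; the empty set is added to the generator for the disjoint case.\<close>

lemma Int_stable_cyl: "Int_stable (insert {} (cyl ` lists S))"
proof (rule Int_stableI)
  have *: "cyl u \<inter> cyl v \<in> {{}, cyl v}" if "length u \<le> length v" for u v :: "'a list"
  proof (cases "cyl u \<inter> cyl v = {}")
    case False
    then obtain y where y: "y \<in> cyl u" "y \<in> cyl v" by auto
    then have "u = take (length u) v"
      using take_prefix_word[OF that, of y] by (simp add: cyl_iff)
    then have "cyl v \<subseteq> cyl u"
      by (metis (no_types, lifting) cyl_iff subsetI take_prefix_word that)
    then show ?thesis by auto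
  qed auto
  fix a b assume "a \<in> insert {} (cyl ` lists S)" "b \<in> insert {} (cyl ` lists S)"
  then show "a \<inter> b \<in> insert {} (cyl ` lists S)"
  proof (safe, goal_cases)
    case (1 u v)
    then show ?case using *[of u v] *[of v u]
      by (cases "length u \<le> length v") (auto simp: Int_commute)
  qed
qed

lemma prob_measures_iff:
  "\<mu> \<in> prob_measures (shift_topology S T) \<longleftrightarrow> prob_space \<mu> \<and> sets \<mu> = sets \<B>"
  by (simp add: prob_measures_def)

lemma space_eq_X: "sets \<mu> = sets \<B> \<Longrightarrow> space \<mu> = X"
  using sets_eq_imp_space_eq[of \<mu> \<B>] by simp

text \<open>Cylinders are an intersection-stable generator that contains \<open>X\<close>, as the
  cylinder of the empty word, so they determine a probability measure.\<close>

lemma measure_eq_cyl: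
  assumes "prob_space M" "prob_space N" "sets M = sets \<B>" "sets N = sets \<B>"
    and eq: "\<And>w. measure M (cyl w) = measure N (cyl w)"
  shows "M = N"
proof (rule measure_eqI_generator_eq[OF Int_stable_cyl, where \<Omega> = X and A = "\<lambda>_. X"])
  interpret M: prob_space M by fact
  interpret N: prob_space N by fact
  show "insert {} (cyl ` lists S) \<subseteq> Pow X" using cyl_subset by auto
  show "range (\<lambda>_::nat. X) \<subseteq> insert {} (cyl ` lists S)"
    using cyl_Nil by (auto simp: image_iff intro!: bexI[of _ "[]"])
  show "emeasure M A = emeasure N A" if "A \<in> insert {} (cyl ` lists S)" for A
    using that eq by (auto simp: M.emeasure_eq_measure N.emeasure_eq_measure)
  show "emeasure M X \<noteq> \<infinity>" for i :: nat by simp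
qed (use assms sets_borel_cyl in auto)

section \<open>Unions of cylinders of a fixed length, and approximation by them\<close>

definition prefix_set :: "nat \<Rightarrow> 'a list set \<Rightarrow> (nat \<Rightarrow> 'a) set" where
  "prefix_set n Q = {x \<in> X. prefix_word n x \<in> Q}"

lemma prefix_set_union: "prefix_set n Q = (\<Union>w\<in>{w\<in>Q. w \<in> lists S \<and> length w = n}. cyl w)"
  using set_prefix_word[of _ n] by (auto simp: prefix_set_def cyl_iff subset_iff in_lists_conv_set)

text \<open>The complement in \<open>X\<close> of a prefix set is the prefix set of the
  complementary words, so these possibly infinite unions of cylinders are clopen. Their masses are
  therefore weak* continuous, which is why they, and not general Borel sets, carry the
  estimates.\<close>

lemma openin_prefix_set: "openin (shift_topology S T) (prefix_set n Q)"
  unfolding prefix_set_union by (intro openin_Union) (auto intro: openin_cyl)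

lemma prefix_set_sets [measurable, simp]: "prefix_set n Q \<in> sets \<B>"
  by (intro openin_sets openin_prefix_set)

lemma cyl_eq_prefix_set: "cyl w = prefix_set (length w) {w}"
  by (auto simp: cyl_iff prefix_set_def)

lemma measurable_prefix_word [measurable]: "prefix_word n \<in> \<B> \<rightarrow>\<^sub>M count_space UNIV"
proof (rule measurableI)
  fix A show "prefix_word n -` A \<inter> space \<B> \<in> sets \<B>"
    using prefix_set_sets[of n A] by (simp add: prefix_set_def vimage_def Int_def conj_commute del: prefix_set_sets)
qed simp

lemma shift_vimage_prefix_set:
  "(left_shift ^^ k) -` prefix_set n Q \<inter> X = prefix_set (k + n) {w. drop k w \<in> Q}"
  using shift_iterate_in_X[of _ k] by (auto simp: prefix_set_def drop_prefix_word simp del: map_map drop_map)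

lemma measurable_shift_iterate [measurable]: "left_shift ^^ k \<in> \<B> \<rightarrow>\<^sub>M \<B>"
proof (rule measurable_sigma_sets[OF sets_borel_cyl])
  show "insert {} (cyl ` lists S) \<subseteq> Pow X" using cyl_subset by auto
  show "left_shift ^^ k \<in> space \<B> \<rightarrow> X" by (auto simp: shift_iterate_in_X)
  fix A assume "A \<in> insert {} (cyl ` lists S)"
  then show "(left_shift ^^ k) -` A \<inter> space \<B> \<in> sets \<B>"
    by (auto simp: cyl_eq_prefix_set shift_vimage_prefix_set)
qed

lemma measurable_shift [measurable]: "left_shift \<in> \<B> \<rightarrow>\<^sub>M \<B>"
  using measurable_shift_iterate[of 1] by simp

text \<open>The sets that prefix sets approximate form a \<sigma>-algebra containing the cylinders.
  Working with the sum of the two measures yields one prefix set that is good for both, as the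
  comparison of \<open>\<nu>\<close> with \<open>\<mu>\<close> requires.\<close>

lemma approximation_by_prefix_sets:
  assumes M: "finite_measure M" "sets M = sets \<B>" and N: "finite_measure N" "sets N = sets \<B>"
    and A: "A \<in> sets \<B>" and e: "e > 0"
  shows "\<exists>n Q. measure M ((A - prefix_set n Q) \<union> (prefix_set n Q - A)) < e \<and>
               measure N ((A - prefix_set n Q) \<union> (prefix_set n Q - A)) < e"
proof -
  interpret M: finite_measure M by fact
  interpret N: finite_measure N by fact
  note [measurable_cong] = M(2) N(2)
  define m where "m B = measure M B + measure N B" for B
  have m_mono: "m B \<le> m C" if "B \<subseteq> C" "C \<in> sets \<B>" for B C
    unfolding m_def using that M N by (intro add_mono M.finite_measure_mono N.finite_measure_mono) auto
  have m_Un: "m (B \<union> C) \<le> m B + m C" if "B \<in> sets \<B>" "C \<in> sets \<B>" for B C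
    unfolding m_def using that M N measure_Un_le[of B M C] measure_Un_le[of B N C] by auto
  have "\<forall>e>0. \<exists>n Q. m ((A - prefix_set n Q) \<union> (prefix_set n Q - A)) < e"
    using A unfolding sets_borel_cyl
  proof (induction A rule: sigma_sets.induct)
    case (Basic a)
    moreover have "{} = prefix_set 0 {}" by (simp add: prefix_set_def)
    ultimately obtain n Q where "a = prefix_set n Q"
      using cyl_eq_prefix_set by blast
    then have "m ((a - prefix_set n Q) \<union> (prefix_set n Q - a)) = 0" by (simp add: m_def)
    then show ?case by metis
  next
    case Empty
    have "m (({} - prefix_set 0 {}) \<union> (prefix_set 0 {} - {})) = 0" by (simp add: prefix_set_def m_def)
    then show ?case by metis
  next
    case (Compl a)
    \<comment> \<open>Complementing both the set and its approximant leaves the symmetric difference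
      unchanged.\<close>
    have "(X - a - prefix_set n (- Q)) \<union> (prefix_set n (- Q) - (X - a)) =
          (a - prefix_set n Q) \<union> (prefix_set n Q - a)" for n Q
      using Compl(1) sets.sets_into_space[of a \<B>] sets_borel_cyl by (auto simp: prefix_set_def)
    then show ?case using Compl.IH by metis
  next
    case (Union a)
    show ?case
    proof (intro allI impI)
      fix e :: real assume e: "e > 0"
      have a [measurable]: "a i \<in> sets \<B>" for i using Union(1) sets_borel_cyl by auto
      have "(\<lambda>k. m (\<Union>i<k. a i)) \<longlonglongrightarrow> m (\<Union>k. \<Union>i<k. a i)"
      proof -
        have inc: "incseq (\<lambda>k. \<Union>i<k. a i)"
          unfolding incseq_def by (intro allI impI UN_mono) auto
        have "range (\<lambda>k. \<Union>i<k. a i) \<subseteq> sets \<B>" using a by blast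
        then show ?thesis
          unfolding m_def using inc M(2) N(2)
          by (intro tendsto_add M.finite_Lim_measure_incseq N.finite_Lim_measure_incseq) auto
      qed
      moreover have "(\<Union>k. \<Union>i<k. a i) = (\<Union>i. a i)" by auto
      ultimately have "\<forall>\<^sub>F k in sequentially. m (\<Union>i<k. a i) > m (\<Union>i. a i) - e / 2"
        using e by (intro order_tendstoD) auto
      then obtain k where k: "m (\<Union>i<k. a i) > m (\<Union>i. a i) - e / 2"
        by (meson eventually_at_top_linorder order_refl)
      have "m ((\<Union>i. a i) - (\<Union>i<k. a i)) = m (\<Union>i. a i) - m (\<Union>i<k. a i)"
      proof -
        have sub: "(\<Union>i<k. a i) \<subseteq> (\<Union>i. a i)" and sets: "(\<Union>i<k. a i) \<in> sets \<B>" "(\<Union>i. a i) \<in> sets \<B>"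
          using a by blast+
        show ?thesis
          unfolding m_def using M.finite_measure_Diff[OF _ _ sub] N.finite_measure_Diff[OF _ _ sub] sets M(2) N(2)
          by simp
      qed
      then have rest: "m ((\<Union>i. a i) - (\<Union>i<k. a i)) < e / 2" using k by simp
      \<comment> \<open>The tolerance lets the \<open>k\<close> approximation errors add up to less
        than \<open>e / 2\<close>; the other half is spent on the discarded tail of the
        union.\<close>
      have "\<forall>i. \<exists>n Q. m ((a i - prefix_set n Q) \<union> (prefix_set n Q - a i)) < e / (2 * (k + 1))"
        using Union.IH e by simp
      then obtain n Q where nQ: "\<And>i. m ((a i - prefix_set (n i) (Q i)) \<union> (prefix_set (n i) (Q i) - a i)) < e / (2 * (k + 1))"
        by metis
      \<comment> \<open>A common length turns the union of the \<open>k\<close> prefix sets into a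
        single prefix set.\<close>
      define l where "l = Max (insert 0 (n ` {..<k}))"
      have l: "n i \<le> l" if "i < k" for i unfolding l_def using that by simp
      define R where "R = {w. \<exists>i<k. take (n i) w \<in> Q i}"
      have R: "prefix_set l R = (\<Union>i<k. prefix_set (n i) (Q i))"
        using l by (auto simp: prefix_set_def R_def take_prefix_word simp del: take_map)
      let ?D = "\<lambda>i. (a i - prefix_set (n i) (Q i)) \<union> (prefix_set (n i) (Q i) - a i)"
      have D [measurable]: "?D i \<in> sets \<B>" for i by measurable
      have Dk: "m (\<Union>i<j. ?D i) \<le> j * (e / (2 * (k + 1)))" for j :: nat
      proof (induction j)
        case (Suc j)
        have "m (\<Union>i<Suc j. ?D i) = m ((\<Union>i<j. ?D i) \<union> ?D j)"
          by (simp add: lessThan_Suc Un_commute)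
        also have "\<dots> \<le> m (\<Union>i<j. ?D i) + m (?D j)" by (intro m_Un) (auto intro!: sets.finite_UN D)
        also have "\<dots> \<le> j * (e / (2 * (k + 1))) + e / (2 * (k + 1))"
          using Suc nQ[of j] by linarith
        finally show ?case by (simp add: algebra_simps add_divide_distrib)
      qed (simp add: m_def)
      have "k * (e / (2 * (k + 1))) < e / 2" using e by (simp add: field_simps)
      then have Dk2: "m (\<Union>i<k. ?D i) < e / 2" using Dk[of k] by linarith
      have "m (((\<Union>i. a i) - prefix_set l R) \<union> (prefix_set l R - (\<Union>i. a i)))
          \<le> m (((\<Union>i. a i) - (\<Union>i<k. a i)) \<union> (\<Union>i<k. ?D i))"
        unfolding R by (intro m_mono) (auto intro!: sets.finite_UN D)
      also have "\<dots> \<le> m ((\<Union>i. a i) - (\<Union>i<k. a i)) + m (\<Union>i<k. ?D i)"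
        by (intro m_Un) (auto intro!: sets.finite_UN D)
      also have "\<dots> < e" using rest Dk2 by linarith
      finally show "\<exists>n Q. m (((\<Union>i. a i) - prefix_set n Q) \<union> (prefix_set n Q - (\<Union>i. a i))) < e" by blast
    qed
  qed
  then obtain n Q where "m ((A - prefix_set n Q) \<union> (prefix_set n Q - A)) < e" using e by blast
  moreover have "measure M B \<ge> 0" "measure N B \<ge> 0" for B by auto
  ultimately have "measure M ((A - prefix_set n Q) \<union> (prefix_set n Q - A)) < e \<and>
               measure N ((A - prefix_set n Q) \<union> (prefix_set n Q - A)) < e"
    unfolding m_def by (smt (verit, best))
  then show ?thesis by blast
qed

end

section \<open>Entropy of finite partitions\<close>

text \<open>Division of \<open>n\<close> by a fixed \<open>k\<close> with remainder shows that the
  limit is the infimum of \<open>a n / n\<close>; the linear lower bound keeps this infimum finite.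
  The second conclusion records the infimum and gives the sharp growth bounds needed later.\<close>

lemma fekete:
  fixes a :: "nat \<Rightarrow> real"
  assumes sub: "\<And>m n. a (m + n) \<le> a m + a n" and lower: "\<And>n. real n * L \<le> a n"
  obtains l where "(\<lambda>n. a n / real n) \<longlonglongrightarrow> l" "\<And>n. real n * l \<le> a n"
proof -
  define l where "l = (INF n\<in>{1..}. a n / real n)"
  have bdd: "bdd_below ((\<lambda>n. a n / real n) ` {1..})"
    using lower by (intro bdd_belowI2[of _ L]) (auto simp: field_simps)
  have l_le: "l \<le> a n / real n" if "n \<ge> 1" for n
    unfolding l_def using that bdd by (intro cINF_lower) auto
  \<comment> \<open>The summand \<open>a 0\<close> is there for \<open>q = 0\<close>, since
    \<open>a 0\<close> may be positive.\<close>
  have mult: "a (q * k) \<le> real q * a k + a 0" for q k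
  proof (induction q)
    case (Suc q)
    have "a (Suc q * k) \<le> a k + a (q * k)" using sub[of k "q * k"] by simp
    then show ?case using Suc by (simp add: algebra_simps)
  qed simp
  have a0: "a 0 \<ge> 0" using sub[of 0 0] by simp
  have "(\<lambda>n. a n / real n) \<longlonglongrightarrow> l"
  proof (rule LIMSEQ_I)
    fix e :: real assume e: "e > 0"
    then have "l < l + e / 2" by simp
    then obtain k where k: "k \<ge> 1" "a k / real k < l + e / 2"
      unfolding l_def using cINF_less_iff[OF _ bdd] by (metis atLeast_iff empty_iff order_refl)
    \<comment> \<open>\<open>C\<close> absorbs the finitely many possible remainders
      \<open>r < k\<close> together with the correction for replacing a multiple of \<open>k\<close>
      by \<open>n\<close>.\<close>
    define C where "C = Max ((\<lambda>r. a r + \<bar>r * (a k / k)\<bar>) ` {..<k}) + a 0"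
    have C: "a r + \<bar>real r * (a k / k)\<bar> + a 0 \<le> C" if "r < k" for r
      unfolding C_def using that by (intro add_right_mono Max_ge) auto
    have up: "a n \<le> real n * (a k / k) + C" for n
    proof -
      have "a n \<le> a (n div k * k) + a (n mod k)" using sub[of "n div k * k" "n mod k"] by simp
      also have "\<dots> \<le> real (n div k) * a k + a 0 + a (n mod k)" using mult[of "n div k" k] by simp
      also have "real (n div k) * a k = real (n div k * k) * (a k / k)" using k by simp
      also have "real (n div k * k) = real n - real (n mod k)"
        by (metis add_diff_cancel_right' div_mod_decomp of_nat_add)
      finally have "a n \<le> real n * (a k / k) - real (n mod k) * (a k / k) + a 0 + a (n mod k)"
        by (simp add: algebra_simps)
      moreover have "n mod k < k" using k by simp
      ultimately show ?thesis using C[of "n mod k"] abs_ge_minus_self[of "real (n mod k) * (a k / k)"] by linarith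
    qed
    obtain N :: nat where N: "real N > 2 * \<bar>C\<bar> / e" using reals_Archimedean2 by blast
    show "\<exists>no. \<forall>n\<ge>no. norm (a n / real n - l) < e"
    proof (intro exI allI impI)
      fix n assume n: "n \<ge> max 1 N"
      have "a n / n \<le> a k / k + C / n" using up[of n] n by (simp add: field_simps)
      moreover have "C / n < e / 2"
      proof -
        have "2 * \<bar>C\<bar> / e < real n" using N n by linarith
        then have "2 * \<bar>C\<bar> < e * n" using e by (simp add: field_simps)
        then show ?thesis using n by (simp add: field_simps)
      qed
      ultimately have "a n / n < l + e" using k(2) by linarith
      then show "norm (a n / real n - l) < e" using l_le[of n] n by (auto simp: abs_less_iff)
    qed
  qed
  moreover have "real n * l \<le> a n" for n
    using l_le[of n] a0 by (cases "n = 0") (auto simp: field_simps)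
  ultimately show ?thesis using that by blast
qed

section \<open>Invariant measures: transport of integrals under the shift\<close>

locale shift_invariant_measure = countable_shift S T + prob_space \<nu>
  for S :: "'a set" and T and \<nu> :: "(nat \<Rightarrow> 'a) measure" +
  assumes invariant: "\<nu> \<in> invariant_measures S T"
begin

lemma sets_nu [measurable_cong, simp]: "sets \<nu> = sets \<B>"
  using invariant by (simp add: invariant_measures_def prob_measures_iff)

lemma space_nu [simp]: "space \<nu> = X"
  by (rule space_eq_X) simp

lemma distr_shift: "distr \<nu> \<nu> (left_shift ^^ k) = \<nu>"
proof (induction k)
  case 0
  then show ?case using distr_id[of \<nu>] by (simp add: id_def)
next
  case (Suc k)
  have 1: "distr \<nu> \<nu> left_shift = \<nu>"
    using invariant by (intro measure_eqI) (auto simp: emeasure_distr invariant_measures_def)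
  have "distr (distr \<nu> \<nu> (left_shift ^^ k)) \<nu> left_shift = distr \<nu> \<nu> (left_shift \<circ> left_shift ^^ k)"
    by (rule distr_distr) auto
  then show ?case by (simp only: funpow.simps Suc 1)
qed

lemma integral_shift:
  fixes f :: "(nat \<Rightarrow> 'a) \<Rightarrow> real"
  assumes "f \<in> borel_measurable \<B>"
  shows "(\<integral>x. f ((left_shift ^^ k) x) \<partial>\<nu>) = (\<integral>x. f x \<partial>\<nu>)"
proof -
  have "(\<integral>x. f x \<partial>distr \<nu> \<nu> (left_shift ^^ k)) = (\<integral>x. f ((left_shift ^^ k) x) \<partial>\<nu>)"
    using assms by (intro integral_distr) auto
  then show ?thesis by (simp add: distr_shift)
qed

lemma integrable_shift:
  fixes f :: "(nat \<Rightarrow> 'a) \<Rightarrow> real"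
  assumes "integrable \<nu> f"
  shows "integrable \<nu> (\<lambda>x. f ((left_shift ^^ k) x))"
  using assms integrable_distr[of "left_shift ^^ k" \<nu> \<nu> f] by (simp add: distr_shift)

lemma measure_shift:
  assumes "A \<in> sets \<B>"
  shows "measure \<nu> ((left_shift ^^ k) -` A \<inter> X) = measure \<nu> A"
proof -
  have "measure (distr \<nu> \<nu> (left_shift ^^ k)) A = measure \<nu> ((left_shift ^^ k) -` A \<inter> X)"
    using assms by (subst measure_distr) auto
  then show ?thesis by (simp add: distr_shift)
qed

lemma indicator_const_integral:
  fixes c :: real
  assumes "A \<in> sets \<B>"
  shows "integrable \<nu> (\<lambda>x. indicator A x * c)" "(\<integral>x. indicator A x * c \<partial>\<nu>) = measure \<nu> A * c"
    "integrable \<nu> (indicator A :: _ \<Rightarrow> real)" "(\<integral>x. indicator A x \<partial>\<nu>) = measure \<nu> A"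
proof -
  have "A \<in> sets \<nu>" "A \<inter> space \<nu> = A" using assms sets.sets_into_space[OF assms] by auto
  then show int: "integrable \<nu> (indicator A :: _ \<Rightarrow> real)" "(\<integral>x. indicator A x \<partial>\<nu>) = measure \<nu> A"
    by (simp_all add: integrable_indicator_iff emeasure_eq_measure)
  then show "integrable \<nu> (\<lambda>x. indicator A x * c)" "(\<integral>x. indicator A x * c \<partial>\<nu>) = measure \<nu> A * c"
    by simp_all
qed

lemma integral_indicator_null:
  fixes f :: "(nat \<Rightarrow> 'a) \<Rightarrow> real"
  assumes "A \<in> sets \<B>" "measure \<nu> A = 0"
  shows "(\<integral>x. indicator A x * f x \<partial>\<nu>) = 0"
proof (rule integral_eq_zero_AE)
  have "A \<in> null_sets \<nu>" using assms by (simp add: null_sets_def emeasure_eq_measure)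
  from AE_not_in[OF this] show "AE x in \<nu>. indicator A x * f x = 0"
    by eventually_elim simp
qed

end

section \<open>Finite partitions, their joins and Gibbs' inequality\<close>

locale invariant_partition = shift_invariant_measure S T \<nu>
  for S :: "'a set" and T and \<nu> :: "(nat \<Rightarrow> 'a) measure" +
  fixes \<P> :: "(nat \<Rightarrow> 'a) set set"
  assumes finite_partition: "finite \<P>" and partition_sets: "\<P> \<subseteq> sets \<B>"
    and partition: "partition_on X \<P>"
begin

abbreviation codes :: "nat \<Rightarrow> (nat \<Rightarrow> (nat \<Rightarrow> 'a) set) set" where
  "codes m \<equiv> {..<m} \<rightarrow>\<^sub>E \<P>"

text \<open>Atoms are indexed by codes rather than collected as a set, so that test distributions
  can be put on the finite set of codes; some atoms may be empty.\<close>

definition atom :: "nat \<Rightarrow> (nat \<Rightarrow> (nat \<Rightarrow> 'a) set) \<Rightarrow> (nat \<Rightarrow> 'a) set" where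
  "atom m a = {x \<in> X. \<forall>i<m. (left_shift ^^ i) x \<in> a i}"

definition join_entropy :: "nat \<Rightarrow> real" where
  "join_entropy m = partition_entropy \<nu> (iterated_join (space \<nu>) left_shift \<P> m)"

lemma finite_codes: "finite (codes m)"
  using finite_partition by (intro finite_PiE) auto

lemma partition_unique: "x \<in> A \<Longrightarrow> x \<in> B \<Longrightarrow> A \<in> \<P> \<Longrightarrow> B \<in> \<P> \<Longrightarrow> A = B"
  using partition_onD2[OF partition] by (auto simp: disjoint_def)

lemma partition_ex: "x \<in> X \<Longrightarrow> \<exists>A\<in>\<P>. x \<in> A"
  using partition_onD1[OF partition] by auto

lemma partition_measurable [measurable]: "A \<in> \<P> \<Longrightarrow> A \<in> sets \<B>"
  using partition_sets by auto

lemma atom_sets: assumes "a \<in> codes m" shows "atom m a \<in> sets \<B>"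
proof -
  have "atom m a = (if m = 0 then X else (\<Inter>i\<in>{..<m}. (left_shift ^^ i) -` a i \<inter> X))"
    by (auto simp: atom_def)
  moreover have "X \<in> sets \<B>" using sets.top[of \<B>] by simp
  moreover have "(left_shift ^^ i) -` a i \<inter> X \<in> sets \<B>" if "i < m" for i
    using assms that measurable_sets[OF measurable_shift_iterate, of "a i" i] by (auto simp: PiE_iff)
  ultimately show ?thesis
    by (simp del: INT_simps) (intro impI sets.finite_INT, auto)
qed

lemma atom_unique:
  assumes "a \<in> codes m" "b \<in> codes m" "x \<in> atom m a" "x \<in> atom m b"
  shows "a = b"
proof (rule PiE_ext[OF assms(1,2)])
  fix i assume "i \<in> {..<m}"
  then show "a i = b i"
    using assms by (intro partition_unique[of "(left_shift ^^ i) x"]) (auto simp: atom_def)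
qed

lemma atom_disjoint: "disjoint_family_on (atom m) (codes m)"
  unfolding disjoint_family_on_def using atom_unique by blast

lemma atom_cover: "x \<in> X \<Longrightarrow> \<exists>a\<in>codes m. x \<in> atom m a"
proof -
  assume x: "x \<in> X"
  define a where "a = (\<lambda>i\<in>{..<m}. SOME A. A \<in> \<P> \<and> (left_shift ^^ i) x \<in> A)"
  have "a i \<in> \<P> \<and> (left_shift ^^ i) x \<in> a i" if "i < m" for i
    using someI_ex[of "\<lambda>A. A \<in> \<P> \<and> (left_shift ^^ i) x \<in> A"] partition_ex[OF shift_iterate_in_X[OF x, of i]] that
    unfolding a_def by auto
  then show ?thesis
    using x by (intro bexI[of _ a]) (auto simp: atom_def a_def)
qed

lemma sum_indicator_atoms:
  fixes g :: "(nat \<Rightarrow> (nat \<Rightarrow> 'a) set) \<Rightarrow> real"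
  assumes a: "a \<in> codes m" "x \<in> atom m a"
  shows "(\<Sum>b\<in>codes m. indicator (atom m b) x * g b) = g a"
proof -
  have "indicator (atom m b) x * g b = (if b = a then g a else 0)" if "b \<in> codes m" for b
  proof (cases "x \<in> atom m b")
    case True
    then show ?thesis using atom_unique[OF that a(1) True a(2)] by simp
  next
    case False
    then have "b \<noteq> a" using a(2) by auto
    then show ?thesis using False by simp
  qed
  then have "(\<Sum>b\<in>codes m. indicator (atom m b) x * g b) = (\<Sum>b\<in>codes m. if b = a then g a else 0)"
    by (rule sum.cong[OF refl])
  also have "\<dots> = g a" unfolding sum.delta[OF finite_codes] using a(1) by (rule if_P)
  finally show ?thesis .
qed

lemma UN_atom: "(\<Union>a\<in>codes m. atom m a) = X"
  using atom_cover by (auto simp: atom_def)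

lemma sum_measure_atom: "(\<Sum>a\<in>codes m. measure \<nu> (atom m a)) = 1"
proof -
  have "measure \<nu> (\<Union>a\<in>codes m. atom m a) = (\<Sum>a\<in>codes m. measure \<nu> (atom m a))"
    by (rule finite_measure_finite_Union[OF finite_codes _ atom_disjoint]) (use atom_sets in auto)
  then show ?thesis using prob_space by (simp add: UN_atom)
qed

lemma integral_split_atoms:
  fixes f :: "(nat \<Rightarrow> 'a) \<Rightarrow> real"
  assumes "integrable \<nu> f"
  shows "(\<integral>x. f x \<partial>\<nu>) = (\<Sum>a\<in>codes m. \<integral>x. indicator (atom m a) x * f x \<partial>\<nu>)"
    and "a \<in> codes m \<Longrightarrow> integrable \<nu> (\<lambda>x. indicator (atom m a) x * f x)"
proof -
  show int: "integrable \<nu> (\<lambda>x. indicator (atom m a) x * f x)" if "a \<in> codes m" for a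
    using integrable_mult_indicator[OF _ assms, of "atom m a"] atom_sets[OF that] by simp
  have "f x = (\<Sum>a\<in>codes m. indicator (atom m a) x * f x)" if x: "x \<in> X" for x
  proof -
    obtain b where b: "b \<in> codes m" "x \<in> atom m b" using atom_cover[OF x] by blast
    show ?thesis using sum_indicator_atoms[OF b, of "\<lambda>_. f x"] by simp
  qed
  then have "(\<integral>x. f x \<partial>\<nu>) = (\<integral>x. (\<Sum>a\<in>codes m. indicator (atom m a) x * f x) \<partial>\<nu>)"
    by (intro Bochner_Integration.integral_cong) auto
  also have "\<dots> = (\<Sum>a\<in>codes m. \<integral>x. indicator (atom m a) x * f x \<partial>\<nu>)"
    using int by (intro Bochner_Integration.integral_sum)
  finally show "(\<integral>x. f x \<partial>\<nu>) = (\<Sum>a\<in>codes m. \<integral>x. indicator (atom m a) x * f x \<partial>\<nu>)" .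
qed

text \<open>Different codes can share an atom only if it is empty, and the empty set contributes
  nothing, so the sum over sets equals the sum over codes.\<close>

lemma join_entropy_eq:
  "join_entropy m = (\<Sum>a\<in>codes m. - (measure \<nu> (atom m a) * ln (measure \<nu> (atom m a))))"
proof -
  have "iterated_join (space \<nu>) left_shift \<P> m = atom m ` codes m"
    by (auto simp: iterated_join_def atom_def)
  moreover have "(\<Sum>A\<in>atom m ` codes m. measure \<nu> A * ln (measure \<nu> A))
      = (\<Sum>a\<in>codes m. measure \<nu> (atom m a) * ln (measure \<nu> (atom m a)))"
  proof (subst sum.reindex_nontrivial)
    fix a b assume "a \<in> codes m" "b \<in> codes m" "a \<noteq> b" "atom m a = atom m b"
    then have "atom m a = {}" using atom_unique[of a m b] by auto
    then show "measure \<nu> (atom m a) * ln (measure \<nu> (atom m a)) = 0" by simp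
  qed (auto simp: finite_codes)
  ultimately show ?thesis
    by (simp add: join_entropy_def partition_entropy_def sum_negf)
qed

lemma join_entropy_nonneg: "join_entropy m \<ge> 0"
proof -
  have "- (p * ln p) \<ge> 0" if "0 \<le> p" "p \<le> 1" for p :: real
    using that by (cases "p = 0") (auto simp: mult_nonneg_nonpos)
  then show ?thesis unfolding join_entropy_eq by (intro sum_nonneg) simp
qed

text \<open>Gibbs' inequality: coding with any subprobability \<open>r\<close> costs at least the
  entropy. The cost \<open>- ln (r a)\<close> is bounded by a function \<open>L\<close> of the
  point, so that it can be a Birkhoff sum and be integrated by invariance.\<close>

lemma join_entropy_le:
  assumes r: "\<And>a. a \<in> codes m \<Longrightarrow> r a \<ge> 0" "(\<Sum>a\<in>codes m. r a) \<le> 1"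
    and L: "integrable \<nu> L"
    and le: "\<And>a x. a \<in> codes m \<Longrightarrow> measure \<nu> (atom m a) > 0 \<Longrightarrow> x \<in> atom m a \<Longrightarrow> exp (- L x) \<le> r a"
  shows "join_entropy m \<le> (\<integral>x. L x \<partial>\<nu>)"
proof -
  have 1: "- (measure \<nu> (atom m a) * ln (measure \<nu> (atom m a)))
      \<le> (\<integral>x. indicator (atom m a) x * L x \<partial>\<nu>) + r a - measure \<nu> (atom m a)" if a: "a \<in> codes m" for a
  proof (cases "measure \<nu> (atom m a) > 0")
    case False
    then have p: "measure \<nu> (atom m a) = 0" by (simp add: zero_less_measure_iff)
    then have "(\<integral>x. indicator (atom m a) x * L x \<partial>\<nu>) = 0"
      by (rule integral_indicator_null[OF atom_sets[OF a]])
    then show ?thesis using p r(1)[OF a] by simp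
  next
    case True
    let ?p = "measure \<nu> (atom m a)"
    obtain x where x: "x \<in> atom m a" using True by (metis ex_in_conv less_irrefl measure_empty)
    have ra: "r a > 0" using le[OF a True x] exp_gt_zero[of "- L x"] by linarith
    have "- ln (r a) \<le> L x" if "x \<in> atom m a" for x
    proof -
      have "- L x \<le> ln (r a)" using le[OF a True that] ra by (simp add: ln_ge_iff)
      then show ?thesis by simp
    qed
    then have "(\<integral>x. indicator (atom m a) x * (- ln (r a)) \<partial>\<nu>) \<le> (\<integral>x. indicator (atom m a) x * L x \<partial>\<nu>)"
      by (intro integral_mono indicator_const_integral atom_sets[OF a] integral_split_atoms(2)[OF L a])
        (auto simp: indicator_def)
    moreover have "(\<integral>x. indicator (atom m a) x * (- ln (r a)) \<partial>\<nu>) = ?p * (- ln (r a))"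
      by (rule indicator_const_integral[OF atom_sets[OF a]])
    \<comment> \<open>The inequality \<open>ln t \<le> t - 1\<close> at \<open>t = r a / ?p\<close>;
      summed over the codes, the right-hand sides give at most \<open>1 - 1\<close>.\<close>
    moreover have "?p * ln (r a / ?p) \<le> ?p * (r a / ?p - 1)"
      using ra True by (intro mult_left_mono ln_le_minus_one) auto
    moreover have "?p * ln (r a / ?p) = ?p * ln (r a) - ?p * ln ?p" "?p * (r a / ?p - 1) = r a - ?p"
      using True ra by (simp_all add: ln_div algebra_simps)
    ultimately show ?thesis by linarith
  qed
  have "join_entropy m \<le> (\<Sum>a\<in>codes m. (\<integral>x. indicator (atom m a) x * L x \<partial>\<nu>) + r a - measure \<nu> (atom m a))"
    unfolding join_entropy_eq by (intro sum_mono 1)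
  also have "\<dots> = (\<integral>x. L x \<partial>\<nu>) + (\<Sum>a\<in>codes m. r a) - 1"
    by (simp add: sum.distrib sum_subtractf sum_measure_atom integral_split_atoms(1)[OF L, of m])
  finally show ?thesis using r(2) by simp
qed

text \<open>Jensen's inequality on an atom of mass \<open>p\<close>: if \<open>exp L\<close> has
  integral at most 1 there, then the mean of \<open>L\<close> on the atom is at most
  \<open>- ln p\<close>. In the application \<open>exp L\<close> is dominated by the ratio of a word
  distribution chosen for the code to the law of the prefix.\<close>

lemma join_entropy_ge:
  assumes L: "integrable \<nu> L"
    and le: "\<And>a. a \<in> codes m \<Longrightarrow> (\<integral>\<^sup>+x. indicator (atom m a) x * ennreal (exp (L x)) \<partial>\<nu>) \<le> 1"
  shows "(\<integral>x. L x \<partial>\<nu>) \<le> join_entropy m"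
proof -
  have [measurable]: "L \<in> borel_measurable \<nu>" using L by auto
  have 1: "(\<integral>x. indicator (atom m a) x * L x \<partial>\<nu>) \<le> - (measure \<nu> (atom m a) * ln (measure \<nu> (atom m a)))"
    if a: "a \<in> codes m" for a
  proof (cases "measure \<nu> (atom m a) > 0")
    case False
    then have p: "measure \<nu> (atom m a) = 0" by (simp add: zero_less_measure_iff)
    then have "(\<integral>x. indicator (atom m a) x * L x \<partial>\<nu>) = 0"
      by (rule integral_indicator_null[OF atom_sets[OF a]])
    then show ?thesis using p by simp
  next
    case True
    let ?p = "measure \<nu> (atom m a)" and ?I = "indicator (atom m a) :: _ \<Rightarrow> real"
    note A [measurable] = atom_sets[OF a]
    have nn: "(\<integral>\<^sup>+x. ennreal (?I x * exp (L x)) \<partial>\<nu>) \<le> 1"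
      using le[OF a] by (simp add: ennreal_mult ennreal_indicator)
    then have int: "integrable \<nu> (\<lambda>x. ?I x * exp (L x))"
      by (intro integrableI_nonneg) (auto intro: order.strict_trans1)
    have "ennreal (\<integral>x. ?I x * exp (L x) \<partial>\<nu>) \<le> 1"
      using nn by (subst nn_integral_eq_integral[symmetric, OF int]) auto
    then have int1: "(\<integral>x. ?I x * exp (L x) \<partial>\<nu>) \<le> 1"
      by (simp add: ennreal_le_1)
    have "(\<integral>x. ?I x * L x \<partial>\<nu>) + ?p * ln ?p = (\<integral>x. ?I x * L x + ?I x * ln ?p \<partial>\<nu>)"
      by (subst Bochner_Integration.integral_add)
        (auto simp only: integral_split_atoms(2)[OF L a] indicator_const_integral[OF A])
    also have "\<dots> \<le> (\<integral>x. ?p * (?I x * exp (L x)) - ?I x \<partial>\<nu>)"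
    proof (intro integral_mono)
      fix x
      \<comment> \<open>Here \<open>ln t \<le> t - 1\<close> is used at
        \<open>t = ?p * exp (L x)\<close>; the factor \<open>?p\<close> makes the integrated bound
        nonpositive.\<close>
      have "L x + ln ?p = ln (?p * exp (L x))" using True by (simp add: ln_mult)
      also have "\<dots> \<le> ?p * exp (L x) - 1" using True by (intro ln_le_minus_one) simp
      finally show "?I x * L x + ?I x * ln ?p \<le> ?p * (?I x * exp (L x)) - ?I x"
        by (auto simp: indicator_def)
    qed (intro Bochner_Integration.integrable_add Bochner_Integration.integrable_diff
          integrable_mult_right int integral_split_atoms(2)[OF L a] indicator_const_integral[OF A])+
    also have "\<dots> = ?p * (\<integral>x. ?I x * exp (L x) \<partial>\<nu>) - ?p"
      using int indicator_const_integral[OF A] by (subst Bochner_Integration.integral_diff) auto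
    also have "\<dots> \<le> 0" using int1 True by (simp add: mult_left_le)
    finally show ?thesis by simp
  qed
  have "(\<integral>x. L x \<partial>\<nu>) = (\<Sum>a\<in>codes m. \<integral>x. indicator (atom m a) x * L x \<partial>\<nu>)"
    by (rule integral_split_atoms(1)[OF L])
  also have "\<dots> \<le> join_entropy m" unfolding join_entropy_eq by (intro sum_mono 1)
  finally show ?thesis .
qed

text \<open>The test distribution is the product of the laws of the first \<open>m\<close> and the
  last \<open>n\<close> labels. Its cost is the sum of two information functions, the second
  evaluated at a shifted point, and invariance removes the shift under the integral.\<close>

lemma join_entropy_add: "join_entropy (m + n) \<le> join_entropy m + join_entropy n"
proof -
  define info where "info m x = (\<Sum>a\<in>codes m. indicator (atom m a) x * (- ln (measure \<nu> (atom m a))))" for m x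
  have info_int: "integrable \<nu> (info m)" for m
    unfolding info_def by (intro Bochner_Integration.integrable_sum indicator_const_integral atom_sets)
  have info_eq: "(\<integral>x. info m x \<partial>\<nu>) = join_entropy m" for m
    unfolding info_def join_entropy_eq
    by (subst Bochner_Integration.integral_sum)
      (auto intro!: sum.cong simp only: indicator_const_integral atom_sets)
  have info: "info m x = - ln (measure \<nu> (atom m a))" if "a \<in> codes m" "x \<in> atom m a" for m a x
    unfolding info_def by (rule sum_indicator_atoms[OF that])
  define L where "L x = info m x + info n ((left_shift ^^ m) x)" for x
  define hd_part where "hd_part a = restrict a {..<m}" for a :: "nat \<Rightarrow> (nat \<Rightarrow> 'a) set"
  define tl_part where "tl_part a = (\<lambda>i\<in>{..<n}. a (m + i))" for a :: "nat \<Rightarrow> (nat \<Rightarrow> 'a) set"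
  have hd: "hd_part a \<in> codes m" and tl: "tl_part a \<in> codes n" if "a \<in> codes (m + n)" for a
    using that by (auto simp: hd_part_def tl_part_def PiE_iff)
  have at: "atom (m + n) a = atom m (hd_part a) \<inter> ((left_shift ^^ m) -` atom n (tl_part a) \<inter> X)" for a
  proof -
    have "(\<forall>i<m + n. R i) \<longleftrightarrow> (\<forall>i<m. R i) \<and> (\<forall>i<n. R (m + i))" for R :: "nat \<Rightarrow> bool"
    proof safe
      fix i assume "\<forall>i<m. R i" "\<forall>i<n. R (m + i)" "i < m + n"
      then show "R i" by (cases "i < m") (auto dest!: spec[of _ "i - m"])
    qed auto
    moreover have "(left_shift ^^ i) ((left_shift ^^ m) x) = (left_shift ^^ (m + i)) x" for i and x :: "nat \<Rightarrow> 'a"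
      by (simp add: left_shift_iterate add.assoc)
    ultimately show ?thesis
      by (auto simp: atom_def hd_part_def tl_part_def shift_iterate_in_X)
  qed
  define r where "r a = measure \<nu> (atom m (hd_part a)) * measure \<nu> (atom n (tl_part a))" for a
  have "join_entropy (m + n) \<le> (\<integral>x. L x \<partial>\<nu>)"
  proof (rule join_entropy_le[where r = r])
    show "r a \<ge> 0" for a by (simp add: r_def)
    have inj: "inj_on (\<lambda>a. (hd_part a, tl_part a)) (codes (m + n))"
    proof (rule inj_onI)
      fix a b assume ab: "a \<in> codes (m + n)" "b \<in> codes (m + n)" "(hd_part a, tl_part a) = (hd_part b, tl_part b)"
      show "a = b"
      proof (rule PiE_ext[OF ab(1,2)])
        fix i assume "i \<in> {..<m + n}"
        then show "a i = b i"
        proof (cases "i < m")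
          case True
          then show ?thesis using ab(3) by (metis Pair_inject hd_part_def lessThan_iff restrict_apply')
        next
          case False
          then obtain j where j: "i = m + j" "j < n"
            using \<open>i \<in> {..<m + n}\<close> by (metis add_diff_inverse_nat lessThan_iff nat_add_left_cancel_less)
          then show ?thesis using ab(3) by (metis Pair_inject tl_part_def lessThan_iff restrict_apply')
        qed
      qed
    qed
    have "(\<Sum>a\<in>codes (m + n). r a) =
      (\<Sum>(u, v)\<in>(\<lambda>a. (hd_part a, tl_part a)) ` codes (m + n). measure \<nu> (atom m u) * measure \<nu> (atom n v))"
      by (subst sum.reindex[OF inj]) (simp add: r_def)
    also have "\<dots> \<le> (\<Sum>(u, v)\<in>codes m \<times> codes n. measure \<nu> (atom m u) * measure \<nu> (atom n v))"
    proof (rule sum_mono2)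
      show "(\<lambda>a. (hd_part a, tl_part a)) ` codes (m + n) \<subseteq> codes m \<times> codes n"
        by (intro image_subsetI SigmaI hd tl)
      show "finite (codes m \<times> codes n)" using finite_codes by (rule finite_cartesian_product[rotated]) (rule finite_codes)
    qed (simp add: case_prod_beta)
    also have "\<dots> = 1"
      by (simp add: sum.cartesian_product[symmetric] sum_product[symmetric] sum_measure_atom)
    finally show "(\<Sum>a\<in>codes (m + n). r a) \<le> 1" .
    show "integrable \<nu> L"
      unfolding L_def using info_int by (intro Bochner_Integration.integrable_add integrable_shift) auto
    fix a x assume a: "a \<in> codes (m + n)" "measure \<nu> (atom (m + n) a) > 0" and x: "x \<in> atom (m + n) a"
    have x': "x \<in> atom m (hd_part a)" "(left_shift ^^ m) x \<in> atom n (tl_part a)"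
      using x unfolding at by auto
    have s: "(left_shift ^^ m) -` atom n (tl_part a) \<inter> X \<in> sets \<B>"
      using measurable_sets[OF measurable_shift_iterate atom_sets[OF tl[OF a(1)]], of m] by simp
    have "measure \<nu> (atom (m + n) a) \<le> measure \<nu> (atom m (hd_part a))"
      unfolding at using atom_sets[OF hd[OF a(1)]] by (intro finite_measure_mono) auto
    moreover have "measure \<nu> (atom (m + n) a) \<le> measure \<nu> ((left_shift ^^ m) -` atom n (tl_part a) \<inter> X)"
      unfolding at using s by (intro finite_measure_mono) auto
    moreover have "measure \<nu> ((left_shift ^^ m) -` atom n (tl_part a) \<inter> X) = measure \<nu> (atom n (tl_part a))"
      by (rule measure_shift[OF atom_sets[OF tl[OF a(1)]]])
    ultimately have "measure \<nu> (atom m (hd_part a)) > 0" "measure \<nu> (atom n (tl_part a)) > 0"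
      using a(2) by linarith+
    then show "exp (- L x) \<le> r a"
      using info[OF hd[OF a(1)] x'(1)] info[OF tl[OF a(1)] x'(2)]
      by (simp add: L_def r_def exp_add)
  qed
  also have "(\<integral>x. L x \<partial>\<nu>) = join_entropy m + join_entropy n"
    unfolding L_def using info_int[of m] info_int[of n]
    by (subst Bochner_Integration.integral_add) (auto simp: integrable_shift integral_shift info_eq)
  finally show ?thesis .
qed

text \<open>The \<open>lim\<close> in the definition of the entropy carries information only once
  convergence is known; subadditivity supplies it.\<close>

lemma entropy_limit: "(\<lambda>m. join_entropy m / real m) \<longlonglongrightarrow> entropy_wrt_partition \<nu> left_shift \<P>"
proof -
  have "real n * 0 \<le> join_entropy n" for n using join_entropy_nonneg by simp
  from fekete[OF join_entropy_add this]
  obtain l where "(\<lambda>m. join_entropy m / real m) \<longlonglongrightarrow> l" by blast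
  then show ?thesis
    unfolding entropy_wrt_partition_def join_entropy_def[symmetric] by (simp add: limI)
qed

end

section \<open>Upper bound for the entropy from a distribution on words\<close>

lemma concat_prefix_words:
  "concat (map (\<lambda>j. prefix_word n ((left_shift ^^ (j * n)) x)) [0..<M]) = prefix_word (M * n) x"
proof (induction M)
  case (Suc M)
  then show ?case using prefix_word_add[where n = "M * n" and m = n and x = x] by (simp add: add.commute)
qed simp

text \<open>A single outcome contributes this much to the expectation. It is used for the one block
  sequence that is read off from the actual point.\<close>

lemma pmf_times_le_expectation:
  fixes F :: "'b \<Rightarrow> real"
  assumes "\<And>y. 0 \<le> F y" "\<And>y. F y \<le> 1"
  shows "pmf p y * F y \<le> measure_pmf.expectation p F"
proof -
  have int: "integrable (measure_pmf p) F"
    using assms by (intro measure_pmf.integrable_const_bound[where B = 1]) auto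
  have "pmf p y * F y = measure_pmf.expectation p (\<lambda>z. indicator {y} z * F y)"
    by (subst integral_measure_pmf[of "{y}"]) (auto simp: indicator_def split: if_splits)
  also have "\<dots> \<le> measure_pmf.expectation p F"
    using assms by (intro integral_mono int measure_pmf.integrable_const_bound[where B = 1]) (auto simp: indicator_def)
  finally show ?thesis .
qed

context invariant_partition
begin

lemma partition_nonempty: "\<P> \<noteq> {}"
  using partition_onD1[OF partition] X_nonempty by auto

text \<open>Each partition element is approximated by a prefix set, and a word is labelled by an
  element whose prefix set contains it. The first \<open>k\<close> letters thus predict the element
  with a small probability of error.\<close>

lemma partition_approximation:
  assumes "e > 0"
  obtains k lab where "\<And>w. lab w \<in> \<P>" "measure \<nu> {x \<in> X. x \<notin> lab (prefix_word k x)} < e"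
    "{x \<in> X. x \<notin> lab (prefix_word k x)} \<in> sets \<B>"
proof -
  \<comment> \<open>One error of size \<open>e'\<close> for each element of \<open>\<P>\<close>; the
    \<open>+ 1\<close> makes the total strictly smaller than \<open>e\<close>.\<close>
  define e' where "e' = e / (card \<P> + 1)"
  have e': "e' > 0" using assms by (simp add: e'_def)
  have "\<exists>n Q. measure \<nu> ((A - prefix_set n Q) \<union> (prefix_set n Q - A)) < e'" if "A \<in> \<P>" for A
    using approximation_by_prefix_sets[of \<nu> \<nu> A e'] that e' finite_measure_axioms by auto
  then obtain n Q where nQ: "\<And>A. A \<in> \<P> \<Longrightarrow> measure \<nu> ((A - prefix_set (n A) (Q A)) \<union> (prefix_set (n A) (Q A) - A)) < e'"
    by metis
  define k where "k = Max (n ` \<P>)"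
  have k: "n A \<le> k" if "A \<in> \<P>" for A
    unfolding k_def using that finite_partition by (intro Max_ge) auto
  define A0 where "A0 = (SOME A. A \<in> \<P>)"
  have A0: "A0 \<in> \<P>" unfolding A0_def using partition_nonempty by (simp add: some_in_eq)
  \<comment> \<open>The prefix sets may overlap or fail to cover: an arbitrary candidate is chosen
    if there is one, and \<open>A0\<close> is the default.\<close>
  define lab where "lab w = (if \<exists>A\<in>\<P>. take (n A) w \<in> Q A then SOME A. A \<in> \<P> \<and> take (n A) w \<in> Q A else A0)" for w
  have lab_in: "lab w \<in> \<P> \<and> take (n (lab w)) w \<in> Q (lab w)" if "\<exists>A\<in>\<P>. take (n A) w \<in> Q A" for w
    using someI_ex[of "\<lambda>A. A \<in> \<P> \<and> take (n A) w \<in> Q A"] that by (auto simp: lab_def)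
  have lab: "lab w \<in> \<P>" for w
    using lab_in[of w] A0 by (cases "\<exists>A\<in>\<P>. take (n A) w \<in> Q A") (auto simp: lab_def)
  let ?bad = "{x \<in> X. x \<notin> lab (prefix_word k x)}"
  let ?D = "\<lambda>A. (A - prefix_set (n A) (Q A)) \<union> (prefix_set (n A) (Q A) - A)"
  have D: "?D A \<in> sets \<B>" if "A \<in> \<P>" for A using that by measurable
  have bad_eq: "?bad = (\<Union>A\<in>\<P>. {x \<in> X. lab (prefix_word k x) = A} - A)"
    using lab by auto
  have "{x \<in> X. lab (prefix_word k x) = A} = prefix_set k {w. lab w = A}" for A
    by (auto simp: prefix_set_def)
  then have bad_sets: "?bad \<in> sets \<B>"
    unfolding bad_eq using finite_partition by (intro sets.finite_UN) auto
  \<comment> \<open>A wrong label means either that the prefix set of the chosen element contains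
    the point while the element does not, or that no prefix set detected the point, in particular
    not that of its own element.\<close>
  have "?bad \<subseteq> (\<Union>A\<in>\<P>. ?D A)"
  proof
    fix x assume "x \<in> ?bad"
    then have x: "x \<in> X" "x \<notin> lab (prefix_word k x)" by auto
    have pre: "x \<in> prefix_set (n A) (Q A) \<longleftrightarrow> take (n A) (prefix_word k x) \<in> Q A" if "A \<in> \<P>" for A
      using x k[OF that] by (simp add: prefix_set_def take_prefix_word del: take_map)
    obtain A where A: "A \<in> \<P>" "x \<in> A" using partition_ex[OF x(1)] by blast
    show "x \<in> (\<Union>A\<in>\<P>. ?D A)"
    proof (cases "\<exists>A\<in>\<P>. take (n A) (prefix_word k x) \<in> Q A")
      case True
      then have "x \<in> ?D (lab (prefix_word k x))" using lab_in[OF True] pre x by blast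
      then show ?thesis using lab by blast
    next
      case False
      then have "x \<in> ?D A" using A pre by blast
      then show ?thesis using A by blast
    qed
  qed
  then have "measure \<nu> ?bad \<le> measure \<nu> (\<Union>A\<in>\<P>. ?D A)"
    using D finite_partition by (intro finite_measure_mono) auto
  also have "\<dots> \<le> (\<Sum>A\<in>\<P>. measure \<nu> (?D A))"
    using D finite_partition by (intro finite_measure_subadditive_finite) auto
  also have "\<dots> \<le> (\<Sum>A\<in>\<P>. e')" using nQ by (intro sum_mono) (auto intro: less_imp_le)
  also have "\<dots> < e" using assms by (simp add: e'_def field_simps)
  finally show ?thesis using that[OF lab _ bad_sets] by blast
qed

text \<open>The test distribution for the join of length \<open>m\<close> draws independent blocks from \<open>D\<close> and perturbs
  the label that a block sequence predicts with probability \<open>\<delta>\<close>.\<close>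

lemma join_entropy_le_blocks:
  fixes D :: "'a list pmf" and f :: "(nat \<Rightarrow> 'a) \<Rightarrow> real"
  assumes n: "n \<ge> 1" and f: "integrable \<nu> f"
    and fD: "\<And>x. x \<in> X \<Longrightarrow> exp (- f x) \<le> pmf D (prefix_word n x)"
    and lab: "\<And>w. lab w \<in> \<P>" and bad: "measure \<nu> {x \<in> X. x \<notin> lab (prefix_word k x)} < e"
    and bad_sets: "{x \<in> X. x \<notin> lab (prefix_word k x)} \<in> sets \<B>"
    and \<delta>: "0 < \<delta>" "\<delta> < 1"
  shows "join_entropy m \<le> (real (m + k) / n + 1) * (\<integral>x. f x \<partial>\<nu>)
           + m * (- ln (1 - \<delta>) + e * ln (card \<P> / \<delta>))"
proof -
  \<comment> \<open>Labels at times below \<open>m\<close> look up to \<open>k\<close> letters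
    ahead, so the \<open>M\<close> blocks have to cover \<open>m + k\<close> letters.\<close>
  define M where "M = (m + k) div n + 1"
  have Mn: "m + k \<le> M * n"
  proof -
    have "m + k = (m + k) div n * n + (m + k) mod n" by simp
    also have "\<dots> \<le> (m + k) div n * n + n"
      using mod_less_divisor[of n "m + k"] n by (intro add_left_mono) linarith
    finally show ?thesis by (simp add: M_def)
  qed
  have M_le: "real M \<le> real (m + k) / n + 1"
    using of_nat_div_le_of_nat[of "m + k" n, where 'a = real] by (simp add: M_def)
  have card: "real (card \<P>) \<ge> 1"
    using partition_nonempty finite_partition by (simp add: Suc_le_eq card_gt_0_iff)
  \<comment> \<open>The probability of label \<open>A\<close> when \<open>B\<close> is predicted. It
    is positive for every \<open>A\<close>, so that a wrong prediction costs only
    \<open>ln (card \<P> / \<delta>)\<close> and not infinity.\<close>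
  define \<kappa> where "\<kappa> A B = (if A = B then 1 - \<delta> else \<delta> / card \<P>)" for A B :: "(nat \<Rightarrow> 'a) set"
  have \<kappa>01: "0 < \<kappa> A B" "\<kappa> A B \<le> 1" for A B
    using \<delta> card by (auto simp: \<kappa>_def field_simps)
  have \<kappa>sum: "(\<Sum>A\<in>\<P>. \<kappa> A B) \<le> 1" if B: "B \<in> \<P>" for B
  proof -
    have "(\<Sum>A\<in>\<P>. \<kappa> A B) \<le> (\<Sum>A\<in>\<P>. (if A = B then 1 - \<delta> else 0) + \<delta> / card \<P>)"
      using \<delta> by (intro sum_mono) (auto simp: \<kappa>_def)
    also have "\<dots> = 1" using B finite_partition partition_nonempty by (simp add: sum.distrib)
    finally show ?thesis .
  qed
  \<comment> \<open>\<open>c\<close> is the cost \<open>- ln \<kappa>\<close> as a function of the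
    point; it is large only on the set where the prediction fails.\<close>
  define c where "c x = (if x \<in> lab (prefix_word k x) then - ln (1 - \<delta>) else ln (card \<P> / \<delta>))" for x
  let ?bad = "{x \<in> X. x \<notin> lab (prefix_word k x)}"
  have c_eq: "c x = - ln (1 - \<delta>) + indicator ?bad x * (ln (card \<P> / \<delta>) + ln (1 - \<delta>))" if "x \<in> X" for x
    using that by (auto simp: c_def indicator_def)
  have c_exp: "exp (- c x) = \<kappa> A (lab (prefix_word k x))" if "x \<in> A" "A \<in> \<P>" for x A
  proof (cases "A = lab (prefix_word k x)")
    case True
    then show ?thesis using that \<delta> by (simp add: c_def \<kappa>_def)
  next
    case False
    then have "x \<notin> lab (prefix_word k x)" using that lab partition_unique by blast
    then show ?thesis using False \<delta> card by (simp add: c_def \<kappa>_def ln_div exp_diff)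
  qed
  have cint: "integrable \<nu> c" and cval: "(\<integral>x. c x \<partial>\<nu>) = - ln (1 - \<delta>) + measure \<nu> ?bad * (ln (card \<P> / \<delta>) + ln (1 - \<delta>))"
  proof -
    have 1: "integrable \<nu> (\<lambda>x. - ln (1 - \<delta>) + indicator ?bad x * (ln (card \<P> / \<delta>) + ln (1 - \<delta>)))"
      by (intro Bochner_Integration.integrable_add indicator_const_integral bad_sets) auto
    show "integrable \<nu> c"
      using 1 by (rule Bochner_Integration.integrable_cong[THEN iffD1, rotated -1]) (auto simp: c_eq)
    have "(\<integral>x. c x \<partial>\<nu>) = (\<integral>x. - ln (1 - \<delta>) + indicator ?bad x * (ln (card \<P> / \<delta>) + ln (1 - \<delta>)) \<partial>\<nu>)"
      by (intro Bochner_Integration.integral_cong) (auto simp: c_eq)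
    also have "\<dots> = - ln (1 - \<delta>) + measure \<nu> ?bad * (ln (card \<P> / \<delta>) + ln (1 - \<delta>))"
      by (subst Bochner_Integration.integral_add)
        (auto simp only: indicator_const_integral[OF bad_sets] integrable_const Bochner_Integration.lebesgue_integral_const prob_space scaleR_one)
    finally show "(\<integral>x. c x \<partial>\<nu>) = - ln (1 - \<delta>) + measure \<nu> ?bad * (ln (card \<P> / \<delta>) + ln (1 - \<delta>))" .
  qed
  define blocks where "blocks = Pi_pmf {..<M} [] (\<lambda>_. D)"
  define joined where "joined g = concat (map g [0..<M])" for g :: "nat \<Rightarrow> 'a list"
  \<comment> \<open>The weight of the code \<open>a\<close> given the blocks \<open>g\<close>: a
    product of independent perturbations of the predicted labels, of total weight at most 1 over the
    codes.\<close>
  define F where "F a g = (\<Prod>i<m. \<kappa> (a i) (lab (take k (drop i (joined g)))))" for a g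
  have F01: "0 \<le> F a g" "F a g \<le> 1" for a g
    using \<kappa>01(1)[THEN less_imp_le] \<kappa>01(2) by (auto simp: F_def intro!: prod_nonneg prod_le_1)
  define r where "r a = measure_pmf.expectation blocks (F a)" for a
  define L where "L x = (\<Sum>j<M. f ((left_shift ^^ (j * n)) x)) + (\<Sum>i<m. c ((left_shift ^^ i) x))" for x
  have "join_entropy m \<le> (\<integral>x. L x \<partial>\<nu>)"
  proof (rule join_entropy_le[where r = r])
    show "0 \<le> r a" for a unfolding r_def by (rule Bochner_Integration.integral_nonneg) (rule F01)
    have int: "integrable (measure_pmf blocks) (F a)" for a
      using F01 by (intro measure_pmf.integrable_const_bound[where B = 1]) auto
    have "(\<Sum>a\<in>codes m. r a) = measure_pmf.expectation blocks (\<lambda>g. \<Sum>a\<in>codes m. F a g)"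
      unfolding r_def using int by (subst Bochner_Integration.integral_sum) auto
    also have "\<dots> \<le> measure_pmf.expectation blocks (\<lambda>_. 1)"
    proof (intro integral_mono)
      fix g
      have "(\<Sum>a\<in>codes m. F a g) = (\<Prod>i<m. \<Sum>A\<in>\<P>. \<kappa> A (lab (take k (drop i (joined g)))))"
        unfolding F_def by (rule prod_sum_PiE[symmetric]) (auto simp: finite_partition)
      also have "\<dots> \<le> 1"
        using \<kappa>sum lab \<kappa>01(1)[THEN less_imp_le] by (intro prod_le_1) (auto intro!: sum_nonneg)
      finally show "(\<Sum>a\<in>codes m. F a g) \<le> 1" .
    qed (use int in auto)
    finally show "(\<Sum>a\<in>codes m. r a) \<le> 1" by simp
    show "integrable \<nu> L"
      unfolding L_def using f cint
      by (intro Bochner_Integration.integrable_add Bochner_Integration.integrable_sum integrable_shift)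
    fix a x assume a: "a \<in> codes m" and x: "x \<in> atom m a"
    then have xX: "x \<in> X" and xa: "\<And>i. i < m \<Longrightarrow> (left_shift ^^ i) x \<in> a i \<and> a i \<in> \<P>"
      by (auto simp: atom_def)
    \<comment> \<open>Outside the \<open>M\<close> blocks \<open>g\<close> takes the default value
      of \<open>Pi_pmf\<close>; any other value there would have probability zero.\<close>
    define g where "g j = (if j < M then prefix_word n ((left_shift ^^ (j * n)) x) else [])" for j
    have "map g [0..<M] = map (\<lambda>j. prefix_word n ((left_shift ^^ (j * n)) x)) [0..<M]"
      by (auto simp: g_def)
    then have joined: "joined g = prefix_word (M * n) x"
      unfolding joined_def using concat_prefix_words[of n x M] by (simp only:)
    have "exp (- L x) = (\<Prod>j<M. exp (- f ((left_shift ^^ (j * n)) x))) * (\<Prod>i<m. exp (- c ((left_shift ^^ i) x)))"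
      by (simp add: L_def exp_add[symmetric] exp_sum[symmetric] sum_negf)
    also have "(\<Prod>i<m. exp (- c ((left_shift ^^ i) x))) = F a g"
      unfolding F_def
    proof (rule prod.cong[OF refl])
      fix i assume i: "i \<in> {..<m}"
      have "i + (M * n - i) = M * n" "k \<le> M * n - i" using Mn i by auto
      then have "take k (drop i (joined g)) = prefix_word k ((left_shift ^^ i) x)"
        using drop_prefix_word[where n = i and m = "M * n - i" and x = x] take_prefix_word[of k "M * n - i"] unfolding joined by metis
      then show "exp (- c ((left_shift ^^ i) x)) = \<kappa> (a i) (lab (take k (drop i (joined g))))"
        using c_exp xa i by simp
    qed
    also have "(\<Prod>j<M. exp (- f ((left_shift ^^ (j * n)) x))) * F a g \<le> pmf blocks g * F a g"
    proof (rule mult_right_mono)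
      have "(\<Prod>j<M. exp (- f ((left_shift ^^ (j * n)) x))) \<le> (\<Prod>j<M. pmf D (g j))"
        using fD[OF shift_iterate_in_X[OF xX]] by (intro prod_mono) (auto simp: g_def)
      also have "\<dots> = pmf blocks g"
        unfolding blocks_def by (subst pmf_Pi) (auto simp: g_def)
      finally show "(\<Prod>j<M. exp (- f ((left_shift ^^ (j * n)) x))) \<le> pmf blocks g" .
    qed (rule F01)
    also have "\<dots> \<le> r a" unfolding r_def using F01 by (intro pmf_times_le_expectation)
    finally show "exp (- L x) \<le> r a" .
  qed
  also have "(\<integral>x. L x \<partial>\<nu>) = M * (\<integral>x. f x \<partial>\<nu>) + m * (\<integral>x. c x \<partial>\<nu>)"
  proof -
    have [measurable]: "f \<in> borel_measurable \<B>" "c \<in> borel_measurable \<B>"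
      using borel_measurable_integrable[OF f] borel_measurable_integrable[OF cint]
      by (simp_all cong: measurable_cong_sets)
    show ?thesis
      unfolding L_def using f cint
      by (simp add: Bochner_Integration.integral_add Bochner_Integration.integral_sum integrable_shift
          integral_shift Bochner_Integration.integrable_sum)
  qed
  also have "\<dots> \<le> (real (m + k) / n + 1) * (\<integral>x. f x \<partial>\<nu>) + m * (- ln (1 - \<delta>) + e * ln (card \<P> / \<delta>))"
  proof (intro add_mono mult_right_mono mult_left_mono)
    have "0 \<le> f x" if "x \<in> X" for x
    proof -
      have "exp (- f x) \<le> 1" using fD[OF that] pmf_le_1[of D "prefix_word n x"] by linarith
      then show ?thesis by simp
    qed
    then show "0 \<le> (\<integral>x. f x \<partial>\<nu>)" by (intro integral_nonneg_AE) auto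
    have "1 - \<delta> \<le> 1" "0 < 1 - \<delta>" using \<delta> by auto
    then have "ln (1 - \<delta>) \<le> 0" by simp
    moreover have pos: "ln (card \<P> / \<delta>) \<ge> 0" using \<delta> card by (intro ln_ge_zero) (simp add: field_simps)
    ultimately have "measure \<nu> ?bad * (ln (card \<P> / \<delta>) + ln (1 - \<delta>)) \<le> measure \<nu> ?bad * ln (card \<P> / \<delta>)"
      by (intro mult_left_mono) auto
    also have "\<dots> \<le> e * ln (card \<P> / \<delta>)" using bad pos by (intro mult_right_mono) auto
    finally show "(\<integral>x. c x \<partial>\<nu>) \<le> - ln (1 - \<delta>) + e * ln (card \<P> / \<delta>)" unfolding cval by simp
  qed (use M_le in auto)
  finally show ?thesis .
qed

lemma entropy_wrt_partition_le:
  fixes D :: "'a list pmf" and f :: "(nat \<Rightarrow> 'a) \<Rightarrow> real"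
  assumes n: "n \<ge> 1" and f: "integrable \<nu> f"
    and fD: "\<And>x. x \<in> X \<Longrightarrow> exp (- f x) \<le> pmf D (prefix_word n x)"
  shows "entropy_wrt_partition \<nu> left_shift \<P> \<le> (\<integral>x. f x \<partial>\<nu>) / n"
proof (rule field_le_epsilon)
  fix \<epsilon> :: real assume \<epsilon>: "\<epsilon> > 0"
  \<comment> \<open>The choice makes \<open>- ln (1 - \<delta>)\<close> equal to
    \<open>\<epsilon> / 2\<close>; afterwards \<open>e\<close> is chosen in terms of
    \<open>\<delta>\<close> so that the wrong predictions also cost \<open>\<epsilon> / 2\<close>.
    The block overhead disappears as \<open>m\<close> grows.\<close>
  define \<delta> where "\<delta> = 1 - exp (- \<epsilon> / 2)"
  have \<delta>: "0 < \<delta>" "\<delta> < 1" "- ln (1 - \<delta>) = \<epsilon> / 2" using \<epsilon> by (auto simp: \<delta>_def)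
  have "real (card \<P>) \<ge> 1"
    using partition_nonempty finite_partition by (simp add: Suc_le_eq card_gt_0_iff)
  then have pos: "ln (card \<P> / \<delta>) > 0" using \<delta> by (intro ln_gt_zero) (simp add: field_simps)
  define e where "e = \<epsilon> / 2 / ln (card \<P> / \<delta>)"
  have "e > 0" using \<epsilon> pos by (simp add: e_def)
  then obtain k lab where lab: "\<And>w. lab w \<in> \<P>" "measure \<nu> {x \<in> X. x \<notin> lab (prefix_word k x)} < e"
    "{x \<in> X. x \<notin> lab (prefix_word k x)} \<in> sets \<B>"
    using partition_approximation by blast
  let ?I = "\<integral>x. f x \<partial>\<nu>"
  have e: "e * ln (card \<P> / \<delta>) = \<epsilon> / 2" using pos by (simp add: e_def)
  have bound: "join_entropy m / m \<le> ?I / n + \<epsilon> + (k / n + 1) * ?I * (1 / m)" if "m \<ge> 1" for m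
  proof -
    have "join_entropy m \<le> (real (m + k) / n + 1) * ?I + m * \<epsilon>"
      using join_entropy_le_blocks[OF n f fD lab \<delta>(1,2), of m] unfolding \<delta>(3) e by simp
    then have "join_entropy m / m \<le> ((real (m + k) / n + 1) * ?I + m * \<epsilon>) / m"
      by (rule divide_right_mono) simp
    also have "\<dots> = real m * \<epsilon> / m + (real m / n / m + (k / n + 1) / m) * ?I"
      by (simp add: add_divide_distrib distrib_right)
    also have "\<dots> = ?I / n + \<epsilon> + (k / n + 1) * ?I * (1 / m)"
      using that by (simp add: distrib_right)
    finally show ?thesis .
  qed
  have "(\<lambda>m. ?I / n + \<epsilon> + (k / n + 1) * ?I * (1 / m)) \<longlonglongrightarrow> ?I / n + \<epsilon> + (k / n + 1) * ?I * 0"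
    by (intro tendsto_intros lim_1_over_n)
  then show "entropy_wrt_partition \<nu> left_shift \<P> \<le> ?I / n + \<epsilon>"
    using bound by (intro LIMSEQ_le[OF entropy_limit]) (auto intro!: exI[of _ 1])
qed

end

text \<open>The preceding bound does not depend on the partition, so it passes to the supremum. This
  takes the place of a generator theorem: \<open>f\<close> is the cost of coding the first
  \<open>n\<close> letters with \<open>D\<close>, paid once every \<open>n\<close> steps.\<close>

lemma (in shift_invariant_measure) ks_entropy_le:
  fixes D :: "'a list pmf" and f :: "(nat \<Rightarrow> 'a) \<Rightarrow> real"
  assumes "n \<ge> 1" and "integrable \<nu> f"
    and "\<And>x. x \<in> X \<Longrightarrow> exp (- f x) \<le> pmf D (prefix_word n x)"
  shows "ks_entropy \<nu> left_shift \<le> ereal ((\<integral>x. f x \<partial>\<nu>) / n)"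
  unfolding ks_entropy_def
proof (rule SUP_least)
  fix \<P> assume "\<P> \<in> {\<P>. finite \<P> \<and> \<P> \<subseteq> sets \<nu> \<and> partition_on (space \<nu>) \<P>}"
  then interpret invariant_partition S T \<nu> \<P>
    by unfold_locales auto
  show "ereal (entropy_wrt_partition \<nu> left_shift \<P>) \<le> ereal ((\<integral>x. f x \<partial>\<nu>) / n)"
    using entropy_wrt_partition_le[OF assms] by simp
qed

section \<open>Gibbs measures are equilibrium states\<close>

text \<open>Both sides are suprema of finite partial sums. The translation gives access to the
  integral calculus for partition functions, which are defined as \<open>infsum\<close>.\<close>

lemma nn_integral_count_space_eq_infsum:
  fixes f :: "'b \<Rightarrow> ennreal"
  assumes "countable A"
  shows "(\<integral>\<^sup>+x. f x \<partial>count_space A) = infsum f A"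
proof (rule antisym)
  have inf: "infsum f A = (SUP F\<in>{F. finite F \<and> F \<subseteq> A}. sum f F)"
    by (rule nonneg_infsum_complete) simp
  show "infsum f A \<le> (\<integral>\<^sup>+x. f x \<partial>count_space A)"
    unfolding inf
  proof (rule SUP_least)
    fix F assume "F \<in> {F. finite F \<and> F \<subseteq> A}"
    then have "sum f F = (\<integral>\<^sup>+x. f x * indicator F x \<partial>count_space A)"
      by (subst nn_integral_count_space'[of F]) (auto simp: indicator_def)
    also have "\<dots> \<le> (\<integral>\<^sup>+x. f x \<partial>count_space A)"
      by (intro nn_integral_mono) (auto simp: indicator_def)
    finally show "sum f F \<le> (\<integral>\<^sup>+x. f x \<partial>count_space A)" .
  qed
  show "(\<integral>\<^sup>+x. f x \<partial>count_space A) \<le> infsum f A"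
  proof (cases "finite A")
    case True
    then show ?thesis unfolding inf by (auto simp: nn_integral_count_space_finite intro!: SUP_upper)
  next
    case False
    then have bij: "bij_betw (from_nat_into A) UNIV A"
      using assms by (simp add: bij_betw_from_nat_into)
    have "(\<integral>\<^sup>+x. f x \<partial>count_space A) = (\<Sum>i. f (from_nat_into A i))"
      by (subst nn_integral_bij_count_space[OF bij, symmetric]) (simp add: nn_integral_count_space_nat)
    also have "\<dots> = (SUP n. \<Sum>i<n. f (from_nat_into A i))" by (rule suminf_eq_SUP)
    also have "\<dots> \<le> infsum f A"
    proof (rule SUP_least)
      fix n
      have "inj_on (from_nat_into A) {..<n}" using bij by (auto simp: bij_betw_def intro: inj_on_subset)
      then have "(\<Sum>i<n. f (from_nat_into A i)) = sum f (from_nat_into A ` {..<n})"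
        by (simp add: sum.reindex)
      also have "\<dots> \<le> infsum f A"
        unfolding inf using bij by (intro SUP_upper) (auto simp: bij_betw_def)
      finally show "(\<Sum>i<n. f (from_nat_into A i)) \<le> infsum f A" .
    qed
    finally show ?thesis .
  qed
qed

section \<open>Summable potentials and the laws of prefixes\<close>

context countable_shift
begin

lemma summable_potential_iff:
  "summable_potential S T \<psi> \<longleftrightarrow>
     (\<integral>\<^sup>+a. (SUP x\<in>cyl [a]. ennreal (exp (\<psi> x))) \<partial>count_space S) < \<infinity>"
proof -
  have W1: "W 1 = (\<lambda>a. [a]) ` S"
    by (auto simp: words_def length_Suc_conv image_iff)
  have bs: "birkhoff_sum 1 \<psi> x = \<psi> x" for x
    by (simp add: birkhoff_sum_def)
  have "partition_function S T 1 \<psi> = (\<integral>\<^sup>+w. (SUP x\<in>cyl w. ennreal (exp (\<psi> x))) \<partial>count_space (W 1))"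
    unfolding partition_function_def bs by (rule nn_integral_count_space_eq_infsum[OF W_countable, symmetric])
  also have "\<dots> = (\<integral>\<^sup>+a. (SUP x\<in>cyl [a]. ennreal (exp (\<psi> x))) \<partial>count_space S)"
    unfolding W1 by (rule nn_integral_bij_count_space[symmetric]) (auto simp: bij_betw_def inj_on_def)
  finally show ?thesis by (simp add: summable_potential_def)
qed

text \<open>Each term of the convergent sum is at most the whole sum, and it bounds
  \<open>exp \<psi>\<close> on its cylinder.\<close>

lemma summable_potential_bounded_above:
  assumes "summable_potential S T \<psi>"
  obtains b where "\<And>x. x \<in> X \<Longrightarrow> \<psi> x \<le> b"
proof -
  let ?s = "\<lambda>a. SUP x\<in>cyl [a]. ennreal (exp (\<psi> x))"
  define Z where "Z = (\<integral>\<^sup>+a. ?s a \<partial>count_space S)"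
  have Z: "Z < \<infinity>" using assms by (simp add: summable_potential_iff Z_def)
  have "\<psi> x \<le> ln (enn2real Z)" if x: "x \<in> X" for x
  proof -
    have x0: "x 0 \<in> S" using x by (simp add: markov_shift_def)
    have "ennreal (exp (\<psi> x)) \<le> ?s (x 0)"
      using x by (intro SUP_upper) (auto simp: cylinder_def)
    also have "\<dots> = (\<integral>\<^sup>+a. ?s a * indicator {x 0} a \<partial>count_space S)"
      using x0 by (subst nn_integral_count_space'[of "{x 0}"]) (auto simp: indicator_def)
    also have "\<dots> \<le> Z" unfolding Z_def by (intro nn_integral_mono) (auto simp: indicator_def)
    also have "Z = ennreal (enn2real Z)" using Z by simp
    finally have "exp (\<psi> x) \<le> enn2real Z" by (simp add: ennreal_le_iff)
    then show ?thesis by (metis exp_gt_zero ln_exp ln_le_cancel_iff order_less_le_trans)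
  qed
  then show ?thesis using that by blast
qed

lemma measurable_birkhoff_sum [measurable]:
  assumes [measurable]: "\<psi> \<in> borel_measurable \<B>"
  shows "birkhoff_sum n \<psi> \<in> borel_measurable \<B>"
  unfolding birkhoff_sum_def[abs_def] by measurable

end

context shift_invariant_measure
begin

lemma emeasure_prefix_set:
  "(\<integral>\<^sup>+w. emeasure \<nu> (prefix_set n {w}) \<partial>count_space Q) = emeasure \<nu> (prefix_set n Q)"
proof -
  have "(\<integral>\<^sup>+w. emeasure \<nu> (prefix_set n {w}) \<partial>count_space Q)
      = (\<integral>\<^sup>+w. emeasure \<nu> (prefix_set n {w}) \<partial>count_space (Q \<inter> lists S))"
  proof (rule nn_integral_count_space_eq)
    fix w assume "w \<in> Q - Q \<inter> lists S"
    then have "prefix_set n {w} = {}" by (auto simp: prefix_set_def markov_shift_def)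
    then show "emeasure \<nu> (prefix_set n {w}) = 0" by simp
  qed auto
  also have "\<dots> = emeasure \<nu> (\<Union>w\<in>Q \<inter> lists S. prefix_set n {w})"
    using countable_alphabet
    by (intro emeasure_UN_countable[symmetric]) (auto simp: disjoint_family_on_def, auto simp: prefix_set_def)
  also have "(\<Union>w\<in>Q \<inter> lists S. prefix_set n {w}) = prefix_set n Q"
    by (auto simp: prefix_set_def markov_shift_def)
  finally show ?thesis .
qed

text \<open>The law of the prefix in the form of a \<open>pmf\<close>, so that it can be
  conditioned, mixed and mapped.\<close>

definition word_law :: "nat \<Rightarrow> 'a list pmf" where
  "word_law n = embed_pmf (\<lambda>w. measure \<nu> (prefix_set n {w}))"

lemma prefix_set_UNIV: "prefix_set n UNIV = X"
  by (simp add: prefix_set_def)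

lemma pmf_word_law: "pmf (word_law n) w = measure \<nu> (prefix_set n {w})"
  unfolding word_law_def
proof (rule pmf_embed_pmf)
  show "(\<integral>\<^sup>+w. ennreal (measure \<nu> (prefix_set n {w})) \<partial>count_space UNIV) = 1"
    using emeasure_prefix_set[where n = n and Q = UNIV] emeasure_space_1
    by (simp add: emeasure_eq_measure prefix_set_UNIV)
qed simp

lemma emeasure_word_law: "emeasure (measure_pmf (word_law n)) Q = emeasure \<nu> (prefix_set n Q)"
  unfolding nn_integral_pmf[symmetric] pmf_word_law
  using emeasure_prefix_set[where n = n and Q = Q] by (simp add: emeasure_eq_measure)

lemma measure_word_law: "measure (measure_pmf (word_law n)) Q = measure \<nu> (prefix_set n Q)"
  using emeasure_word_law[where n = n and Q = Q] by (simp add: measure_def)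

lemma word_law_eq_distr: "measure_pmf (word_law n) = distr \<nu> (count_space UNIV) (prefix_word n)"
proof (rule measure_eqI)
  fix A assume "A \<in> sets (measure_pmf (word_law n))"
  have "prefix_word n -` A \<inter> X = prefix_set n A" by (auto simp: prefix_set_def)
  then show "emeasure (measure_pmf (word_law n)) A = emeasure (distr \<nu> (count_space UNIV) (prefix_word n)) A"
    by (subst emeasure_distr) (auto simp: emeasure_word_law)
qed simp

lemma nn_integral_prefix_word:
  "(\<integral>\<^sup>+x. F (prefix_word n x) \<partial>\<nu>) = (\<integral>\<^sup>+w. ennreal (measure \<nu> (prefix_set n {w})) * F w \<partial>count_space UNIV)"
proof -
  have "(\<integral>\<^sup>+x. F (prefix_word n x) \<partial>\<nu>) = (\<integral>\<^sup>+w. F w \<partial>measure_pmf (word_law n))"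
    unfolding word_law_eq_distr by (subst nn_integral_distr) auto
  then show ?thesis by (simp add: nn_integral_measure_pmf pmf_word_law)
qed

lemma integral_birkhoff_sum:
  assumes "integrable \<nu> \<psi>"
  shows "integrable \<nu> (birkhoff_sum n \<psi>)" "(\<integral>x. birkhoff_sum n \<psi> x \<partial>\<nu>) = n * (\<integral>x. \<psi> x \<partial>\<nu>)"
proof -
  have [measurable]: "\<psi> \<in> borel_measurable \<B>"
    using borel_measurable_integrable[OF assms] by (simp cong: measurable_cong_sets)
  show "integrable \<nu> (birkhoff_sum n \<psi>)"
    unfolding birkhoff_sum_def[abs_def] using assms by (intro Bochner_Integration.integrable_sum integrable_shift)
  show "(\<integral>x. birkhoff_sum n \<psi> x \<partial>\<nu>) = n * (\<integral>x. \<psi> x \<partial>\<nu>)"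
    unfolding birkhoff_sum_def
    by (subst Bochner_Integration.integral_sum) (auto simp: integrable_shift[OF assms] integral_shift)
qed

lemma ext_integral_eq:
  assumes "integrable \<nu> \<psi>"
  shows "ext_integral \<nu> \<psi> = ereal (\<integral>x. \<psi> x \<partial>\<nu>)"
proof -
  have fin: "(\<integral>\<^sup>+x. ennreal (\<psi> x) \<partial>\<nu>) \<noteq> \<infinity>" "(\<integral>\<^sup>+x. ennreal (- \<psi> x) \<partial>\<nu>) \<noteq> \<infinity>"
    using assms by (auto simp: real_integrable_def)
  have "ext_integral \<nu> \<psi> = ereal (enn2real (\<integral>\<^sup>+x. ennreal (\<psi> x) \<partial>\<nu>)) - ereal (enn2real (\<integral>\<^sup>+x. ennreal (- \<psi> x) \<partial>\<nu>))"
    unfolding ext_integral_def using fin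
    by (metis enn2ereal_ennreal enn2real_nonneg ennreal_enn2real infinity_ennreal_def top.not_eq_extremum)
  then show ?thesis by (simp add: real_lebesgue_integral_def[OF assms])
qed

text \<open>The upper bound makes the positive part integrable, so only the negative part can fail,
  and its failure forces the value \<open>-\<infinity>\<close>.\<close>

lemma integrable_iff_ext_integral:
  assumes [measurable]: "\<psi> \<in> borel_measurable \<B>" and b: "\<And>x. x \<in> X \<Longrightarrow> \<psi> x \<le> b"
  shows "ext_integral \<nu> \<psi> > -\<infinity> \<longleftrightarrow> integrable \<nu> \<psi>"
proof
  assume "integrable \<nu> \<psi>"
  then show "ext_integral \<nu> \<psi> > -\<infinity>" by (simp add: ext_integral_eq)
next
  assume *: "ext_integral \<nu> \<psi> > -\<infinity>"
  have "(\<integral>\<^sup>+x. ennreal (\<psi> x) \<partial>\<nu>) \<le> (\<integral>\<^sup>+x. ennreal b \<partial>\<nu>)"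
    using b by (intro nn_integral_mono) (auto intro: ennreal_leI)
  also have "\<dots> < \<infinity>" using emeasure_space_1 by (simp add: ennreal_mult_less_top)
  finally have fin: "(\<integral>\<^sup>+x. ennreal (\<psi> x) \<partial>\<nu>) < \<infinity>" .
  have "(\<integral>\<^sup>+x. ennreal (- \<psi> x) \<partial>\<nu>) \<noteq> \<infinity>"
  proof
    assume "(\<integral>\<^sup>+x. ennreal (- \<psi> x) \<partial>\<nu>) = \<infinity>"
    then have "ext_integral \<nu> \<psi> = enn2ereal (\<integral>\<^sup>+x. ennreal (\<psi> x) \<partial>\<nu>) - \<infinity>"
      by (simp add: ext_integral_def)
    also have "enn2ereal (\<integral>\<^sup>+x. ennreal (\<psi> x) \<partial>\<nu>) \<noteq> \<infinity>" using fin
      by (metis enn2ereal_eq_top_iff infinity_ennreal_def less_irrefl top_ereal_def)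
    then have "enn2ereal (\<integral>\<^sup>+x. ennreal (\<psi> x) \<partial>\<nu>) - \<infinity> = -\<infinity>"
      by (cases "enn2ereal (\<integral>\<^sup>+x. ennreal (\<psi> x) \<partial>\<nu>)") auto
    finally show False using * by simp
  qed
  then show "integrable \<nu> \<psi>" using fin by (simp add: real_integrable_def)
qed

end

section \<open>Gibbs measures: integrability and free energy\<close>

lemma birkhoff_sum_add:
  "birkhoff_sum (n + m) \<psi> x = birkhoff_sum n \<psi> x + birkhoff_sum m \<psi> ((left_shift ^^ n) x)"
proof -
  have "birkhoff_sum (n + m) \<psi> x = birkhoff_sum n \<psi> x + (\<Sum>i\<in>{n..<n+m}. \<psi> ((left_shift ^^ i) x))"
    unfolding birkhoff_sum_def by (subst sum.union_disjoint[symmetric]) (auto intro!: sum.cong)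
  also have "(\<Sum>i\<in>{n..<n+m}. \<psi> ((left_shift ^^ i) x)) = birkhoff_sum m \<psi> ((left_shift ^^ n) x)"
    unfolding birkhoff_sum_def
    by (rule sum.reindex_bij_witness[where i = "\<lambda>i. n + i" and j = "\<lambda>i. i - n"])
      (auto simp: left_shift_iterate add.assoc)
  finally show ?thesis .
qed

text \<open>The number \<open>\<beta>\<close> is a witness for \<open>beta_infinity < 1\<close>. The
  Gibbs property is split into two inequalities without quotients; \<open>c\<close> and
  \<open>P\<close> are parameters because different Gibbs states may come with different
  constants.\<close>

locale gibbs_measure = shift_invariant_measure S T \<mu>
  for S :: "'a set" and T and \<mu> :: "(nat \<Rightarrow> 'a) measure" +
  fixes \<phi> :: "(nat \<Rightarrow> 'a) \<Rightarrow> real" and c P \<beta> :: real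
  assumes infinite_alphabet: "infinite S"
    and potential_measurable [measurable]: "\<phi> \<in> borel_measurable \<B>"
    and potential_summable: "summable_potential S T \<phi>"
    and beta: "\<beta> < 1" "summable_potential S T (\<lambda>x. \<beta> * \<phi> x)"
    and c: "c \<ge> 1"
    and gibbs_upper: "\<And>n x. n \<ge> 1 \<Longrightarrow> x \<in> X \<Longrightarrow>
      measure \<mu> (cyl (prefix_word n x)) \<le> c * exp (- P * n + birkhoff_sum n \<phi> x)"
    and gibbs_lower: "\<And>n x. n \<ge> 1 \<Longrightarrow> x \<in> X \<Longrightarrow>
      exp (- P * n + birkhoff_sum n \<phi> x) \<le> c * measure \<mu> (cyl (prefix_word n x))"
begin

lemma prefix_set_single: "x \<in> X \<Longrightarrow> prefix_set n {prefix_word n x} = cyl (prefix_word n x)"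
  by (simp add: cyl_eq_prefix_set)

text \<open>The lower Gibbs inequality at any point of the cylinder gives full support, which
  permits division by masses of cylinders.\<close>

lemma cyl_pos: assumes "w \<in> W n" shows "measure \<mu> (cyl w) > 0"
proof -
  obtain x where x: "x \<in> cyl w" using cyl_nonempty[OF assms] by blast
  have n: "length w = n" "n \<ge> 1" using assms by (auto simp: words_def)
  then have "x \<in> X" "prefix_word n x = w" using x by (auto simp: cyl_iff)
  then have "exp (- P * n + birkhoff_sum n \<phi> x) \<le> c * measure \<mu> (cyl w)"
    using gibbs_lower[of n x] n by simp
  then have "0 < c * measure \<mu> (cyl w)"
    by (rule less_le_trans[OF exp_gt_zero])
  then show ?thesis using c by (simp add: zero_less_mult_iff)
qed

lemma single_word: "a \<in> S \<Longrightarrow> [a] \<in> W 1"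
  by (auto simp: words_def)

lemma gibbs_first:
  assumes "x \<in> X"
  shows "measure \<mu> (cyl [x 0]) \<le> c * exp (- P + \<phi> x)" "exp (- P + \<phi> x) \<le> c * measure \<mu> (cyl [x 0])"
    "measure \<mu> (cyl [x 0]) > 0"
proof -
  have "prefix_word 1 x = [x 0]" "birkhoff_sum 1 \<phi> x = \<phi> x" by (auto simp: birkhoff_sum_def)
  then show "measure \<mu> (cyl [x 0]) \<le> c * exp (- P + \<phi> x)" "exp (- P + \<phi> x) \<le> c * measure \<mu> (cyl [x 0])"
    using gibbs_upper[of 1 x] gibbs_lower[of 1 x] assms by simp_all
  show "measure \<mu> (cyl [x 0]) > 0"
    using assms by (intro cyl_pos[OF single_word]) (auto simp: markov_shift_def)
qed

text \<open>The condition \<open>\<beta> < 1\<close> makes \<open>exp (-(1 - \<beta>) \<phi>)\<close> integrable, and this function dominates \<open>- \<phi>\<close>.\<close>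

lemma integrable_potential: "integrable \<mu> \<phi>"
proof -
  obtain b where b: "\<And>x. x \<in> X \<Longrightarrow> \<phi> x \<le> b"
    using summable_potential_bounded_above[OF potential_summable] by blast
  define t where "t = 1 - \<beta>"
  have t: "t > 0" using beta by (simp add: t_def)
  define s where "s a = (SUP x\<in>cyl [a]. ennreal (exp (\<beta> * \<phi> x)))" for a
  define g where "g x = ennreal (exp (- t * \<phi> x))" for x
  have [measurable]: "g \<in> borel_measurable \<mu>" unfolding g_def[abs_def] by measurable
  have part: "(\<integral>\<^sup>+x. indicator (cyl [a]) x * g x \<partial>\<mu>) \<le> ennreal (c * exp (- P)) * s a" if a: "a \<in> S" for a
  proof -
    have pos: "measure \<mu> (cyl [a]) > 0" using cyl_pos[OF single_word[OF a]] .
    have le: "g x \<le> ennreal (c * exp (- P) / measure \<mu> (cyl [a])) * s a" if x: "x \<in> cyl [a]" for x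
    proof -
      have xX: "x \<in> X" "x 0 = a" using x by (auto simp: cylinder_def)
      \<comment> \<open>The upper Gibbs inequality trades the mass of the cylinder for
        \<open>exp (\<phi> x)\<close>, and \<open>\<phi> - t \<phi> = \<beta> \<phi>\<close>.
        Integration over the cylinder thus leaves a term of the convergent sum for
        \<open>\<beta> \<phi>\<close>.\<close>
      have "measure \<mu> (cyl [a]) * exp (- t * \<phi> x) \<le> c * exp (- P + \<phi> x) * exp (- t * \<phi> x)"
        using gibbs_first(1)[OF xX(1)] xX by (intro mult_right_mono) auto
      also have "\<dots> = c * exp (- P) * exp (\<beta> * \<phi> x)"
        by (simp add: t_def mult_exp_exp algebra_simps)
      finally have "exp (- t * \<phi> x) \<le> c * exp (- P) / measure \<mu> (cyl [a]) * exp (\<beta> * \<phi> x)"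
        using pos by (simp add: field_simps)
      then have "g x \<le> ennreal (c * exp (- P) / measure \<mu> (cyl [a]) * exp (\<beta> * \<phi> x))"
        unfolding g_def by (rule ennreal_leI)
      also have "\<dots> = ennreal (c * exp (- P) / measure \<mu> (cyl [a])) * ennreal (exp (\<beta> * \<phi> x))"
        using c pos by (intro ennreal_mult) auto
      also have "\<dots> \<le> ennreal (c * exp (- P) / measure \<mu> (cyl [a])) * s a"
        unfolding s_def using x by (intro mult_left_mono SUP_upper) auto
      finally show ?thesis .
    qed
    have "(\<integral>\<^sup>+x. indicator (cyl [a]) x * g x \<partial>\<mu>)
        \<le> (\<integral>\<^sup>+x. ennreal (c * exp (- P) / measure \<mu> (cyl [a])) * s a * indicator (cyl [a]) x \<partial>\<mu>)"
      using le by (intro nn_integral_mono) (auto simp: indicator_def)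
    also have "\<dots> = ennreal (c * exp (- P) / measure \<mu> (cyl [a])) * s a * ennreal (measure \<mu> (cyl [a]))"
      by (subst nn_integral_cmult_indicator) (auto simp: emeasure_eq_measure)
    also have "\<dots> = ennreal (c * exp (- P) / measure \<mu> (cyl [a]) * measure \<mu> (cyl [a])) * s a"
      using c pos by (subst ennreal_mult) (auto simp: mult_ac)
    also have "\<dots> = ennreal (c * exp (- P)) * s a" using pos by simp
    finally show ?thesis .
  qed
  have "(\<integral>\<^sup>+x. g x \<partial>\<mu>) = (\<integral>\<^sup>+x. \<integral>\<^sup>+a. indicator (cyl [a]) x * g x \<partial>count_space S \<partial>\<mu>)"
  proof (rule nn_integral_cong)
    fix x assume "x \<in> space \<mu>"
    then have x: "x \<in> X" "x 0 \<in> S" by (auto simp: markov_shift_def)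
    then show "g x = (\<integral>\<^sup>+a. indicator (cyl [a]) x * g x \<partial>count_space S)"
      by (subst nn_integral_count_space'[of "{x 0}"]) (auto simp: indicator_def cylinder_def)
  qed
  also have "\<dots> = (\<integral>\<^sup>+a. \<integral>\<^sup>+x. indicator (cyl [a]) x * g x \<partial>\<mu> \<partial>count_space S)"
    using countable_alphabet by (intro nn_integral_count_space_nn_integral) auto
  also have "\<dots> \<le> (\<integral>\<^sup>+a. ennreal (c * exp (- P)) * s a \<partial>count_space S)"
    using part by (intro nn_integral_mono) auto
  also have "\<dots> = ennreal (c * exp (- P)) * (\<integral>\<^sup>+a. s a \<partial>count_space S)"
    by (intro nn_integral_cmult) auto
  also have "\<dots> < \<infinity>"
    using beta(2) by (auto simp: summable_potential_iff s_def ennreal_mult_less_top)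
  finally have fin: "(\<integral>\<^sup>+x. g x \<partial>\<mu>) < \<infinity>" .
  show ?thesis
  proof (rule integrableI_bounded)
    have "ennreal (norm (\<phi> x)) \<le> ennreal \<bar>b\<bar> + ennreal (1 / t) * g x" if x: "x \<in> X" for x
    proof -
      have "- t * \<phi> x \<le> exp (- t * \<phi> x)" using exp_ge_add_one_self[of "- t * \<phi> x"] by linarith
      then have "- \<phi> x \<le> 1 / t * exp (- t * \<phi> x)" using t by (simp add: field_simps)
      moreover have "0 \<le> 1 / t * exp (- t * \<phi> x)" using t by simp
      ultimately have "norm (\<phi> x) \<le> \<bar>b\<bar> + 1 / t * exp (- t * \<phi> x)" using b[OF x] by auto
      then have "ennreal (norm (\<phi> x)) \<le> ennreal (\<bar>b\<bar> + 1 / t * exp (- t * \<phi> x))" by (rule ennreal_leI)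
      also have "\<dots> = ennreal \<bar>b\<bar> + ennreal (1 / t) * g x"
        using t by (simp add: g_def ennreal_plus ennreal_mult[symmetric])
      finally show ?thesis .
    qed
    then have "(\<integral>\<^sup>+x. ennreal (norm (\<phi> x)) \<partial>\<mu>) \<le> (\<integral>\<^sup>+x. ennreal \<bar>b\<bar> + ennreal (1 / t) * g x \<partial>\<mu>)"
      by (intro nn_integral_mono) auto
    also have "\<dots> = ennreal \<bar>b\<bar> * emeasure \<mu> (space \<mu>) + ennreal (1 / t) * (\<integral>\<^sup>+x. g x \<partial>\<mu>)"
      by (subst nn_integral_add) (auto simp: nn_integral_cmult)
    also have "\<dots> < \<infinity>" using fin emeasure_space_1 by (simp add: ennreal_mult_less_top)
    finally show "(\<integral>\<^sup>+x. ennreal (norm (\<phi> x)) \<partial>\<mu>) < \<infinity>" .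
  qed measurable
qed

text \<open>The test distribution on words is an equal mixture of the law of the prefix under \<open>\<mu>\<close> and of
  this law conditioned on \<open>Q\<close>; mass that \<open>\<nu>\<close> puts on a \<open>\<mu>\<close>-small set \<open>Q\<close> costs entropy.\<close>

lemma entropy_upper_bound:
  assumes "shift_invariant_measure S T \<nu>" and int: "integrable \<nu> \<phi>" and n: "n \<ge> 1"
    and Q: "measure \<mu> (prefix_set n Q) > 0"
  shows "ks_entropy \<nu> left_shift \<le> ereal (P - (\<integral>x. \<phi> x \<partial>\<nu>) +
    (ln (2 * c) - measure \<nu> (prefix_set n Q) * ln (1 / measure \<mu> (prefix_set n Q))) / n)"
proof -
  interpret \<nu>: shift_invariant_measure S T \<nu> by fact
  let ?C = "prefix_set n Q"
  define p where "p = measure \<mu> ?C"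
  \<comment> \<open>\<open>f\<close> bounds the cost of the mixture: \<open>ln (2 * c)\<close>
    accounts for the weight \<open>1 / 2\<close> and the lower Gibbs inequality, and on
    \<open>?C\<close> the conditioned half gains the factor \<open>1 / p\<close>.\<close>
  define f where "f x = P * n - birkhoff_sum n \<phi> x + ln (2 * c) - indicator ?C x * ln (1 / p)" for x
  \<comment> \<open>Conditioning on \<open>Q\<close> makes sense only if \<open>Q\<close> meets the
    support of the word law.\<close>
  have ne: "set_pmf (word_law n) \<inter> Q \<noteq> {}"
  proof
    assume "set_pmf (word_law n) \<inter> Q = {}"
    then have "measure (measure_pmf (word_law n)) Q = 0"
      by (simp add: measure_pmf_zero_iff)
    then show False using Q by (simp add: measure_word_law)
  qed
  define D where "D = bind_pmf (bernoulli_pmf (1 / 2)) (\<lambda>b. if b then cond_pmf (word_law n) Q else word_law n)"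
  have D: "pmf D w = (if w \<in> Q then measure \<mu> (prefix_set n {w}) / p else 0) / 2 + measure \<mu> (prefix_set n {w}) / 2" for w
    by (simp add: D_def pmf_bind pmf_cond[OF ne] measure_word_law pmf_word_law p_def)
  have p: "p > 0" "p \<le> 1" using Q by (auto simp: p_def)
  have fD: "exp (- f x) \<le> pmf D (prefix_word n x)" if x: "x \<in> X" for x
  proof -
    let ?m = "measure \<mu> (prefix_set n {prefix_word n x})"
    have "exp (- f x) = exp (- P * n + birkhoff_sum n \<phi> x) / (2 * c) * exp (indicator ?C x * ln (1 / p))"
      using c by (simp add: f_def exp_add exp_diff exp_minus divide_simps)
    also have "\<dots> \<le> ?m / 2 * exp (indicator ?C x * ln (1 / p))"
      using gibbs_lower[OF n x] c by (intro mult_right_mono) (auto simp: prefix_set_single[OF x] field_simps)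
    also have "\<dots> \<le> pmf D (prefix_word n x)"
      unfolding D using p x by (auto simp: indicator_def prefix_set_def exp_minus ln_div divide_simps)
    finally show ?thesis .
  qed
  have Cint: "integrable \<nu> (\<lambda>x. indicator ?C x * ln (1 / p))" "(\<integral>x. indicator ?C x * ln (1 / p) \<partial>\<nu>) = measure \<nu> ?C * ln (1 / p)"
    by (rule \<nu>.indicator_const_integral, simp)+
  note bint = \<nu>.integral_birkhoff_sum[OF int, of n]
  have fint: "integrable \<nu> f"
    unfolding f_def using Cint(1) bint(1)
    by (intro Bochner_Integration.integrable_diff Bochner_Integration.integrable_add) auto
  have "(\<integral>x. f x \<partial>\<nu>) = P * n - n * (\<integral>x. \<phi> x \<partial>\<nu>) + ln (2 * c) - measure \<nu> ?C * ln (1 / p)"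
  proof -
    have "(\<integral>x. f x \<partial>\<nu>) = (\<integral>x. (P * n + ln (2 * c)) - birkhoff_sum n \<phi> x - indicator ?C x * ln (1 / p) \<partial>\<nu>)"
      unfolding f_def by (intro Bochner_Integration.integral_cong) auto
    also have "\<dots> = (\<integral>x. (P * n + ln (2 * c)) - birkhoff_sum n \<phi> x \<partial>\<nu>) - (\<integral>x. indicator ?C x * ln (1 / p) \<partial>\<nu>)"
      using Cint(1) bint(1) by (intro Bochner_Integration.integral_diff) auto
    also have "(\<integral>x. (P * n + ln (2 * c)) - birkhoff_sum n \<phi> x \<partial>\<nu>) = P * n + ln (2 * c) - n * (\<integral>x. \<phi> x \<partial>\<nu>)"
      using bint \<nu>.prob_space by (subst Bochner_Integration.integral_diff) auto
    finally show ?thesis using Cint(2) by simp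
  qed
  then have "(\<integral>x. f x \<partial>\<nu>) / n = P - (\<integral>x. \<phi> x \<partial>\<nu>) + (ln (2 * c) - measure \<nu> ?C * ln (1 / p)) / n"
    using n by (simp add: field_simps)
  then show ?thesis using \<nu>.ks_entropy_le[OF n fint fD] by (simp add: p_def)
qed

text \<open>For \<open>Q = UNIV\<close> the penalty is zero because \<open>ln 1 = 0\<close>, and the
  remaining \<open>ln (2 * c) / n\<close> vanishes in the limit.\<close>

lemma free_energy_upper_bound:
  assumes "shift_invariant_measure S T \<nu>" and int: "integrable \<nu> \<phi>"
  shows "ks_entropy \<nu> left_shift \<le> ereal (P - (\<integral>x. \<phi> x \<partial>\<nu>))"
proof (rule Lim_bounded2)
  let ?I = "\<integral>x. \<phi> x \<partial>\<nu>"
  have "(\<lambda>n. P - ?I + ln (2 * c) * (1 / real n)) \<longlonglongrightarrow> P - ?I + ln (2 * c) * 0"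
    by (intro tendsto_intros lim_1_over_n)
  then show "(\<lambda>n. ereal (P - ?I + ln (2 * c) * (1 / real n))) \<longlonglongrightarrow> ereal (P - ?I)"
    by simp
  show "\<forall>n\<ge>1. ks_entropy \<nu> left_shift \<le> ereal (P - ?I + ln (2 * c) * (1 / real n))"
    using entropy_upper_bound[OF assms, of _ UNIV] prob_space by (simp add: prefix_set_UNIV)
qed

text \<open>Given a code \<open>a\<close>, the word is reconstructed by drawing the letters outside \<open>F\<close> independently.\<close>

lemma entropy_lower_bound_finite:
  assumes F: "finite F" "F \<subseteq> S"
  shows "ereal (P - (\<integral>x. \<phi> x \<partial>\<mu>) - (\<integral>x. indicator {x \<in> X. x 0 \<notin> F} x * (P + ln c - \<phi> x) \<partial>\<mu>))
    \<le> ks_entropy \<mu> left_shift"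
proof -
  define tail where "tail = {x \<in> X. x 0 \<notin> F}"
  define \<P> where "\<P> = insert tail ((\<lambda>a. cyl [a]) ` F)"
  have tail_sets: "tail \<in> sets \<B>"
  proof -
    have "tail = prefix_set 1 {w. hd w \<notin> F}" by (auto simp: tail_def prefix_set_def)
    then show ?thesis by simp
  qed
  have P_fin: "finite \<P>" "\<P> \<subseteq> sets \<B>" using F tail_sets by (auto simp: \<P>_def)
  have P_part: "partition_on X \<P>"
  proof (rule partition_onI)
    show "\<Union>\<P> = X" by (auto simp: \<P>_def tail_def cylinder_def)
    show "disjnt p q" if "p \<in> \<P>" "q \<in> \<P>" "p \<noteq> q" for p q
      using that by (auto simp: \<P>_def tail_def cylinder_def disjnt_def)
    \<comment> \<open>Elements of a partition must be nonempty; the tail is nonempty because the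
      alphabet is infinite.\<close>
    have "\<not> S \<subseteq> F" using infinite_alphabet F finite_subset by blast
    then obtain a where "a \<in> S" "a \<notin> F" by blast
    then obtain x where "x \<in> cyl [a]" using cyl_nonempty single_word by blast
    then have "x \<in> tail" using \<open>a \<notin> F\<close> by (auto simp: tail_def cylinder_def)
    moreover have "cyl [a] \<noteq> {}" if "a \<in> F" for a using cyl_nonempty[OF single_word] that F by blast
    ultimately show "{} \<notin> \<P>" by (auto simp: \<P>_def)
  qed
  interpret invariant_partition S T \<mu> \<P>
    by unfold_locales (use P_fin P_part in auto)
  \<comment> \<open>The cost of naming a letter in the tail, bounded with the lower Gibbs inequality
    for one letter; off the tail the code already determines the letter.\<close>
  define \<tau> where "\<tau> x = indicator tail x * (P + ln c - \<phi> x)" for x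
  have [measurable]: "\<tau> \<in> borel_measurable \<B>" unfolding \<tau>_def[abs_def] using tail_sets by measurable
  have \<tau>int: "integrable \<mu> \<tau>"
  proof -
    have "integrable \<mu> (\<lambda>x. P + ln c - \<phi> x)" using integrable_potential by simp
    from integrable_mult_indicator[OF _ this, of tail] show ?thesis
      using tail_sets by (simp add: \<tau>_def[abs_def])
  qed
  define d where "d = map_pmf hd (word_law 1)"
  have d: "pmf d (x 0) \<ge> measure \<mu> (cyl [x 0])" if "x \<in> X" for x
  proof -
    have "measure \<mu> (cyl [x 0]) = pmf (word_law 1) [x 0]"
      by (simp add: pmf_word_law cyl_eq_prefix_set)
    also have "\<dots> = measure (measure_pmf (word_law 1)) {[x 0]}" by (simp add: measure_pmf_single)
    also have "\<dots> \<le> measure (measure_pmf (word_law 1)) (hd -` {x 0})"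
      by (intro measure_pmf.finite_measure_mono) auto
    also have "\<dots> = pmf d (x 0)" by (simp add: d_def pmf_map)
    finally show ?thesis .
  qed
  \<comment> \<open>In a one-letter cylinder all points have the same first letter, so any chosen
    point reveals it. In the tail the unconditioned law of the first letter suffices.\<close>
  define letter where "letter A = (if A = tail then d else return_pmf ((SOME x. x \<in> A) 0))" for A
  have letter: "exp (- \<tau> x) \<le> pmf (letter A) (x 0)" if x: "x \<in> A" "A \<in> \<P>" for x A
  proof (cases "A = tail")
    case True
    then have xX: "x \<in> X" using x by (auto simp: tail_def)
    have "exp (- \<tau> x) = exp (- P + \<phi> x) / c"
      using True x c by (simp add: \<tau>_def exp_diff exp_add exp_minus divide_simps)
    also have "\<dots> \<le> measure \<mu> (cyl [x 0])" using gibbs_first(2)[OF xX] c by (simp add: field_simps)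
    also have "\<dots> \<le> pmf d (x 0)" by (rule d[OF xX])
    finally show ?thesis using True by (simp add: letter_def)
  next
    case False
    then obtain a where a: "a \<in> F" "A = cyl [a]" using x by (auto simp: \<P>_def)
    have "(SOME x. x \<in> A) \<in> A" using x by (metis someI)
    then have "(SOME x. x \<in> A) 0 = x 0" using x a by (auto simp: cylinder_def)
    moreover have "x \<notin> tail" using x a by (auto simp: cylinder_def tail_def)
    ultimately show ?thesis using False by (simp add: letter_def \<tau>_def)
  qed
  \<comment> \<open>\<open>L\<close> is a lower bound for the logarithm of the ratio between the
    probability of reconstructing the prefix from its code and the mass of that prefix:
    \<open>- ln c\<close> stems from the upper Gibbs inequality, \<open>\<tau>\<close> from the
    letters in the tail.\<close>
  define L where "L m x = P * m - birkhoff_sum m \<phi> x - ln c - birkhoff_sum m \<tau> x" for m x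
  have Lint: "integrable \<mu> (L m)" for m
    unfolding L_def using integral_birkhoff_sum(1)[OF integrable_potential] integral_birkhoff_sum(1)[OF \<tau>int]
    by (intro Bochner_Integration.integrable_diff) auto
  have Lval: "(\<integral>x. L m x \<partial>\<mu>) = m * (P - (\<integral>x. \<phi> x \<partial>\<mu>) - (\<integral>x. \<tau> x \<partial>\<mu>)) - ln c" for m
  proof -
    have "(\<integral>x. L m x \<partial>\<mu>) = (\<integral>x. (P * m - ln c) - birkhoff_sum m \<phi> x - birkhoff_sum m \<tau> x \<partial>\<mu>)"
      unfolding L_def by (intro Bochner_Integration.integral_cong) auto
    also have "\<dots> = (\<integral>x. (P * m - ln c) - birkhoff_sum m \<phi> x \<partial>\<mu>) - m * (\<integral>x. \<tau> x \<partial>\<mu>)"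
      using integral_birkhoff_sum[OF integrable_potential] integral_birkhoff_sum[OF \<tau>int]
      by (subst Bochner_Integration.integral_diff) auto
    also have "(\<integral>x. (P * m - ln c) - birkhoff_sum m \<phi> x \<partial>\<mu>) = P * m - ln c - m * (\<integral>x. \<phi> x \<partial>\<mu>)"
      using integral_birkhoff_sum[OF integrable_potential] prob_space
      by (subst Bochner_Integration.integral_diff) auto
    finally show ?thesis by (simp add: algebra_simps)
  qed
  have Lle: "(\<integral>x. L m x \<partial>\<mu>) \<le> join_entropy m" if m: "m \<ge> 1" for m
  proof (rule join_entropy_ge[OF Lint])
    fix a assume a: "a \<in> codes m"
    define G where "G = map_pmf (\<lambda>g. map g [0..<m]) (Pi_pmf {..<m} undefined (\<lambda>i. letter (a i)))"
    have pt: "exp (L m x) * measure \<mu> (prefix_set m {prefix_word m x}) \<le> pmf G (prefix_word m x)"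
      if x: "x \<in> atom m a" for x
    proof -
      have xX: "x \<in> X" and xa: "\<And>i. i < m \<Longrightarrow> (left_shift ^^ i) x \<in> a i \<and> a i \<in> \<P>"
        using x a by (auto simp: atom_def)
      let ?h = "\<lambda>i. if i < m then x i else undefined"
      have "exp (L m x) = exp (P * m - birkhoff_sum m \<phi> x) / c * exp (- birkhoff_sum m \<tau> x)"
        using c by (simp add: L_def exp_diff exp_add exp_minus divide_simps)
      then have "exp (L m x) * measure \<mu> (prefix_set m {prefix_word m x})
        = exp (P * m - birkhoff_sum m \<phi> x) / c * exp (- birkhoff_sum m \<tau> x) * measure \<mu> (cyl (prefix_word m x))"
        by (simp only: prefix_set_single[OF xX])
      also have "\<dots> \<le> exp (P * m - birkhoff_sum m \<phi> x) / c * exp (- birkhoff_sum m \<tau> x) * (c * exp (- P * m + birkhoff_sum m \<phi> x))"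
        using c by (intro mult_left_mono gibbs_upper[OF m xX]) auto
      also have "\<dots> = exp (P * m - birkhoff_sum m \<phi> x) * exp (- P * m + birkhoff_sum m \<phi> x) * exp (- birkhoff_sum m \<tau> x)"
        using c by simp
      also have "\<dots> = exp (- birkhoff_sum m \<tau> x)"
        unfolding exp_add[symmetric] by simp
      also have "\<dots> = (\<Prod>i<m. exp (- \<tau> ((left_shift ^^ i) x)))"
        by (simp add: birkhoff_sum_def exp_sum[symmetric] sum_negf)
      also have "\<dots> \<le> (\<Prod>i<m. pmf (letter (a i)) (x i))"
      proof (intro prod_mono conjI)
        fix i assume "i \<in> {..<m}"
        then show "exp (- \<tau> ((left_shift ^^ i) x)) \<le> pmf (letter (a i)) (x i)"
          using letter[of "(left_shift ^^ i) x" "a i"] xa[of i] by (simp add: left_shift_iterate)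
      qed simp
      also have "\<dots> = pmf (Pi_pmf {..<m} undefined (\<lambda>i. letter (a i))) ?h"
        by (subst pmf_Pi) auto
      also have "\<dots> = measure (measure_pmf (Pi_pmf {..<m} undefined (\<lambda>i. letter (a i)))) {?h}"
        by (simp add: measure_pmf_single)
      also have "\<dots> \<le> measure (measure_pmf (Pi_pmf {..<m} undefined (\<lambda>i. letter (a i)))) ((\<lambda>g. map g [0..<m]) -` {prefix_word m x})"
        by (intro measure_pmf.finite_measure_mono) auto
      also have "\<dots> = pmf G (prefix_word m x)" by (simp add: G_def pmf_map)
      finally show ?thesis .
    qed
    \<comment> \<open>Integrated against \<open>\<mu>\<close>, the ratio \<open>R\<close> returns at
      most the total mass of \<open>G\<close>, which is 1.\<close>
    define R where "R w = ennreal (pmf G w / measure \<mu> (prefix_set m {w}))" for w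
    have "(\<integral>\<^sup>+x. indicator (atom m a) x * ennreal (exp (L m x)) \<partial>\<mu>) \<le> (\<integral>\<^sup>+x. R (prefix_word m x) \<partial>\<mu>)"
    proof (rule nn_integral_mono)
      fix x assume "x \<in> space \<mu>"
      then have x: "x \<in> X" by simp
      have "measure \<mu> (prefix_set m {prefix_word m x}) > 0"
        unfolding prefix_set_single[OF x] using prefix_in_words[OF x m] by (rule cyl_pos)
      then have "ennreal (exp (L m x)) \<le> R (prefix_word m x)" if "x \<in> atom m a"
        unfolding R_def using pt[OF that] by (intro ennreal_leI) (simp add: field_simps)
      then show "indicator (atom m a) x * ennreal (exp (L m x)) \<le> R (prefix_word m x)"
        by (auto simp: indicator_def)
    qed
    also have "\<dots> = (\<integral>\<^sup>+w. ennreal (measure \<mu> (prefix_set m {w})) * R w \<partial>count_space UNIV)"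
      by (rule nn_integral_prefix_word)
    also have "\<dots> \<le> (\<integral>\<^sup>+w. pmf G w \<partial>count_space UNIV)"
      unfolding R_def by (intro nn_integral_mono) (auto simp: ennreal_mult[symmetric] intro!: ennreal_leI)
    also have "\<dots> = 1" by (simp add: nn_integral_pmf)
    finally show "(\<integral>\<^sup>+x. indicator (atom m a) x * ennreal (exp (L m x)) \<partial>\<mu>) \<le> 1" .
  qed
  have bound: "P - (\<integral>x. \<phi> x \<partial>\<mu>) - (\<integral>x. \<tau> x \<partial>\<mu>) - ln c * (1 / m) \<le> join_entropy m / m" if "m \<ge> 1" for m
  proof -
    have "(m * (P - (\<integral>x. \<phi> x \<partial>\<mu>) - (\<integral>x. \<tau> x \<partial>\<mu>)) - ln c) / m \<le> join_entropy m / m"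
      using Lle[OF that] unfolding Lval
      by (rule divide_right_mono) simp
    then show ?thesis using that by (simp add: diff_divide_distrib)
  qed
  have "(\<lambda>m. P - (\<integral>x. \<phi> x \<partial>\<mu>) - (\<integral>x. \<tau> x \<partial>\<mu>) - ln c * (1 / real m)) \<longlonglongrightarrow> P - (\<integral>x. \<phi> x \<partial>\<mu>) - (\<integral>x. \<tau> x \<partial>\<mu>) - ln c * 0"
    by (intro tendsto_intros lim_1_over_n)
  then have "P - (\<integral>x. \<phi> x \<partial>\<mu>) - (\<integral>x. \<tau> x \<partial>\<mu>) \<le> entropy_wrt_partition \<mu> left_shift \<P>"
    using bound by (intro LIMSEQ_le[OF _ entropy_limit]) (auto intro!: exI[of _ 1])
  also have "ereal \<dots> \<le> ks_entropy \<mu> left_shift"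
    unfolding ks_entropy_def using P_fin P_part by (intro SUP_upper) auto
  finally show ?thesis by (simp add: \<tau>_def tail_def)
qed

text \<open>The alphabet is exhausted by finite sets \<open>F k\<close>. Since \<open>\<phi>\<close>
  is integrable, the cost of the tails tends to zero by dominated convergence.\<close>

lemma entropy_lower_bound: "ereal (P - (\<integral>x. \<phi> x \<partial>\<mu>)) \<le> ks_entropy \<mu> left_shift"
proof (rule Lim_bounded)
  define F where "F k = from_nat_into S ` {..<k}" for k :: nat
  let ?g = "\<lambda>k x. indicator {x \<in> X. x 0 \<notin> F k} x * (P + ln c - \<phi> x)"
  have F: "finite (F k)" "F k \<subseteq> S" for k
    using from_nat_into[OF nonempty_alphabet] by (auto simp: F_def)
  have meas: "{x \<in> X. x 0 \<notin> F k} \<in> sets \<B>" for k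
  proof -
    have "{x \<in> X. x 0 \<notin> F k} = prefix_set 1 {w. hd w \<notin> F k}" by (auto simp: prefix_set_def)
    then show ?thesis by simp
  qed
  have "(\<lambda>k. \<integral>x. ?g k x \<partial>\<mu>) \<longlonglongrightarrow> (\<integral>x. 0 \<partial>\<mu>)"
  proof (rule integral_dominated_convergence[where w = "\<lambda>x. \<bar>P + ln c - \<phi> x\<bar>"])
    show "integrable \<mu> (\<lambda>x. \<bar>P + ln c - \<phi> x\<bar>)" using integrable_potential by auto
    show "AE x in \<mu>. (\<lambda>k. ?g k x) \<longlonglongrightarrow> 0"
    proof (rule AE_I2)
      fix x assume "x \<in> space \<mu>"
      then have "x 0 \<in> S" by (auto simp: markov_shift_def)
      then obtain j where j: "x 0 = from_nat_into S j"
        by (metis countable_alphabet from_nat_into_surj)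
      have "\<forall>\<^sub>F k in sequentially. ?g k x = 0"
        using eventually_gt_at_top[of j] by eventually_elim (auto simp: j F_def)
      then show "(\<lambda>k. ?g k x) \<longlonglongrightarrow> 0" by (rule tendsto_eventually)
    qed
    show "?g k \<in> borel_measurable \<mu>" for k using meas[of k] by measurable
    show "AE x in \<mu>. norm (?g k x) \<le> \<bar>P + ln c - \<phi> x\<bar>" for k by (auto simp: indicator_def)
  qed simp
  then have "(\<lambda>k. P - (\<integral>x. \<phi> x \<partial>\<mu>) - (\<integral>x. ?g k x \<partial>\<mu>)) \<longlonglongrightarrow> P - (\<integral>x. \<phi> x \<partial>\<mu>) - 0"
    by (intro tendsto_intros) simp
  then show "(\<lambda>k. ereal (P - (\<integral>x. \<phi> x \<partial>\<mu>) - (\<integral>x. ?g k x \<partial>\<mu>))) \<longlonglongrightarrow> ereal (P - (\<integral>x. \<phi> x \<partial>\<mu>))"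
    by simp
  show "\<forall>k\<ge>0. ereal (P - (\<integral>x. \<phi> x \<partial>\<mu>) - (\<integral>x. ?g k x \<partial>\<mu>)) \<le> ks_entropy \<mu> left_shift"
    using entropy_lower_bound_finite[OF F] by auto
qed

section \<open>Pressure and the variational principle\<close>

lemma invariant_measures_potD:
  assumes "\<nu> \<in> invariant_measures_pot S T \<phi>"
  shows "shift_invariant_measure S T \<nu>" "integrable \<nu> \<phi>" "ext_integral \<nu> \<phi> = ereal (\<integral>x. \<phi> x \<partial>\<nu>)"
proof -
  have inv: "\<nu> \<in> invariant_measures S T" using assms by (simp add: invariant_measures_pot_def)
  then have "prob_space \<nu>" by (simp add: invariant_measures_def prob_measures_iff)
  with inv show *: "shift_invariant_measure S T \<nu>"
    by (intro shift_invariant_measure.intro shift_invariant_measure_axioms.intro countable_shift_axioms)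
  obtain b where "\<And>x. x \<in> X \<Longrightarrow> \<phi> x \<le> b"
    using summable_potential_bounded_above[OF potential_summable] by blast
  then show "integrable \<nu> \<phi>"
    using assms shift_invariant_measure.integrable_iff_ext_integral[OF * potential_measurable]
    by (auto simp: invariant_measures_pot_def)
  then show "ext_integral \<nu> \<phi> = ereal (\<integral>x. \<phi> x \<partial>\<nu>)"
    by (rule shift_invariant_measure.ext_integral_eq[OF *])
qed

lemma mu_in_pot: "\<mu> \<in> invariant_measures_pot S T \<phi>"
  using invariant by (simp add: invariant_measures_pot_def ext_integral_eq[OF integrable_potential])

lemma entropy_plus_integral_le:
  assumes "\<nu> \<in> invariant_measures_pot S T \<phi>"
  shows "ks_entropy \<nu> left_shift + ext_integral \<nu> \<phi> \<le> ereal P"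
proof -
  note \<nu> = invariant_measures_potD[OF assms]
  have "ks_entropy \<nu> left_shift + ext_integral \<nu> \<phi> \<le> ereal (P - (\<integral>x. \<phi> x \<partial>\<nu>)) + ereal (\<integral>x. \<phi> x \<partial>\<nu>)"
    unfolding \<nu>(3) using free_energy_upper_bound[OF \<nu>(1,2)] by (rule add_right_mono)
  then show ?thesis by simp
qed

lemma entropy_plus_integral_eq: "ks_entropy \<mu> left_shift + ext_integral \<mu> \<phi> = ereal P"
proof (rule antisym[OF entropy_plus_integral_le[OF mu_in_pot]])
  have "ereal (P - (\<integral>x. \<phi> x \<partial>\<mu>)) + ereal (\<integral>x. \<phi> x \<partial>\<mu>) \<le> ks_entropy \<mu> left_shift + ext_integral \<mu> \<phi>"
    unfolding ext_integral_eq[OF integrable_potential] using entropy_lower_bound by (rule add_right_mono)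
  then show "ereal P \<le> ks_entropy \<mu> left_shift + ext_integral \<mu> \<phi>" by simp
qed

lemma pressure_eq: "pressure S T \<phi> = ereal P"
  unfolding pressure_def
proof (rule antisym)
  show "(SUP \<nu>\<in>invariant_measures_pot S T \<phi>. ks_entropy \<nu> left_shift + ext_integral \<nu> \<phi>) \<le> ereal P"
    by (intro SUP_least entropy_plus_integral_le)
  show "ereal P \<le> (SUP \<nu>\<in>invariant_measures_pot S T \<phi>. ks_entropy \<nu> left_shift + ext_integral \<nu> \<phi>)"
    using mu_in_pot by (rule SUP_upper2) (simp add: entropy_plus_integral_eq)
qed

text \<open>Each supremum in \<open>Z_n\<close> agrees, up to the factor \<open>c\<close>, with
  \<open>exp (P * n)\<close> times the mass of its cylinder, and these masses add up to 1. Hence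
  \<open>ln Z_n\<close> differs from \<open>P * n\<close> by a bounded amount.\<close>

lemma partition_function_bounds:
  assumes n: "n \<ge> 1"
  shows "ennreal (exp (P * n) / c) \<le> partition_function S T n \<phi>"
    and "partition_function S T n \<phi> \<le> ennreal (c * exp (P * n))"
proof -
  let ?s = "\<lambda>w. SUP x\<in>cyl w. ennreal (exp (birkhoff_sum n \<phi> x))"
  have pf: "partition_function S T n \<phi> = (\<integral>\<^sup>+w. ?s w \<partial>count_space (W n))"
    unfolding partition_function_def by (rule nn_integral_count_space_eq_infsum[OF W_countable, symmetric])
  have one: "(\<integral>\<^sup>+w. ennreal (measure \<mu> (cyl w)) \<partial>count_space (W n)) = 1"
  proof -
    have "(\<integral>\<^sup>+w. ennreal (measure \<mu> (cyl w)) \<partial>count_space (W n)) = (\<integral>\<^sup>+w. emeasure \<mu> (prefix_set n {w}) \<partial>count_space (W n))"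
      by (intro nn_integral_cong) (auto simp: emeasure_eq_measure cyl_eq_prefix_set words_def)
    also have "\<dots> = emeasure \<mu> (prefix_set n (W n))" by (rule emeasure_prefix_set)
    also have "prefix_set n (W n) = space \<mu>" using prefix_in_words[OF _ n] by (auto simp: prefix_set_def)
    finally show ?thesis unfolding emeasure_space_1 .
  qed
  have up: "?s w \<le> ennreal (c * exp (P * n)) * ennreal (measure \<mu> (cyl w))" if w: "w \<in> W n" for w
  proof (rule SUP_least)
    fix x assume x: "x \<in> cyl w"
    then have xX: "x \<in> X" "prefix_word n x = w" using w by (auto simp: cyl_iff words_def)
    have "exp (birkhoff_sum n \<phi> x) = exp (P * n) * exp (- P * n + birkhoff_sum n \<phi> x)"
      by (simp add: exp_add[symmetric])
    also have "\<dots> \<le> exp (P * n) * (c * measure \<mu> (cyl w))"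
      using gibbs_lower[OF n xX(1)] xX by (intro mult_left_mono) auto
    finally show "ennreal (exp (birkhoff_sum n \<phi> x)) \<le> ennreal (c * exp (P * n)) * ennreal (measure \<mu> (cyl w))"
      using c by (subst ennreal_mult[symmetric]) (auto intro!: ennreal_leI simp: mult_ac)
  qed
  have low: "ennreal (exp (P * n) / c) * ennreal (measure \<mu> (cyl w)) \<le> ?s w" if w: "w \<in> W n" for w
  proof -
    obtain x where x: "x \<in> cyl w" using cyl_nonempty[OF w] by blast
    then have xX: "x \<in> X" "prefix_word n x = w" using w by (auto simp: cyl_iff words_def)
    have "exp (P * n) / c * measure \<mu> (cyl w) \<le> exp (P * n) / c * (c * exp (- P * n + birkhoff_sum n \<phi> x))"
      using gibbs_upper[OF n xX(1)] xX c by (intro mult_left_mono) auto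
    also have "\<dots> = exp (birkhoff_sum n \<phi> x)" using c by (simp add: exp_add[symmetric])
    finally have "ennreal (exp (P * n) / c) * ennreal (measure \<mu> (cyl w)) \<le> ennreal (exp (birkhoff_sum n \<phi> x))"
      using c by (subst ennreal_mult[symmetric]) (auto intro!: ennreal_leI)
    also have "\<dots> \<le> ?s w" using x by (rule SUP_upper)
    finally show ?thesis .
  qed
  have "ennreal (exp (P * n) / c) = (\<integral>\<^sup>+w. ennreal (exp (P * n) / c) * ennreal (measure \<mu> (cyl w)) \<partial>count_space (W n))"
    by (subst nn_integral_cmult) (auto simp: one)
  also have "\<dots> \<le> partition_function S T n \<phi>"
    unfolding pf using low by (intro nn_integral_mono) auto
  finally show "ennreal (exp (P * n) / c) \<le> partition_function S T n \<phi>" .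
  have "partition_function S T n \<phi> \<le> (\<integral>\<^sup>+w. ennreal (c * exp (P * n)) * ennreal (measure \<mu> (cyl w)) \<partial>count_space (W n))"
    unfolding pf using up by (intro nn_integral_mono) auto
  also have "\<dots> = ennreal (c * exp (P * n))" by (subst nn_integral_cmult) (auto simp: one)
  finally show "partition_function S T n \<phi> \<le> ennreal (c * exp (P * n))" .
qed

lemma variational_principle_holds: "variational_principle S T \<phi>"
proof -
  define z where "z n = enn2real (partition_function S T n \<phi>)" for n
  have z: "partition_function S T n \<phi> = ennreal (z n)" "exp (P * n) / c \<le> z n" "z n \<le> c * exp (P * n)" if "n \<ge> 1" for n
  proof -
    have "partition_function S T n \<phi> < \<infinity>"
      using partition_function_bounds(2)[OF that] by (simp add: le_less_trans[OF _ ennreal_less_top])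
    then show *: "partition_function S T n \<phi> = ennreal (z n)" by (simp add: z_def)
    show "exp (P * n) / c \<le> z n" "z n \<le> c * exp (P * n)"
      using partition_function_bounds[OF that] c unfolding * by (auto simp: z_def ennreal_le_iff)
  qed
  have ln_z: "P - ln c * (1 / n) \<le> ln (z n) / n" "ln (z n) / n \<le> P + ln c * (1 / n)" "z n > 0" if n: "n \<ge> 1" for n
  proof -
    have pos: "exp (P * n) / c > 0" using c by simp
    then show zp: "z n > 0" using z(2)[OF n] by linarith
    have "ln (exp (P * n) / c) \<le> ln (z n)" using z(2)[OF n] pos zp by simp
    moreover have "ln (z n) \<le> ln (c * exp (P * n))" using z(3)[OF n] zp c by simp
    ultimately have "P * n - ln c \<le> ln (z n)" "ln (z n) \<le> ln c + P * n" using c by (auto simp: ln_div ln_mult)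
    then show "P - ln c * (1 / n) \<le> ln (z n) / n" "ln (z n) / n \<le> P + ln c * (1 / n)"
      using n by (simp_all add: divide_simps)
  qed
  have "(\<lambda>n. P - ln c * (1 / real n)) \<longlonglongrightarrow> P - ln c * 0" "(\<lambda>n. P + ln c * (1 / real n)) \<longlonglongrightarrow> P + ln c * 0"
    by (intro tendsto_intros lim_1_over_n)+
  then have lims: "(\<lambda>n. P - ln c * (1 / real n)) \<longlonglongrightarrow> P" "(\<lambda>n. P + ln c * (1 / real n)) \<longlonglongrightarrow> P"
    by simp_all
  have "(\<lambda>n. ln (z n) / n) \<longlonglongrightarrow> P"
    by (rule tendsto_sandwich[OF eventually_sequentiallyI eventually_sequentiallyI lims], rule ln_z(1), assumption, rule ln_z(2))
  then have "(\<lambda>n. ereal (ln (z n) / n)) \<longlonglongrightarrow> ereal P" by simp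
  then show ?thesis
    unfolding variational_principle_def pressure_eq
  proof (rule Lim_transform_eventually)
    show "\<forall>\<^sub>F n in sequentially. ereal (ln (z n) / real n) = ext_ln (partition_function S T n \<phi>) / ereal (real n)"
      using eventually_ge_at_top[of 1]
    proof eventually_elim
      case (elim n)
      have "ext_ln (partition_function S T n \<phi>) = ereal (ln (z n))"
        using z(1)[OF elim] ln_z(3)[OF elim] by (simp add: ext_ln_def)
      then show ?case using elim by simp
    qed
  qed
qed

lemma equilibrium_mu: "equilibrium_state S T \<phi> \<mu>"
  unfolding equilibrium_state_def
  using variational_principle_holds mu_in_pot entropy_plus_integral_eq by (simp add: pressure_eq)

end

section \<open>Ergodicity of Gibbs measures\<close>

lemma (in countable_shift) all_words_iff: "w \<in> all_words S T \<longleftrightarrow> w \<in> W (length w)"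
  by (auto simp: all_words_def words_def)

text \<open>Rewriting with one more letter excludes length zero, where neither words nor Gibbs
  inequalities are available.\<close>

lemma (in countable_shift) prefix_set_Suc: "prefix_set n Q = prefix_set (Suc n) {w. take n w \<in> Q}"
  unfolding prefix_set_def by (simp only: mem_Collect_eq take_prefix_word[OF le_SucI[OF order_refl]])

lemma (in shift_invariant_measure) emeasure_pullback:
  assumes "E \<in> sets \<B>"
  shows "emeasure \<nu> (E \<inter> ((left_shift ^^ k) -` prefix_set m Q \<inter> X)) =
    (\<integral>\<^sup>+w. emeasure \<nu> (E \<inter> ((left_shift ^^ k) -` cyl w \<inter> X)) \<partial>count_space (Q \<inter> lists S \<inter> {w. length w = m}))"
proof -
  have eq: "E \<inter> ((left_shift ^^ k) -` prefix_set m Q \<inter> X)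
      = (\<Union>w\<in>Q \<inter> lists S \<inter> {w. length w = m}. E \<inter> ((left_shift ^^ k) -` cyl w \<inter> X))"
    unfolding prefix_set_union by auto
  have "E \<inter> ((left_shift ^^ k) -` cyl w \<inter> X) \<in> sets \<nu>" for w
    using assms measurable_sets[OF measurable_shift_iterate cyl_sets, of k w] by auto
  moreover have "countable (Q \<inter> lists S \<inter> {w. length w = m})"
    using countable_alphabet countable_lists by (auto intro: countable_subset[of _ "lists S"])
  moreover have "disjoint_family_on (\<lambda>w. E \<inter> ((left_shift ^^ k) -` cyl w \<inter> X)) (Q \<inter> lists S \<inter> {w. length w = m})"
    by (auto simp: disjoint_family_on_def cyl_iff)
  ultimately show ?thesis unfolding eq by (intro emeasure_UN_countable)
qed

text \<open>The connectors are nonempty words, also for the full shift, so that the Gibbs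
  inequalities apply to them.\<close>

locale irreducible_gibbs_measure = gibbs_measure S T \<mu> \<phi> c P \<beta>
  for S :: "'a set" and T and \<mu> :: "(nat \<Rightarrow> 'a) measure" and \<phi> c P \<beta> +
  fixes \<Lambda> :: "'a list set"
  assumes connectors: "finite \<Lambda>" "\<Lambda> \<subseteq> all_words S T"
    and connect: "\<And>u v. u \<in> all_words S T \<Longrightarrow> v \<in> all_words S T \<Longrightarrow> \<exists>l\<in>\<Lambda>. u @ l @ v \<in> all_words S T"
begin

lemma connectors_nonempty: "\<Lambda> \<noteq> {}"
proof -
  obtain a where "a \<in> S" using nonempty_alphabet by blast
  then have "[a] \<in> all_words S T" by (simp add: all_words_iff words_def)
  then show ?thesis using connect by blast
qed

text \<open>The power \<open>c ^ 4\<close> collects three upper Gibbs inequalities, for the two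
  words and the connector, and one lower inequality for their concatenation. The minimum is positive
  because there are finitely many connectors.\<close>

definition \<kappa> :: real where "\<kappa> = Min ((\<lambda>l. measure \<mu> (cyl l)) ` \<Lambda>) / c ^ 4"

lemma kappa_pos: "\<kappa> > 0"
proof -
  have "measure \<mu> (cyl l) > 0" if "l \<in> \<Lambda>" for l
    using connectors that by (intro cyl_pos) (auto simp: all_words_iff)
  then show ?thesis using connectors connectors_nonempty c by (simp add: \<kappa>_def)
qed

text \<open>Along a connected word \<open>u @ l @ v\<close> the Birkhoff sums add up, so the Gibbs
  inequalities compare its mass with the product of the masses. The sum over all connectors frees
  the right-hand side from the choice of \<open>l\<close>, which depends on \<open>u\<close> and
  \<open>v\<close>; the inequality can then be extended additively in either word.\<close>

lemma cylinder_mixing: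
  assumes u: "u \<in> all_words S T" and v: "v \<in> all_words S T"
  shows "\<kappa> * measure \<mu> (cyl u) * measure \<mu> (cyl v)
    \<le> (\<Sum>l\<in>\<Lambda>. measure \<mu> (cyl u \<inter> ((left_shift ^^ (length u + length l)) -` cyl v \<inter> X)))"
proof -
  obtain l where l: "l \<in> \<Lambda>" "u @ l @ v \<in> all_words S T" using connect[OF u v] by blast
  let ?n = "length u" and ?k = "length l" and ?m = "length v"
  have lens: "?n \<ge> 1" "?k \<ge> 1" "?m \<ge> 1"
    using u v l connectors by (auto simp: all_words_iff words_def)
  obtain x where x: "x \<in> cyl (u @ l @ v)" using cyl_nonempty l(2) unfolding all_words_iff by blast
  have split: "y \<in> X \<and> prefix_word ?n y = u \<and> prefix_word ?k ((left_shift ^^ ?n) y) = l \<and>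
      prefix_word ?m ((left_shift ^^ (?n + ?k)) y) = v" if y: "y \<in> cyl (u @ l @ v)" for y
  proof -
    have yX: "y \<in> X" and "prefix_word (?n + (?k + ?m)) y = u @ l @ v"
      using y unfolding cyl_iff by auto
    then have "prefix_word ?n y @ prefix_word ?k ((left_shift ^^ ?n) y) @
        prefix_word ?m ((left_shift ^^ ?k) ((left_shift ^^ ?n) y)) = u @ l @ v"
      by (simp only: prefix_word_add)
    moreover have "(left_shift ^^ ?k) ((left_shift ^^ ?n) y) = (left_shift ^^ (?n + ?k)) y"
      by (simp add: left_shift_iterate add.assoc)
    ultimately show ?thesis
      using yX by (simp add: append_eq_append_conv)
  qed
  note sx = split[OF x]
  define g where "g n y = exp (- P * real n + birkhoff_sum n \<phi> y)" for n and y :: "nat \<Rightarrow> 'a"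
  have g_split: "g (?n + (?k + ?m)) x = g ?n x * (g ?k ((left_shift ^^ ?n) x) * g ?m ((left_shift ^^ (?n + ?k)) x))"
    unfolding g_def birkhoff_sum_add by (simp add: exp_add[symmetric] algebra_simps left_shift_iterate)
  have g_le: "g (?n + (?k + ?m)) x \<le> c * measure \<mu> (cyl (u @ l @ v))"
  proof -
    have "prefix_word (?n + (?k + ?m)) x = u @ l @ v" using x unfolding cyl_iff by auto
    then show ?thesis using gibbs_lower[of "?n + (?k + ?m)" x] sx lens unfolding g_def by simp
  qed
  have mu: "measure \<mu> (cyl u) \<le> c * g ?n x"
    using gibbs_upper[of ?n x] sx lens unfolding g_def by simp
  have ml: "measure \<mu> (cyl l) \<le> c * g ?k ((left_shift ^^ ?n) x)"
    using gibbs_upper[of ?k "(left_shift ^^ ?n) x"] sx lens shift_iterate_in_X unfolding g_def by simp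
  have mv: "measure \<mu> (cyl v) \<le> c * g ?m ((left_shift ^^ (?n + ?k)) x)"
    using gibbs_upper[of ?m "(left_shift ^^ (?n + ?k)) x"] sx lens shift_iterate_in_X unfolding g_def by simp
  have "measure \<mu> (cyl u) * (measure \<mu> (cyl l) * measure \<mu> (cyl v))
      \<le> (c * g ?n x) * ((c * g ?k ((left_shift ^^ ?n) x)) * (c * g ?m ((left_shift ^^ (?n + ?k)) x)))"
    using c by (intro mult_mono mu ml mv mult_nonneg_nonneg) (auto simp: g_def)
  also have "\<dots> = c ^ 3 * g (?n + (?k + ?m)) x"
    unfolding g_split by (simp add: power3_eq_cube mult_ac)
  also have "\<dots> \<le> c ^ 3 * (c * measure \<mu> (cyl (u @ l @ v)))"
    using g_le c by (intro mult_left_mono) auto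
  finally have "measure \<mu> (cyl u) * (measure \<mu> (cyl l) * measure \<mu> (cyl v)) \<le> c ^ 3 * (c * measure \<mu> (cyl (u @ l @ v)))" .
  then have "measure \<mu> (cyl l) / c ^ 4 * (measure \<mu> (cyl u) * measure \<mu> (cyl v)) \<le> measure \<mu> (cyl (u @ l @ v))"
    using c by (simp add: field_simps power3_eq_cube power4_eq_xxxx)
  moreover have "\<kappa> * (measure \<mu> (cyl u) * measure \<mu> (cyl v)) \<le> measure \<mu> (cyl l) / c ^ 4 * (measure \<mu> (cyl u) * measure \<mu> (cyl v))"
    unfolding \<kappa>_def using connectors l c by (intro mult_right_mono divide_right_mono Min_le) auto
  moreover have "measure \<mu> (cyl (u @ l @ v)) \<le> measure \<mu> (cyl u \<inter> ((left_shift ^^ (?n + ?k)) -` cyl v \<inter> X))"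
  proof (rule finite_measure_mono)
    show "cyl (u @ l @ v) \<subseteq> cyl u \<inter> ((left_shift ^^ (?n + ?k)) -` cyl v \<inter> X)"
      using split shift_iterate_in_X by (auto simp only: cyl_iff[of _ u] cyl_iff[of _ v] vimage_eq Int_iff)
    show "cyl u \<inter> ((left_shift ^^ (?n + ?k)) -` cyl v \<inter> X) \<in> sets \<mu>"
      using measurable_sets[OF measurable_shift_iterate cyl_sets, of "?n + ?k" v] by auto
  qed
  moreover have "measure \<mu> (cyl u \<inter> ((left_shift ^^ (?n + ?k)) -` cyl v \<inter> X))
      \<le> (\<Sum>l\<in>\<Lambda>. measure \<mu> (cyl u \<inter> ((left_shift ^^ (length u + length l)) -` cyl v \<inter> X)))"
    using connectors(1) l(1) by (intro member_le_sum) auto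
  ultimately show ?thesis by (simp add: mult.assoc)
qed

text \<open>Both sides are countably additive in the cylinder, which gives prefix sets;
  approximation then gives Borel sets, since invariance keeps the error small after shifting. The
  family \<open>E\<close>, \<open>k\<close> is general because the extension is made once in each of
  the two words.\<close>

lemma extend_cylinder_inequality:
  fixes E :: "'i \<Rightarrow> (nat \<Rightarrow> 'a) set" and k :: "'i \<Rightarrow> nat"
  assumes I: "finite I" and E: "\<And>i. i \<in> I \<Longrightarrow> E i \<in> sets \<B>" and a: "a \<ge> 0"
    and le: "\<And>w. w \<in> all_words S T \<Longrightarrow>
      a * measure \<mu> (cyl w) \<le> (\<Sum>i\<in>I. measure \<mu> (E i \<inter> ((left_shift ^^ k i) -` cyl w \<inter> X)))"
    and B: "B \<in> sets \<B>"
  shows "a * measure \<mu> B \<le> (\<Sum>i\<in>I. measure \<mu> (E i \<inter> ((left_shift ^^ k i) -` B \<inter> X)))"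
proof -
  have pull: "(left_shift ^^ j) -` C \<inter> X \<in> sets \<B>" if "C \<in> sets \<B>" for C j
    using measurable_sets[OF measurable_shift_iterate that, of j] by simp
  have pos: "a * measure \<mu> (prefix_set m Q) \<le> (\<Sum>i\<in>I. measure \<mu> (E i \<inter> ((left_shift ^^ k i) -` prefix_set m Q \<inter> X)))"
    if m: "m \<ge> 1" for m Q
  proof -
    let ?R = "Q \<inter> lists S \<inter> {w. length w = m}"
    have le': "a * measure \<mu> (cyl w) \<le> (\<Sum>i\<in>I. measure \<mu> (E i \<inter> ((left_shift ^^ k i) -` cyl w \<inter> X)))" if "w \<in> ?R" for w
    proof (cases "cyl w = {}")
      case False
      then obtain x where "x \<in> cyl w" by blast
      then have "x \<in> X" "prefix_word m x = w" using that by (auto simp: cyl_iff)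
      then have "w \<in> W m" using prefix_in_words m by blast
      then have "w \<in> all_words S T" using that by (simp add: all_words_iff)
      then show ?thesis by (rule le)
    qed simp
    \<comment> \<open>The zeroth iterate is inserted so that \<open>emeasure_pullback\<close>
      decomposes the left-hand side in the same way as the right-hand side.\<close>
    have "ennreal (a * measure \<mu> (prefix_set m Q)) = ennreal a * emeasure \<mu> (X \<inter> ((left_shift ^^ 0) -` prefix_set m Q \<inter> X))"
    proof -
      have "X \<inter> ((left_shift ^^ 0) -` prefix_set m Q \<inter> X) = prefix_set m Q" by (auto simp: prefix_set_def)
      then show ?thesis using a by (simp add: emeasure_eq_measure ennreal_mult)
    qed
    also have "\<dots> = (\<integral>\<^sup>+w. ennreal a * emeasure \<mu> (X \<inter> ((left_shift ^^ 0) -` cyl w \<inter> X)) \<partial>count_space ?R)"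
      using sets.top[of \<B>] by (subst emeasure_pullback) (auto simp: nn_integral_cmult)
    also have "\<dots> = (\<integral>\<^sup>+w. ennreal (a * measure \<mu> (cyl w)) \<partial>count_space ?R)"
    proof (rule nn_integral_cong)
      fix w
      have "X \<inter> ((left_shift ^^ 0) -` cyl w \<inter> X) = cyl w" using cyl_subset by auto
      then show "ennreal a * emeasure \<mu> (X \<inter> ((left_shift ^^ 0) -` cyl w \<inter> X)) = ennreal (a * measure \<mu> (cyl w))"
        using a by (simp add: emeasure_eq_measure ennreal_mult)
    qed
    also have "\<dots> \<le> (\<integral>\<^sup>+w. ennreal (\<Sum>i\<in>I. measure \<mu> (E i \<inter> ((left_shift ^^ k i) -` cyl w \<inter> X))) \<partial>count_space ?R)"
      using le' by (intro nn_integral_mono ennreal_leI) auto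
    also have "\<dots> = (\<integral>\<^sup>+w. (\<Sum>i\<in>I. emeasure \<mu> (E i \<inter> ((left_shift ^^ k i) -` cyl w \<inter> X))) \<partial>count_space ?R)"
      by (intro nn_integral_cong) (simp add: emeasure_eq_measure)
    also have "\<dots> = (\<Sum>i\<in>I. emeasure \<mu> (E i \<inter> ((left_shift ^^ k i) -` prefix_set m Q \<inter> X)))"
      using E by (subst nn_integral_sum) (auto simp: emeasure_pullback)
    also have "\<dots> = ennreal (\<Sum>i\<in>I. measure \<mu> (E i \<inter> ((left_shift ^^ k i) -` prefix_set m Q \<inter> X)))"
      by (simp add: emeasure_eq_measure)
    finally show ?thesis by (simp add: ennreal_le_iff sum_nonneg)
  qed
  have all: "a * measure \<mu> (prefix_set m Q) \<le> (\<Sum>i\<in>I. measure \<mu> (E i \<inter> ((left_shift ^^ k i) -` prefix_set m Q \<inter> X)))" for m Q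
    unfolding prefix_set_Suc[of m Q] by (rule pos) simp
  let ?N = "a + card I"
  have N: "?N \<ge> 0" using a by simp
  show ?thesis
  proof (rule field_le_epsilon)
    fix e :: real assume e: "e > 0"
    \<comment> \<open>The approximation costs \<open>a * e'\<close> on the left and
      \<open>e'\<close> for each index on the right.\<close>
    define e' where "e' = e / (?N + 1)"
    have e': "e' > 0" using e N by (simp add: e'_def)
    obtain m Q where mQ: "measure \<mu> ((B - prefix_set m Q) \<union> (prefix_set m Q - B)) < e'"
      using approximation_by_prefix_sets[of \<mu> \<mu> B e'] B e' finite_measure_axioms by auto
    let ?C = "prefix_set m Q" and ?D = "(B - prefix_set m Q) \<union> (prefix_set m Q - B)"
    have D: "?D \<in> sets \<B>" using B by auto
    have "measure \<mu> B \<le> measure \<mu> (?C \<union> ?D)" using B D by (intro finite_measure_mono) auto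
    also have "\<dots> \<le> measure \<mu> ?C + measure \<mu> ?D" using D by (intro measure_Un_le) auto
    finally have "a * measure \<mu> B \<le> a * (measure \<mu> ?C + e')" using mQ a by (intro mult_left_mono) auto
    also have "\<dots> = a * measure \<mu> ?C + a * e'" by (simp add: algebra_simps)
    also have "a * measure \<mu> ?C \<le> (\<Sum>i\<in>I. measure \<mu> (E i \<inter> ((left_shift ^^ k i) -` ?C \<inter> X)))" by (rule all)
    also have "\<dots> \<le> (\<Sum>i\<in>I. measure \<mu> (E i \<inter> ((left_shift ^^ k i) -` B \<inter> X)) + e')"
    proof (rule sum_mono)
      fix i assume i: "i \<in> I"
      let ?p = "\<lambda>C. (left_shift ^^ k i) -` C \<inter> X"
      have "measure \<mu> (E i \<inter> ?p ?C) \<le> measure \<mu> ((E i \<inter> ?p B) \<union> ?p ?D)"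
        using E[OF i] pull[OF B] pull[OF D] by (intro finite_measure_mono) auto
      also have "\<dots> \<le> measure \<mu> (E i \<inter> ?p B) + measure \<mu> (?p ?D)"
        using E[OF i] pull[OF B] pull[OF D] by (intro measure_Un_le) auto
      also have "measure \<mu> (?p ?D) = measure \<mu> ?D" by (rule measure_shift[OF D])
      finally show "measure \<mu> (E i \<inter> ?p ?C) \<le> measure \<mu> (E i \<inter> ?p B) + e'" using mQ by linarith
    qed
    also have "\<dots> = (\<Sum>i\<in>I. measure \<mu> (E i \<inter> ((left_shift ^^ k i) -` B \<inter> X))) + card I * e'"
      by (simp add: sum.distrib)
    finally have "a * measure \<mu> B \<le> (\<Sum>i\<in>I. measure \<mu> (E i \<inter> ((left_shift ^^ k i) -` B \<inter> X))) + ?N * e'"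
      by (simp add: algebra_simps)
    also have "?N * e' \<le> e" using e N by (simp add: e'_def field_simps)
    finally show "a * measure \<mu> B \<le> (\<Sum>i\<in>I. measure \<mu> (E i \<inter> ((left_shift ^^ k i) -` B \<inter> X))) + e" by simp
  qed
qed

text \<open>Extending the mixing inequality from \<open>v\<close> to the invariant set
  \<open>A\<close> replaces the shifted copies of \<open>A\<close> by \<open>A\<close> itself, up to
  null sets. Extending in \<open>u\<close> to the complement of \<open>A\<close> then bounds a
  positive multiple of \<open>\<mu>(A) \<mu>(X - A)\<close> by the mass of
  \<open>A \<inter> (X - A)\<close>.\<close>

lemma ergodic:
  assumes A: "A \<in> sets \<B>"
    and inv: "measure \<mu> (A - (left_shift -` A \<inter> X)) = 0" "measure \<mu> ((left_shift -` A \<inter> X) - A) = 0"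
  shows "measure \<mu> A = 0 \<or> measure \<mu> A = 1"
proof -
  have pull: "(left_shift ^^ j) -` C \<inter> X \<in> sets \<B>" if "C \<in> sets \<B>" for C j
    using measurable_sets[OF measurable_shift_iterate that, of j] by simp
  have null: "measure \<mu> (((left_shift ^^ j) -` A \<inter> X) - A) = 0" for j
  proof (induction j)
    case (Suc j)
    let ?B = "(left_shift -` A \<inter> X) - A"
    have B: "?B \<in> sets \<B>" using A pull[OF A, of 1] by auto
    have "((left_shift ^^ Suc j) -` A \<inter> X) - A \<subseteq> ((left_shift ^^ j) -` ?B \<inter> X) \<union> (((left_shift ^^ j) -` A \<inter> X) - A)"
      using shift_iterate_in_X by auto
    then have "measure \<mu> (((left_shift ^^ Suc j) -` A \<inter> X) - A) \<le> measure \<mu> (((left_shift ^^ j) -` ?B \<inter> X) \<union> (((left_shift ^^ j) -` A \<inter> X) - A))"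
      using A B pull by (intro finite_measure_mono) auto
    also have "\<dots> \<le> measure \<mu> ((left_shift ^^ j) -` ?B \<inter> X) + measure \<mu> (((left_shift ^^ j) -` A \<inter> X) - A)"
      using A B pull by (intro measure_Un_le) auto
    also have "\<dots> = 0" using Suc inv(2) measure_shift[OF B, of j] by simp
    finally show ?case by (rule antisym) (rule measure_nonneg)
  next
    case 0
    have "((left_shift ^^ 0) -` A \<inter> X) - A = {}" by auto
    then show ?case by (simp only: measure_empty)
  qed
  \<comment> \<open>The trivial iterate \<open>left_shift ^^ 0\<close> is kept so that this
    inequality fits \<open>extend_cylinder_inequality\<close> a second time.\<close>
  have cyl_A: "\<kappa> * measure \<mu> A * measure \<mu> (cyl u) \<le> (\<Sum>l\<in>\<Lambda>. measure \<mu> (A \<inter> ((left_shift ^^ 0) -` cyl u \<inter> X)))"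
    if u: "u \<in> all_words S T" for u
  proof -
    have "\<kappa> * measure \<mu> (cyl u) * measure \<mu> A
        \<le> (\<Sum>l\<in>\<Lambda>. measure \<mu> (cyl u \<inter> ((left_shift ^^ (length u + length l)) -` A \<inter> X)))"
      by (rule extend_cylinder_inequality[where E = "\<lambda>_. cyl u" and k = "\<lambda>l. length u + length l",
            OF connectors(1) cyl_sets _ cylinder_mixing[OF u] A]) (use kappa_pos in auto)
    also have "\<dots> \<le> (\<Sum>l\<in>\<Lambda>. measure \<mu> (A \<inter> ((left_shift ^^ 0) -` cyl u \<inter> X)))"
    proof (rule sum_mono)
      fix l assume "l \<in> \<Lambda>"
      let ?j = "length u + length l"
      have "measure \<mu> (cyl u \<inter> ((left_shift ^^ ?j) -` A \<inter> X)) \<le> measure \<mu> ((A \<inter> (cyl u \<inter> X)) \<union> (((left_shift ^^ ?j) -` A \<inter> X) - A))"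
        using A pull[OF A, of ?j] sets.top[of \<B>] by (intro finite_measure_mono) auto
      also have "\<dots> \<le> measure \<mu> (A \<inter> (cyl u \<inter> X)) + measure \<mu> (((left_shift ^^ ?j) -` A \<inter> X) - A)"
        using A pull[OF A, of ?j] sets.top[of \<B>] by (intro measure_Un_le) auto
      finally show "measure \<mu> (cyl u \<inter> ((left_shift ^^ ?j) -` A \<inter> X)) \<le> measure \<mu> (A \<inter> ((left_shift ^^ 0) -` cyl u \<inter> X))"
        using null[of ?j] by simp
    qed
    finally show ?thesis by (simp only: mult_ac)
  qed
  have cA: "X - A \<in> sets \<B>" using A sets.compl_sets[of A \<B>] by simp
  have "\<kappa> * measure \<mu> A * measure \<mu> (X - A) \<le> (\<Sum>l\<in>\<Lambda>. measure \<mu> (A \<inter> ((left_shift ^^ 0) -` (X - A) \<inter> X)))"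
    by (rule extend_cylinder_inequality[where E = "\<lambda>_. A" and k = "\<lambda>_. 0", OF connectors(1) A _ cyl_A cA])
      (use kappa_pos in auto)
  also have "A \<inter> ((left_shift ^^ 0) -` (X - A) \<inter> X) = {}" by auto
  finally have "\<kappa> * measure \<mu> A * measure \<mu> (X - A) \<le> 0" by simp
  moreover have "measure \<mu> (X - A) = 1 - measure \<mu> A" using prob_compl[of A] A by simp
  moreover have "0 \<le> \<kappa> * measure \<mu> A * measure \<mu> (X - A)" using kappa_pos by simp
  ultimately have "\<kappa> * measure \<mu> A * (1 - measure \<mu> A) = 0" by simp
  then show ?thesis using kappa_pos by simp
qed

text \<open>A \<open>\<mu>\<close>-null set is approximated, for both measures, by a prefix set of
  \<open>\<mu>\<close>-mass below \<open>exp (- j)\<close>. The logarithm is then at least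
  \<open>j\<close>, so the bound leaves \<open>\<nu>\<close>-mass at most
  \<open>\<bar>K\<bar> / j\<close>.\<close>

lemma absolutely_continuous_of_bound:
  assumes \<nu>: "shift_invariant_measure S T \<nu>"
    and bound: "\<And>n Q. measure \<mu> (prefix_set n Q) > 0 \<Longrightarrow>
      measure \<nu> (prefix_set n Q) * ln (1 / measure \<mu> (prefix_set n Q)) \<le> K"
    and A: "A \<in> sets \<B>" "measure \<mu> A = 0"
  shows "measure \<nu> A = 0"
proof -
  interpret \<nu>: shift_invariant_measure S T \<nu> by fact
  have small: "measure \<nu> A \<le> \<bar>K\<bar> * (1 / j) + exp (- real j)" if j: "j \<ge> 1" for j :: nat
  proof -
    obtain n Q where nQ: "measure \<mu> ((A - prefix_set n Q) \<union> (prefix_set n Q - A)) < exp (- real j)"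
      "measure \<nu> ((A - prefix_set n Q) \<union> (prefix_set n Q - A)) < exp (- real j)"
      using approximation_by_prefix_sets[of \<mu> \<nu> A "exp (- real j)"] A finite_measure_axioms \<nu>.finite_measure_axioms
      by auto
    let ?C = "prefix_set n Q" and ?D = "(A - prefix_set n Q) \<union> (prefix_set n Q - A)"
    have D: "?D \<in> sets \<B>" using A by auto
    have "measure \<mu> ?C \<le> measure \<mu> (A \<union> ?D)" using A D by (intro finite_measure_mono) auto
    also have "\<dots> \<le> measure \<mu> A + measure \<mu> ?D" using A D by (intro measure_Un_le) auto
    finally have C: "measure \<mu> ?C < exp (- real j)" using nQ A by linarith
    have "measure \<nu> A \<le> measure \<nu> (?C \<union> ?D)" using A D by (intro \<nu>.finite_measure_mono) auto
    also have "\<dots> \<le> measure \<nu> ?C + measure \<nu> ?D" using A D by (intro measure_Un_le) auto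
    finally have 1: "measure \<nu> A \<le> measure \<nu> ?C + exp (- real j)" using nQ by linarith
    have 2: "measure \<nu> ?C \<le> \<bar>K\<bar> * (1 / j)"
    proof (cases "measure \<mu> ?C > 0")
      case True
      have "ln (measure \<mu> ?C) < ln (exp (- real j))" using C True by (subst ln_less_cancel_iff) auto
      then have "real j \<le> ln (1 / measure \<mu> ?C)" using True by (simp add: ln_div)
      then have "measure \<nu> ?C * j \<le> measure \<nu> ?C * ln (1 / measure \<mu> ?C)" by (intro mult_left_mono) auto
      also have "\<dots> \<le> \<bar>K\<bar>" using bound[OF True] by linarith
      finally show ?thesis using j by (simp add: field_simps)
    next
      case False
      \<comment> \<open>The assumed bound says nothing about a prefix set of
        \<open>\<mu>\<close>-mass zero, but full support makes such a set empty. A cylinder of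
        length \<open>Suc n\<close> is used because \<open>n\<close> may be zero.\<close>
      have "?C = {}"
      proof (rule ccontr)
        assume "?C \<noteq> {}"
        then obtain x where x: "x \<in> ?C" by blast
        then have xX: "x \<in> X" by (auto simp: prefix_set_def)
        have "cyl (prefix_word (Suc n) x) \<subseteq> ?C"
        proof
          fix y assume "y \<in> cyl (prefix_word (Suc n) x)"
          then have "y \<in> X" "prefix_word (Suc n) y = prefix_word (Suc n) x" by (auto simp: cyl_iff)
          then have "y \<in> X" "prefix_word n y = prefix_word n x"
            using take_prefix_word[of n "Suc n" x] take_prefix_word[of n "Suc n" y] by (simp_all only:)
          then show "y \<in> ?C" using x unfolding prefix_set_def by (simp only: mem_Collect_eq)
        qed
        then have "measure \<mu> (cyl (prefix_word (Suc n) x)) \<le> measure \<mu> ?C" by (intro finite_measure_mono) auto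
        then show False using cyl_pos[OF prefix_in_words[OF xX, of "Suc n"]] False by simp
      qed
      then show ?thesis by simp
    qed
    show ?thesis using 1 2 by linarith
  qed
  have "(\<lambda>j. \<bar>K\<bar> * (1 / real j) + exp (- real j)) \<longlonglongrightarrow> \<bar>K\<bar> * 0 + 0"
    by (intro tendsto_intros lim_1_over_n filterlim_compose[OF exp_at_bot]
        filterlim_compose[OF filterlim_uminus_at_bot_at_top] filterlim_real_sequentially)
  then have "measure \<nu> A \<le> 0"
    using small by (intro LIMSEQ_le_const[where X = "\<lambda>j. \<bar>K\<bar> * (1 / real j) + exp (- real j)"]) auto
  then show ?thesis by (simp add: measure_le_0_iff)
qed

text \<open>Otherwise \<open>{d\<nu>/d\<mu> > 1}\<close> would be a nontrivial set that is invariant up to \<open>\<mu>\<close>-null sets.\<close>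

lemma invariant_ac_eq:
  assumes \<nu>: "shift_invariant_measure S T \<nu>"
    and ac: "\<And>A. A \<in> sets \<B> \<Longrightarrow> measure \<mu> A = 0 \<Longrightarrow> measure \<nu> A = 0"
  shows "\<nu> = \<mu>"
proof -
  interpret \<nu>: shift_invariant_measure S T \<nu> by fact
  have "absolutely_continuous \<mu> \<nu>"
    unfolding absolutely_continuous_def
    using ac by (auto simp: null_sets_def emeasure_eq_measure \<nu>.emeasure_eq_measure)
  then have dens: "density \<mu> (RN_deriv \<mu> \<nu>) = \<nu>"
    by (intro density_RN_deriv) auto
  define \<rho> where "\<rho> = RN_deriv \<mu> \<nu>"
  have [measurable]: "\<rho> \<in> borel_measurable \<mu>" unfolding \<rho>_def by measurable
  have em: "emeasure \<nu> B = (\<integral>\<^sup>+x. \<rho> x * indicator B x \<partial>\<mu>)" if "B \<in> sets \<B>" for B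
    using that by (subst dens[symmetric], subst emeasure_density) (auto simp: \<rho>_def)
  \<comment> \<open>Inside \<open>{\<rho> > 1}\<close> the measure \<open>\<nu>\<close> strictly
    exceeds \<open>\<mu>\<close>, except on null sets.\<close>
  have strict: "measure \<mu> B = 0" if B: "B \<in> sets \<B>" "\<And>x. x \<in> B \<Longrightarrow> \<rho> x > 1" "measure \<nu> B \<le> measure \<mu> B" for B
  proof (rule ccontr)
    assume nz: "measure \<mu> B \<noteq> 0"
    have "(\<integral>\<^sup>+x. indicator B x \<partial>\<mu>) < (\<integral>\<^sup>+x. \<rho> x * indicator B x \<partial>\<mu>)"
    proof (rule nn_integral_less)
      show "(\<integral>\<^sup>+x. indicator B x \<partial>\<mu>) \<noteq> \<infinity>" using B by simp
      show "AE x in \<mu>. indicator B x \<le> \<rho> x * indicator B x"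
        using B(2) by (intro AE_I2) (auto simp: indicator_def less_imp_le)
      show "\<not> (AE x in \<mu>. \<rho> x * indicator B x \<le> indicator B x)"
      proof
        assume "AE x in \<mu>. \<rho> x * indicator B x \<le> indicator B x"
        then have "AE x in \<mu>. x \<notin> B"
          by eventually_elim (use B(2) in \<open>auto simp: indicator_def not_le[symmetric] split: if_splits\<close>)
        then have "measure \<mu> B = 0" using B(1) by (subst measure_eq_0_null_sets) (auto simp: AE_iff_null_sets)
        then show False using nz by simp
      qed
    qed (use B in auto)
    then have "emeasure \<mu> B < emeasure \<nu> B" using B by (simp add: em)
    then show False using B(3) by (simp add: emeasure_eq_measure \<nu>.emeasure_eq_measure ennreal_less_iff)
  qed
  define A where "A = {x \<in> X. \<rho> x > 1}"
  have A: "A \<in> sets \<B>"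
  proof -
    have "{x \<in> space \<mu>. \<rho> x > 1} \<in> sets \<mu>" by measurable
    then show ?thesis by (simp add: A_def)
  qed
  let ?A' = "left_shift -` A \<inter> X"
  have A': "?A' \<in> sets \<B>" using measurable_sets[OF measurable_shift A] by simp
  have mA: "measure \<mu> ?A' = measure \<mu> A" "measure \<nu> ?A' = measure \<nu> A"
    using measure_shift[OF A, of 1] \<nu>.measure_shift[OF A, of 1] by auto
  \<comment> \<open>A set and its preimage have equal mass, so the two halves of their symmetric
    difference have equal mass.\<close>
  have diff: "measure M (A - ?A') = measure M (?A' - A)" if "finite_measure M" "sets M = sets \<B>" "measure M ?A' = measure M A" for M
  proof -
    interpret M: finite_measure M by fact
    show ?thesis using M.finite_measure_Diff'[of A ?A'] M.finite_measure_Diff'[of ?A' A] A A' that by (simp add: Int_commute)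
  qed
  have 2: "measure \<nu> (?A' - A) \<le> measure \<mu> (?A' - A)"
  proof -
    have "emeasure \<nu> (?A' - A) \<le> (\<integral>\<^sup>+x. indicator (?A' - A) x \<partial>\<mu>)"
    proof (subst em)
      show "(\<integral>\<^sup>+x. \<rho> x * indicator (?A' - A) x \<partial>\<mu>) \<le> (\<integral>\<^sup>+x. indicator (?A' - A) x \<partial>\<mu>)"
      proof (rule nn_integral_mono)
        fix x
        have "x \<in> ?A' - A \<Longrightarrow> \<rho> x \<le> 1" by (auto simp: A_def not_less)
        then show "\<rho> x * indicator (?A' - A) x \<le> indicator (?A' - A) x" by (auto simp: indicator_def)
      qed
    qed (use A A' in auto)
    also have "\<dots> = emeasure \<mu> (?A' - A)" using A A' by simp
    finally show ?thesis by (simp add: emeasure_eq_measure \<nu>.emeasure_eq_measure)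
  qed
  have d\<mu>: "measure \<mu> (A - ?A') = measure \<mu> (?A' - A)" and d\<nu>: "measure \<nu> (A - ?A') = measure \<nu> (?A' - A)"
    using diff[OF finite_measure_axioms _ mA(1)] diff[OF \<nu>.finite_measure_axioms _ mA(2)] by auto
  \<comment> \<open>On \<open>A - ?A'\<close> the density exceeds 1, on \<open>?A' - A\<close> it is
    at most 1, and both measures give equal mass to the two differences. Hence \<open>\<nu>\<close>
    does not exceed \<open>\<mu>\<close> on \<open>A - ?A'\<close>, which is therefore null.\<close>
  have 1: "measure \<mu> (A - ?A') = 0"
    using A A' 2 d\<mu> d\<nu> by (intro strict) (auto simp: A_def)
  have "measure \<mu> A = 0 \<or> measure \<mu> A = 1"
    using ergodic[OF A 1] 1 d\<mu> by simp
  \<comment> \<open>If \<open>A\<close> had full mass, \<open>\<nu>\<close> would have total mass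
    greater than 1.\<close>
  moreover have "measure \<mu> A \<noteq> 1"
  proof
    assume *: "measure \<mu> A = 1"
    then have "measure \<mu> A = 0"
      using A by (intro strict) (auto simp: A_def[symmetric], auto simp: A_def)
    then show False using * by simp
  qed
  ultimately have "measure \<mu> A = 0" by blast
  then have "AE x in \<mu>. x \<notin> A" using A by (intro AE_not_in) (auto simp: null_sets_def emeasure_eq_measure)
  then have "AE x in \<mu>. \<rho> x \<le> 1" using AE_space by eventually_elim (auto simp: A_def not_less)
  \<comment> \<open>One-sided domination is enough: applied to complements, it gives equality of the
    two probability measures.\<close>
  then have le: "measure \<nu> B \<le> measure \<mu> B" if B: "B \<in> sets \<B>" for B
  proof -
    have "emeasure \<nu> B \<le> (\<integral>\<^sup>+x. indicator B x \<partial>\<mu>)"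
      unfolding em[OF B] using \<open>AE x in \<mu>. \<rho> x \<le> 1\<close>
      by (intro nn_integral_mono_AE) (auto simp: indicator_def)
    also have "\<dots> = emeasure \<mu> B" using B by simp
    finally show ?thesis by (simp add: emeasure_eq_measure \<nu>.emeasure_eq_measure)
  qed
  show ?thesis
  proof (rule measure_eqI)
    fix B assume "B \<in> sets \<nu>"
    then have B: "B \<in> sets \<B>" by simp
    then have "X - B \<in> sets \<B>" using sets.compl_sets[of B \<B>] by simp
    then have "measure \<nu> (X - B) \<le> measure \<mu> (X - B)" by (rule le)
    then have "measure \<nu> B \<ge> measure \<mu> B" using prob_compl[of B] \<nu>.prob_compl[of B] B by simp
    then show "emeasure \<nu> B = emeasure \<mu> B"
      using le[OF B] by (simp add: emeasure_eq_measure \<nu>.emeasure_eq_measure)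
  qed simp
qed

end

section \<open>Minimizers of the rate function\<close>

text \<open>Every preimage under the indicator is again a prefix set of the same length, hence
  open.\<close>

lemma (in countable_shift) continuous_indicator_prefix_set:
  "continuous_map (shift_topology S T) euclideanreal (indicator (prefix_set n Q))"
proof -
  have "openin (shift_topology S T) {x \<in> X. indicator (prefix_set n Q) x \<in> U}" for U :: "real set"
  proof -
    have "{x \<in> X. indicator (prefix_set n Q) x \<in> U} = prefix_set n {w. (if w \<in> Q then 1 else 0) \<in> U}"
      by (auto simp: prefix_set_def indicator_def)
    then show ?thesis by (simp add: openin_prefix_set)
  qed
  then show ?thesis by (simp add: continuous_map)
qed

lemma (in countable_shift) shift_invariant_measureI:
  assumes \<nu>: "prob_space \<nu>" "sets \<nu> = sets \<B>"
    and eq: "\<And>w. measure \<nu> (left_shift -` cyl w \<inter> X) = measure \<nu> (cyl w)"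
  shows "shift_invariant_measure S T \<nu>"
proof -
  note [measurable_cong] = \<nu>(2)
  interpret \<nu>: prob_space \<nu> by (rule \<nu>)
  have d: "distr \<nu> \<B> left_shift = \<nu>"
  proof (rule measure_eq_cyl)
    show "prob_space (distr \<nu> \<B> left_shift)" by (rule \<nu>.prob_space_distr) measurable
    show "measure (distr \<nu> \<B> left_shift) (cyl w) = measure \<nu> (cyl w)" for w
      by (subst measure_distr) (auto simp: eq space_eq_X[OF \<nu>(2)])
  qed (use \<nu> in auto)
  have "\<nu> \<in> invariant_measures S T"
    unfolding invariant_measures_def
  proof (intro CollectI conjI ballI)
    show "\<nu> \<in> prob_measures (shift_topology S T)" using \<nu> by (simp add: prob_measures_iff)
    fix A assume "A \<in> sets \<nu>"
    then have "emeasure (distr \<nu> \<B> left_shift) A = emeasure \<nu> (left_shift -` A \<inter> space \<nu>)"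
      using \<nu>(2) by (intro emeasure_distr) auto
    then show "emeasure \<nu> (left_shift -` A \<inter> space \<nu>) = emeasure \<nu> A" by (simp add: d)
  qed
  then show ?thesis
    by (intro shift_invariant_measure.intro shift_invariant_measure_axioms.intro countable_shift_axioms \<nu>(1))
qed

lemma (in countable_shift) weak_star_open_prefix_set:
  "openin (weak_star_topology (shift_topology S T))
     {\<nu> \<in> prob_measures (shift_topology S T). measure \<nu> (prefix_set n Q) \<in> {a<..<b}}"
proof -
  let ?f = "indicator (prefix_set n Q) :: _ \<Rightarrow> real"
  have "{\<nu> \<in> prob_measures (shift_topology S T). measure \<nu> (prefix_set n Q) \<in> {a<..<b}} =
    {\<nu> \<in> prob_measures (shift_topology S T). (\<integral>x. ?f x \<partial>\<nu>) \<in> {a<..<b}}"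
  proof (rule Collect_cong, rule conj_cong[OF refl])
    fix \<nu> assume "\<nu> \<in> prob_measures (shift_topology S T)"
    then have "sets \<nu> = sets \<B>" by (simp add: prob_measures_iff)
    then have "prefix_set n Q \<inter> space \<nu> = prefix_set n Q" by (auto simp: space_eq_X prefix_set_def)
    then show "(measure \<nu> (prefix_set n Q) \<in> {a<..<b}) = ((\<integral>x. ?f x \<partial>\<nu>) \<in> {a<..<b})" by simp
  qed
  moreover have "openin (weak_star_topology (shift_topology S T))
    {\<nu> \<in> prob_measures (shift_topology S T). (\<integral>x. ?f x \<partial>\<nu>) \<in> {a<..<b}}"
    unfolding weak_star_topology_def
  proof (rule topology_generated_by_Basis)
    have "bounded (?f ` topspace (shift_topology S T))"
      by (rule finite_imp_bounded, rule finite_subset[of _ "{0, 1}"]) (auto simp: indicator_def)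
    then show "{\<nu> \<in> prob_measures (shift_topology S T). (\<integral>x. ?f x \<partial>\<nu>) \<in> {a<..<b}} \<in>
      {{\<mu> \<in> prob_measures (shift_topology S T). (\<integral>x. f x \<partial>\<mu>) \<in> U} |f U.
        continuous_map (shift_topology S T) euclideanreal f \<and> bounded (f ` topspace (shift_topology S T)) \<and> open U}"
      using continuous_indicator_prefix_set[of n Q] open_greaterThanLessThan by blast
  qed
  ultimately show ?thesis by simp
qed

context irreducible_gibbs_measure
begin

lemma free_energy_eq:
  "\<nu> \<in> invariant_measures_pot S T \<phi> \<Longrightarrow>
    free_energy S T \<phi> \<nu> = - ereal P + (ks_entropy \<nu> left_shift + ext_integral \<nu> \<phi>)"
  by (simp add: free_energy_def pressure_eq add.assoc)

lemma free_energy_le_0: "free_energy S T \<phi> \<nu> \<le> 0"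
proof (cases "\<nu> \<in> invariant_measures_pot S T \<phi>")
  case True
  have "free_energy S T \<phi> \<nu> \<le> - ereal P + ereal P"
    unfolding free_energy_eq[OF True] using entropy_plus_integral_le[OF True] by (rule add_left_mono)
  then show ?thesis by (simp add: zero_ereal_def)
qed (simp add: free_energy_def)

text \<open>As \<open>F\<close> is nowhere positive, a zero of \<open>F\<close> makes its supremum
  over every neighbourhood equal to 0.\<close>

lemma minimizerI:
  assumes "\<nu> \<in> prob_measures (shift_topology S T)" "free_energy S T \<phi> \<nu> = 0"
  shows "minimizer S T \<phi> \<nu>"
proof -
  let ?tau = "weak_star_topology (shift_topology S T)"
  let ?N = "{\<G>. openin ?tau \<G> \<and> \<nu> \<in> \<G>}"
  have eq: "(SUP \<nu>'\<in>\<G>. free_energy S T \<phi> \<nu>') = 0" if "\<G> \<in> ?N" for \<G>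
  proof (rule antisym)
    show "(SUP \<nu>'\<in>\<G>. free_energy S T \<phi> \<nu>') \<le> 0" by (intro SUP_least free_energy_le_0)
    show "0 \<le> (SUP \<nu>'\<in>\<G>. free_energy S T \<phi> \<nu>')" using that assms(2) by (intro SUP_upper2[of \<nu>]) auto
  qed
  \<comment> \<open>The infimum over an empty family of neighbourhoods would be infinite. The mass
    of the empty set gives one neighbourhood, namely all probability measures.\<close>
  have "{\<nu> \<in> prob_measures (shift_topology S T). measure \<nu> (prefix_set 0 {}) \<in> {-1<..<1}} \<in> ?N"
    using weak_star_open_prefix_set[of 0 "{}" "-1" 1] assms(1) by (simp add: prefix_set_def)
  then have "?N \<noteq> {}" by blast
  have "(INF \<G>\<in>?N. SUP \<nu>'\<in>\<G>. free_energy S T \<phi> \<nu>') = (INF \<G>\<in>?N. 0)"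
    using eq by (intro INF_cong) auto
  also have "\<dots> = 0" using \<open>?N \<noteq> {}\<close> by simp
  finally show ?thesis using assms by (simp add: minimizer_def rate_function_def)
qed

text \<open>Two prefix sets are controlled at once because invariance compares the mass of a
  cylinder with that of its preimage, a prefix set of another length.\<close>

lemma minimizer_approximation:
  assumes min: "minimizer S T \<phi> \<nu>" and e: "e > 0"
  obtains \<nu>' where "\<nu>' \<in> invariant_measures_pot S T \<phi>" "free_energy S T \<phi> \<nu>' > - ereal e"
    "\<bar>measure \<nu>' (prefix_set n Q) - measure \<nu> (prefix_set n Q)\<bar> < e"
    "\<bar>measure \<nu>' (prefix_set m R) - measure \<nu> (prefix_set m R)\<bar> < e"
proof -
  let ?tau = "weak_star_topology (shift_topology S T)"
  let ?N = "{\<G>. openin ?tau \<G> \<and> \<nu> \<in> \<G>}"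
  let ?U = "\<lambda>n Q. {\<nu>' \<in> prob_measures (shift_topology S T).
    measure \<nu>' (prefix_set n Q) \<in> {measure \<nu> (prefix_set n Q) - e<..<measure \<nu> (prefix_set n Q) + e}}"
  have "openin ?tau (?U n Q \<inter> ?U m R)" by (intro openin_Int weak_star_open_prefix_set)
  then have in_N: "?U n Q \<inter> ?U m R \<in> ?N"
    using min e by (simp add: minimizer_def)
  have "(INF \<G>\<in>?N. SUP \<nu>'\<in>\<G>. free_energy S T \<phi> \<nu>') = 0"
    using min by (simp add: minimizer_def rate_function_def ereal_uminus_eq_reorder)
  then have "0 \<le> (SUP \<nu>'\<in>?U n Q \<inter> ?U m R. free_energy S T \<phi> \<nu>')"
    using INF_lower[OF in_N, of "\<lambda>\<G>. SUP \<nu>'\<in>\<G>. free_energy S T \<phi> \<nu>'"] by simp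
  moreover have "- ereal e < 0" using e by simp
  ultimately have "- ereal e < (SUP \<nu>'\<in>?U n Q \<inter> ?U m R. free_energy S T \<phi> \<nu>')" by (rule order_less_le_trans[rotated])
  then obtain \<nu>' where \<nu>': "\<nu>' \<in> ?U n Q \<inter> ?U m R" "- ereal e < free_energy S T \<phi> \<nu>'"
    unfolding less_SUP_iff by blast
  have "\<nu>' \<in> invariant_measures_pot S T \<phi>"
    using \<nu>'(2) by (auto simp: free_energy_def split: if_splits)
  then show ?thesis using \<nu>' by (intro that[of \<nu>']) (auto simp: abs_less_iff)
qed

text \<open>The approximating measures are invariant, and the identity between the masses of two
  clopen sets passes to the limit.\<close>

lemma minimizer_invariant:
  assumes min: "minimizer S T \<phi> \<nu>"
  shows "shift_invariant_measure S T \<nu>"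
proof -
  have \<nu>: "prob_space \<nu>" "sets \<nu> = sets \<B>" using min by (auto simp: minimizer_def prob_measures_iff)
  have eq: "measure \<nu> (left_shift -` cyl w \<inter> X) = measure \<nu> (cyl w)" for w
  proof -
    let ?C = "prefix_set (length w) {w}" and ?C' = "prefix_set (1 + length w) {v. drop 1 v \<in> {w}}"
    have C: "cyl w = ?C" "left_shift -` cyl w \<inter> X = ?C'"
      using shift_vimage_prefix_set[of 1 "length w" "{w}"] by (simp_all add: cyl_eq_prefix_set)
    have "\<bar>measure \<nu> ?C' - measure \<nu> ?C\<bar> \<le> 0 + e" if e: "e > 0" for e
    proof -
      obtain \<nu>' where \<nu>': "\<nu>' \<in> invariant_measures_pot S T \<phi>"
        "\<bar>measure \<nu>' ?C - measure \<nu> ?C\<bar> < e / 2" "\<bar>measure \<nu>' ?C' - measure \<nu> ?C'\<bar> < e / 2"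
        using minimizer_approximation[OF min, of "e / 2" "length w" "{w}" "1 + length w" "{v. drop 1 v \<in> {w}}"] e
        by (metis half_gt_zero)
      interpret \<nu>': shift_invariant_measure S T \<nu>' by (rule invariant_measures_potD[OF \<nu>'(1)])
      have "measure \<nu>' ?C' = measure \<nu>' ?C"
        using \<nu>'.measure_shift[OF cyl_sets, of 1 w] C by simp
      then show ?thesis using \<nu>' by linarith
    qed
    then have "\<bar>measure \<nu> ?C' - measure \<nu> ?C\<bar> \<le> 0" by (rule field_le_epsilon)
    then show ?thesis using C by simp
  qed
  show ?thesis
    by (rule shift_invariant_measureI[OF \<nu> eq])
qed

lemma minimizer_bound:
  assumes min: "minimizer S T \<phi> \<nu>" and pos: "measure \<mu> (prefix_set n Q) > 0"
  shows "measure \<nu> (prefix_set n Q) * ln (1 / measure \<mu> (prefix_set n Q)) \<le> ln (2 * c)"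
proof -
  have main: "measure \<nu> (prefix_set n Q) * ln (1 / measure \<mu> (prefix_set n Q)) \<le> ln (2 * c)"
    if n: "n \<ge> 1" and pos: "measure \<mu> (prefix_set n Q) > 0" for n Q
  proof (rule field_le_epsilon)
    fix e :: real assume e: "e > 0"
    let ?C = "prefix_set n Q"
    define lp where "lp = ln (1 / measure \<mu> ?C)"
    have lp: "lp \<ge> 0" unfolding lp_def using pos by (intro ln_ge_zero) simp
    \<comment> \<open>The deficit \<open>d\<close> of the free energy is multiplied by
      \<open>n\<close>, the error \<open>d\<close> of the mass by \<open>lp\<close>; together they
      amount to \<open>e\<close>.\<close>
    define d where "d = e / (n + lp)"
    have d: "d > 0" using e n lp by (simp add: d_def add_pos_nonneg)
    obtain \<nu>' where \<nu>': "\<nu>' \<in> invariant_measures_pot S T \<phi>" "free_energy S T \<phi> \<nu>' > - ereal d"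
      "\<bar>measure \<nu>' ?C - measure \<nu> ?C\<bar> < d"
      using minimizer_approximation[OF min d, of n Q n Q] by blast
    note i = invariant_measures_potD[OF \<nu>'(1)]
    let ?I = "\<integral>x. \<phi> x \<partial>\<nu>'"
    have "- ereal d < - ereal P + (ks_entropy \<nu>' left_shift + ereal ?I)"
      using \<nu>'(2) unfolding free_energy_eq[OF \<nu>'(1)] i(3) .
    also have "\<dots> \<le> - ereal P + (ereal (P - ?I + (ln (2 * c) - measure \<nu>' ?C * lp) / n) + ereal ?I)"
      unfolding lp_def by (intro add_left_mono add_right_mono entropy_upper_bound i n pos)
    finally have "- d < (ln (2 * c) - measure \<nu>' ?C * lp) / n" by simp
    then have "measure \<nu>' ?C * lp \<le> ln (2 * c) + n * d" using n by (simp add: field_simps)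
    moreover have "measure \<nu> ?C * lp \<le> (measure \<nu>' ?C + d) * lp"
      using \<nu>'(3) lp by (intro mult_right_mono) auto
    ultimately have "measure \<nu> ?C * lp \<le> ln (2 * c) + d * (n + lp)"
      by (simp add: algebra_simps)
    also have "d * (n + lp) = e" using n lp by (simp add: d_def)
    finally show "measure \<nu> ?C * ln (1 / measure \<mu> ?C) \<le> ln (2 * c) + e" by (simp add: lp_def)
  qed
  show ?thesis
    using main[of "Suc n" "{w. take n w \<in> Q}"] pos by (simp add: prefix_set_Suc[symmetric])
qed

lemma minimizer_iff: "minimizer S T \<phi> \<nu> \<longleftrightarrow> \<nu> = \<mu>"
proof
  assume min: "minimizer S T \<phi> \<nu>"
  note inv = minimizer_invariant[OF min]
  show "\<nu> = \<mu>"
    using absolutely_continuous_of_bound[OF inv minimizer_bound[OF min]] by (intro invariant_ac_eq[OF inv])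
next
  have "free_energy S T \<phi> \<mu> = 0"
    unfolding free_energy_eq[OF mu_in_pot] entropy_plus_integral_eq by simp
  moreover have "\<mu> \<in> prob_measures (shift_topology S T)"
    using prob_space_axioms by (simp add: prob_measures_iff)
  ultimately show "\<nu> = \<mu> \<Longrightarrow> minimizer S T \<phi> \<nu>" using minimizerI by blast
qed

text \<open>Equilibrium states satisfy \<open>F = 0\<close> and are therefore minimizers, so their
  uniqueness is inherited.\<close>

lemma equilibrium_state_iff: "equilibrium_state S T \<phi> \<nu> \<longleftrightarrow> \<nu> = \<mu>"
proof
  assume eq: "equilibrium_state S T \<phi> \<nu>"
  then have \<nu>: "\<nu> \<in> invariant_measures_pot S T \<phi>"
    and val: "ks_entropy \<nu> left_shift + ext_integral \<nu> \<phi> = ereal P"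
    by (auto simp: equilibrium_state_def pressure_eq)
  have "free_energy S T \<phi> \<nu> = 0" unfolding free_energy_eq[OF \<nu>] val by simp
  moreover have "\<nu> \<in> prob_measures (shift_topology S T)"
    using \<nu> by (simp add: invariant_measures_pot_def invariant_measures_def)
  ultimately show "\<nu> = \<mu>" using minimizerI minimizer_iff by blast
qed (simp add: equilibrium_mu)

end

section \<open>Existence of an invariant Gibbs measure\<close>

lemma nn_integral_count_space_inj:
  assumes inj: "inj_on h A" and zero: "\<And>a. a \<notin> A \<Longrightarrow> f a = 0" and le: "\<And>a. a \<in> A \<Longrightarrow> f a \<le> g (h a)"
  shows "(\<integral>\<^sup>+a. f a \<partial>count_space UNIV) \<le> (\<integral>\<^sup>+b. g b \<partial>count_space UNIV)"
proof -
  have "(\<integral>\<^sup>+a. f a \<partial>count_space UNIV) = (\<integral>\<^sup>+a. f a \<partial>count_space A)"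
    by (rule nn_integral_count_space_eq) (auto intro: zero)
  also have "\<dots> \<le> (\<integral>\<^sup>+a. g (h a) \<partial>count_space A)"
    using le by (intro nn_integral_mono) auto
  also have "\<dots> = (\<integral>\<^sup>+b. g b \<partial>count_space (h ` A))"
    using inj by (intro nn_integral_bij_count_space) (simp add: bij_betw_def)
  also have "\<dots> = (\<integral>\<^sup>+b. g b * indicator (h ` A) b \<partial>count_space UNIV)"
    by (cases "h ` A = UNIV") (auto simp: nn_integral_count_space_indicator)
  also have "\<dots> \<le> (\<integral>\<^sup>+b. g b \<partial>count_space UNIV)"
    by (intro nn_integral_mono) (auto simp: indicator_def)
  finally show ?thesis .
qed

lemma nn_integral_count_space_product:
  fixes f :: "'b \<Rightarrow> ennreal" and g :: "'c \<Rightarrow> ennreal"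
  shows "(\<integral>\<^sup>+p. (k * f (fst p)) * g (snd p) \<partial>count_space UNIV)
    = k * ((\<integral>\<^sup>+x. f x \<partial>count_space UNIV) * (\<integral>\<^sup>+y. g y \<partial>count_space UNIV))"
  by (subst nn_integral_fst_count_space[symmetric]) (simp add: nn_integral_cmult nn_integral_multc mult.assoc)

text \<open>In the application \<open>s w\<close> is the exponential of the Birkhoff sum at a chosen
  point of the cylinder, and \<open>K\<close> absorbs the distortion. Unlike the one-sided shift,
  these axioms are symmetric under reversal of words, so that left-hand statements yield right-hand
  ones.\<close>

locale word_weights =
  fixes adm :: "'a list \<Rightarrow> bool" and s :: "'a list \<Rightarrow> real" and K :: real and \<Lambda> :: "'a list set"
  assumes adm_Nil: "adm []"
    and adm_append: "\<And>u v. adm (u @ v) \<Longrightarrow> adm u \<and> adm v"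
    and adm_glue: "\<And>u w v. w \<noteq> [] \<Longrightarrow> adm (u @ w) \<Longrightarrow> adm (w @ v) \<Longrightarrow> adm (u @ w @ v)"
    and connectors: "finite \<Lambda>" "\<And>l. l \<in> \<Lambda> \<Longrightarrow> adm l"
    and connect: "\<And>u v. adm u \<Longrightarrow> adm v \<Longrightarrow> \<exists>l\<in>\<Lambda>. adm (u @ l @ v)"
    and s_pos: "\<And>w. adm w \<Longrightarrow> s w > 0" and s_zero: "\<And>w. \<not> adm w \<Longrightarrow> s w = 0" and s_Nil: "s [] = 1"
    and K: "K \<ge> 1"
    and s_append_le: "\<And>u v. adm (u @ v) \<Longrightarrow> s (u @ v) \<le> K * (s u * s v)"
    and s_append_ge: "\<And>u v. adm (u @ v) \<Longrightarrow> s u * s v \<le> K * s (u @ v)"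
    and letters_summable: "(\<integral>\<^sup>+a. ennreal (s [a]) \<partial>count_space UNIV) < \<infinity>"
begin

lemma s_nonneg: "s w \<ge> 0"
  by (metis less_imp_le order_refl s_pos s_zero)

definition weight :: "nat \<Rightarrow> 'a list \<Rightarrow> ennreal" where
  "weight n w = (if length w = n then ennreal (s w) else 0)"

definition Z :: "nat \<Rightarrow> ennreal" where
  "Z n = (\<integral>\<^sup>+w. weight n w \<partial>count_space UNIV)"

definition left_sum :: "nat \<Rightarrow> 'a list \<Rightarrow> ennreal" where
  "left_sum n w = (\<integral>\<^sup>+v. (if adm (v @ w) then weight n v else 0) \<partial>count_space UNIV)"

definition right_sum :: "nat \<Rightarrow> 'a list \<Rightarrow> ennreal" where
  "right_sum n w = (\<integral>\<^sup>+v. (if adm (w @ v) then weight n v else 0) \<partial>count_space UNIV)"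

lemma Z_0: "Z 0 = 1"
proof -
  have "Z 0 = (\<Sum>w\<in>{[]}. weight 0 w)"
    unfolding Z_def by (rule nn_integral_count_space') (auto simp: weight_def)
  then show ?thesis by (simp add: weight_def s_Nil)
qed

lemma Z_add_le: "Z (i + j) \<le> ennreal K * (Z i * Z j)"
proof -
  have "Z (i + j) \<le> (\<integral>\<^sup>+p. (ennreal K * weight i (fst p)) * weight j (snd p) \<partial>count_space UNIV)"
    unfolding Z_def
  proof (rule nn_integral_count_space_inj[where h = "\<lambda>w. (take i w, drop i w)" and A = "{w. length w = i + j \<and> adm w}"])
    show "inj_on (\<lambda>w. (take i w, drop i w)) {w. length w = i + j \<and> adm w}"
      by (rule inj_onI) (metis Pair_inject append_take_drop_id)
    fix w assume "w \<in> {w. length w = i + j \<and> adm w}"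
    then have w: "length w = i + j" "adm w" by auto
    then have "s w \<le> K * (s (take i w) * s (drop i w))" using s_append_le[of "take i w" "drop i w"] by simp
    then have "ennreal (s w) \<le> ennreal K * ennreal (s (take i w)) * ennreal (s (drop i w))"
      using K s_nonneg by (simp add: ennreal_mult[symmetric] ennreal_leI mult.assoc)
    then show "weight (i + j) w \<le> (ennreal K * weight i (fst (take i w, drop i w))) * weight j (snd (take i w, drop i w))"
      using w by (simp add: weight_def)
  qed (auto simp: weight_def s_zero)
  also have "\<dots> = ennreal K * (Z i * Z j)"
    unfolding Z_def by (rule nn_integral_count_space_product)
  finally show ?thesis .
qed

lemma Z_1: "Z 1 < \<infinity>"
proof -
  have "Z 1 \<le> (\<integral>\<^sup>+a. ennreal (s [a]) \<partial>count_space UNIV)"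
    unfolding Z_def
  proof (rule nn_integral_count_space_inj[where h = hd and A = "{w. length w = 1}"])
    show "inj_on hd {w :: 'a list. length w = 1}" by (auto simp: inj_on_def length_Suc_conv)
  qed (auto simp: weight_def length_Suc_conv)
  then show ?thesis using letters_summable by (rule order_le_less_trans)
qed

lemma Z_finite: "Z n < \<infinity>"
proof (induction n)
  case (Suc n)
  have "Z (1 + n) \<le> ennreal K * (Z 1 * Z n)" by (rule Z_add_le)
  also have "\<dots> < \<infinity>" using Z_1 Suc by (simp add: ennreal_mult_less_top)
  finally show ?case by simp
qed (simp add: Z_0)

definition z :: "nat \<Rightarrow> real" where "z n = enn2real (Z n)"

lemma Z_eq: "Z n = ennreal (z n)"
  using Z_finite[of n] by (simp add: z_def)

lemma z_nonneg: "z n \<ge> 0"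
  by (simp add: z_def)

text \<open>For each connector \<open>l\<close>: attaching it costs \<open>K / s l\<close>, cutting
  off a head of the same length costs \<open>K\<close>, and summing over the possible heads gives
  \<open>z (length l)\<close>.\<close>

definition C\<^sub>1 :: real where "C\<^sub>1 = (\<Sum>l\<in>\<Lambda>. K\<^sup>2 / s l * z (length l))"

lemma C1_eq: "ennreal C\<^sub>1 = (\<Sum>l\<in>\<Lambda>. ennreal (K\<^sup>2 / s l) * Z (length l))"
proof -
  have "ennreal (K\<^sup>2 / s l) * Z (length l) = ennreal (K\<^sup>2 / s l * z (length l))" for l
    unfolding Z_eq using s_nonneg z_nonneg by (intro ennreal_mult[symmetric]) auto
  then have "(\<Sum>l\<in>\<Lambda>. ennreal (K\<^sup>2 / s l) * Z (length l)) = (\<Sum>l\<in>\<Lambda>. ennreal (K\<^sup>2 / s l * z (length l)))"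
    by simp
  also have "\<dots> = ennreal C\<^sub>1"
    unfolding C\<^sub>1_def using s_nonneg z_nonneg by (intro sum_ennreal) auto
  finally show ?thesis by simp
qed

lemma C1_nonneg: "C\<^sub>1 \<ge> 0"
  unfolding C\<^sub>1_def using s_nonneg z_nonneg by (intro sum_nonneg) auto

text \<open>Attach a connector to \<open>v\<close> and cut the result back to the length of \<open>v\<close>.\<close>

lemma Z_le_left_sum:
  assumes w: "adm w"
  shows "Z i \<le> ennreal C\<^sub>1 * left_sum i w"
proof -
  let ?R = "\<lambda>v. if adm (v @ w) then weight i v else 0"
  let ?f = "\<lambda>l v. if adm (v @ l @ w) then weight i v else 0"
  have "Z i \<le> (\<integral>\<^sup>+v. (\<Sum>l\<in>\<Lambda>. ?f l v) \<partial>count_space UNIV)"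
    unfolding Z_def
  proof (rule nn_integral_mono)
    fix v
    show "weight i v \<le> (\<Sum>l\<in>\<Lambda>. ?f l v)"
    proof (cases "adm v")
      case True
      then obtain l where l: "l \<in> \<Lambda>" "adm (v @ l @ w)" using connect w by blast
      have "weight i v = ?f l v" using l by simp
      also have "\<dots> \<le> (\<Sum>l\<in>\<Lambda>. ?f l v)" using l connectors by (intro member_le_sum) auto
      finally show ?thesis .
    qed (simp add: weight_def s_zero)
  qed
  also have "\<dots> = (\<Sum>l\<in>\<Lambda>. \<integral>\<^sup>+v. ?f l v \<partial>count_space UNIV)"
    by (intro nn_integral_sum) auto
  also have "\<dots> \<le> (\<Sum>l\<in>\<Lambda>. ennreal (K\<^sup>2 / s l) * Z (length l) * left_sum i w)"
  proof (rule sum_mono)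
    fix l assume l: "l \<in> \<Lambda>"
    let ?k = "length l"
    have "(\<integral>\<^sup>+v. ?f l v \<partial>count_space UNIV) \<le> (\<integral>\<^sup>+p. (ennreal (K\<^sup>2 / s l) * weight ?k (fst p)) * ?R (snd p) \<partial>count_space UNIV)"
    \<comment> \<open>The pair of head and remainder determines \<open>v @ l\<close> and hence
      \<open>v\<close>. The remainder has length \<open>i\<close> and fits before \<open>w\<close>,
      being followed by \<open>w\<close> in the admissible word \<open>v @ l @ w\<close>.\<close>
    proof (rule nn_integral_count_space_inj[where h = "\<lambda>v. (take ?k (v @ l), drop ?k (v @ l))" and A = "{v. length v = i \<and> adm (v @ l @ w)}"])
      show "inj_on (\<lambda>v. (take ?k (v @ l), drop ?k (v @ l))) {v. length v = i \<and> adm (v @ l @ w)}"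
        by (rule inj_onI) (metis Pair_inject append_take_drop_id append_same_eq)
      fix v assume "v \<in> {v. length v = i \<and> adm (v @ l @ w)}"
      then have v: "length v = i" "adm (v @ l @ w)" by auto
      let ?h = "take ?k (v @ l)" and ?r = "drop ?k (v @ l)"
      have lens: "length ?h = ?k" "length ?r = i" using v by auto
      have adm_vl: "adm (v @ l)" using adm_append[of "v @ l" w] v by simp
      have adm_rw: "adm (?r @ w)"
        using adm_append[of ?h "?r @ w"] v(2) by (metis append.assoc append_take_drop_id)
      have "s v \<le> K / s l * s (v @ l)"
        using s_append_ge[OF adm_vl] s_pos[OF connectors(2)[OF l]] by (simp add: field_simps)
      also have "\<dots> \<le> K / s l * (K * (s ?h * s ?r))"
        using s_append_le[of ?h ?r] adm_vl K s_nonneg by (intro mult_left_mono) (simp_all only: append_take_drop_id, auto)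
      finally have "s v \<le> K\<^sup>2 / s l * s ?h * s ?r" by (simp add: power2_eq_square)
      then have "ennreal (s v) \<le> ennreal (K\<^sup>2 / s l) * ennreal (s ?h) * ennreal (s ?r)"
        using s_nonneg by (simp add: ennreal_mult[symmetric] ennreal_leI)
      then show "?f l v \<le> (ennreal (K\<^sup>2 / s l) * weight ?k (fst (?h, ?r))) * ?R (snd (?h, ?r))"
        using v(2) adm_rw
        by (simp only: weight_def fst_conv snd_conv v(1) lens if_True refl)
    qed (auto simp: weight_def)
    also have "\<dots> = ennreal (K\<^sup>2 / s l) * (Z ?k * left_sum i w)"
      unfolding left_sum_def Z_def by (rule nn_integral_count_space_product)
    finally show "(\<integral>\<^sup>+v. ?f l v \<partial>count_space UNIV) \<le> ennreal (K\<^sup>2 / s l) * Z ?k * left_sum i w"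
      by (simp only: mult.assoc)
  qed
  also have "\<dots> = ennreal C\<^sub>1 * left_sum i w"
    unfolding C1_eq by (simp add: sum_distrib_right)
  finally show ?thesis .
qed

text \<open>Reversal exchanges the two sides and preserves \<open>Z\<close> and
  \<open>C\<^sub>1\<close>, so the left-hand bound applies to the reversed words.\<close>

lemma Z_le_right_sum:
  assumes w: "adm w"
  shows "Z i \<le> ennreal C\<^sub>1 * right_sum i w"
proof -
  interpret rev: word_weights "\<lambda>w. adm (rev w)" "\<lambda>w. s (rev w)" K "rev ` \<Lambda>"
  proof
    show "adm (rev u)" if "u \<in> rev ` \<Lambda>" for u using that connectors by auto
    show "\<exists>l\<in>rev ` \<Lambda>. adm (rev (u @ l @ v))" if "adm (rev u)" "adm (rev v)" for u v
      using connect[OF that(2,1)] by auto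
    show "adm (rev (u @ w @ v))" if "w \<noteq> []" "adm (rev (u @ w))" "adm (rev (w @ v))" for u w v
      using adm_glue[of "rev w" "rev v" "rev u"] that by simp
    show "s (rev (u @ v)) \<le> K * (s (rev u) * s (rev v))" if "adm (rev (u @ v))" for u v
      using s_append_le[of "rev v" "rev u"] that by (simp add: mult.commute)
    show "s (rev u) * s (rev v) \<le> K * s (rev (u @ v))" if "adm (rev (u @ v))" for u v
      using s_append_ge[of "rev v" "rev u"] that by (simp add: mult.commute)
    show "adm (rev u) \<and> adm (rev v)" if "adm (rev (u @ v))" for u v
      using adm_append[of "rev v" "rev u"] that by simp
  qed (use adm_Nil connectors s_pos s_zero s_Nil K letters_summable in auto)
  have bij: "bij (rev :: 'a list \<Rightarrow> 'a list)" by (metis bij_betw_def inj_on_rev surj_def rev_rev_ident)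
  have weight: "rev.weight n v = weight n (rev v)" for n v
    by (simp add: rev.weight_def weight_def)
  have Z: "rev.Z n = Z n" for n
    unfolding rev.Z_def Z_def weight by (rule nn_integral_bij_count_space[OF bij])
  have "rev.C\<^sub>1 = C\<^sub>1"
    unfolding rev.C\<^sub>1_def C\<^sub>1_def rev.z_def z_def Z by (subst sum.reindex) auto
  moreover have "rev.left_sum i (rev w) = right_sum i w"
    unfolding rev.left_sum_def right_sum_def weight rev_append rev_rev_ident
    by (rule nn_integral_bij_count_space[OF bij, of "\<lambda>v. if adm (w @ v) then weight i v else 0"])
  ultimately show ?thesis using rev.Z_le_left_sum[of "rev w" i] w by (simp add: Z)
qed

text \<open>For each \<open>v\<close> the full sum over \<open>u\<close> is replaced, at cost
  \<open>C\<^sub>1\<close>, by the sum over those \<open>u\<close> that fit before \<open>v\<close>;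
  their concatenations are distinct words of length \<open>i + j\<close>.\<close>

lemma Z_mult_le: "Z i * Z j \<le> ennreal (K * C\<^sub>1) * Z (i + j)"
proof -
  have "(\<integral>\<^sup>+v. \<integral>\<^sup>+u. (if adm (u @ v) then weight i u * weight j v else 0) \<partial>count_space UNIV \<partial>count_space UNIV)
    = (\<integral>\<^sup>+p. (if adm (snd p @ fst p) then weight i (snd p) * weight j (fst p) else 0) \<partial>count_space UNIV)"
    by (subst nn_integral_fst_count_space[symmetric]) (simp cong: if_cong)
  also have "\<dots> \<le> (\<integral>\<^sup>+w. ennreal K * weight (i + j) w \<partial>count_space UNIV)"
  proof (rule nn_integral_count_space_inj[where h = "\<lambda>p. snd p @ fst p" and A = "{p. length (snd p) = i \<and> length (fst p) = j \<and> adm (snd p @ fst p)}"])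
    show "inj_on (\<lambda>p. snd p @ fst p) {p. length (snd p) = i \<and> length (fst p) = j \<and> adm (snd p @ fst p)}"
      by (auto simp: inj_on_def)
    fix p assume p: "p \<in> {p. length (snd p) = i \<and> length (fst p) = j \<and> adm (snd p @ fst p)}"
    then have "s (snd p) * s (fst p) \<le> K * s (snd p @ fst p)" by (intro s_append_ge) auto
    then have "ennreal (s (snd p)) * ennreal (s (fst p)) \<le> ennreal K * ennreal (s (snd p @ fst p))"
      using s_nonneg K by (simp add: ennreal_mult[symmetric] ennreal_leI)
    then show "(if adm (snd p @ fst p) then weight i (snd p) * weight j (fst p) else 0) \<le> ennreal K * weight (i + j) (snd p @ fst p)"
      using p by (simp add: weight_def)
  qed (auto simp: weight_def)
  also have "\<dots> = ennreal K * Z (i + j)" by (simp add: nn_integral_cmult Z_def)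
  finally have main: "(\<integral>\<^sup>+v. \<integral>\<^sup>+u. (if adm (u @ v) then weight i u * weight j v else 0) \<partial>count_space UNIV \<partial>count_space UNIV)
    \<le> ennreal K * Z (i + j)" .
  have "Z i * Z j = (\<integral>\<^sup>+v. weight j v * Z i \<partial>count_space UNIV)"
    by (subst nn_integral_multc) (auto simp: Z_def[of j] mult.commute)
  also have "\<dots> \<le> (\<integral>\<^sup>+v. weight j v * (ennreal C\<^sub>1 * left_sum i v) \<partial>count_space UNIV)"
  proof (rule nn_integral_mono)
    fix v show "weight j v * Z i \<le> weight j v * (ennreal C\<^sub>1 * left_sum i v)"
      using Z_le_left_sum[of v i] by (cases "adm v") (auto simp: weight_def s_zero intro!: mult_left_mono)
  qed
  also have "\<dots> = ennreal C\<^sub>1 * (\<integral>\<^sup>+v. \<integral>\<^sup>+u. (if adm (u @ v) then weight i u * weight j v else 0) \<partial>count_space UNIV \<partial>count_space UNIV)"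
  proof -
    have "weight j v * (ennreal C\<^sub>1 * left_sum i v) = ennreal C\<^sub>1 * (\<integral>\<^sup>+u. (if adm (u @ v) then weight i u * weight j v else 0) \<partial>count_space UNIV)" for v
    proof -
      have "(\<integral>\<^sup>+u. (if adm (u @ v) then weight i u * weight j v else 0) \<partial>count_space UNIV)
          = (\<integral>\<^sup>+u. (if adm (u @ v) then weight i u else 0) * weight j v \<partial>count_space UNIV)"
        by (intro nn_integral_cong) auto
      also have "\<dots> = left_sum i v * weight j v"
        unfolding left_sum_def by (rule nn_integral_multc) simp
      finally show ?thesis by (simp only: mult_ac)
    qed
    then show ?thesis by (simp add: nn_integral_cmult)
  qed
  also have "\<dots> \<le> ennreal C\<^sub>1 * (ennreal K * Z (i + j))" using main by (intro mult_left_mono) auto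
  also have "\<dots> = ennreal (K * C\<^sub>1) * Z (i + j)" using K C1_nonneg by (simp add: ennreal_mult mult_ac)
  finally show ?thesis .
qed

definition occurrence :: "nat \<Rightarrow> nat \<Rightarrow> 'a list \<Rightarrow> ennreal" where
  "occurrence N i w = (\<integral>\<^sup>+u. (if take (length w) (drop i u) = w then weight N u else 0) \<partial>count_space UNIV)"

text \<open>The word is cut before and after \<open>w\<close>, each cut costing a factor
  \<open>K\<close>.\<close>

lemma occurrence_le:
  "occurrence (i + length w + k) i w \<le> ennreal (K\<^sup>2 * s w) * (Z i * Z k)"
proof -
  let ?N = "i + length w + k"
  have "occurrence ?N i w \<le> (\<integral>\<^sup>+p. (ennreal (K\<^sup>2 * s w) * weight i (fst p)) * weight k (snd p) \<partial>count_space UNIV)"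
    unfolding occurrence_def
  proof (rule nn_integral_count_space_inj[where h = "\<lambda>u. (take i u, drop (i + length w) u)"
        and A = "{u. length u = ?N \<and> adm u \<and> take (length w) (drop i u) = w}"])
    have split: "u = take i u @ w @ drop (i + length w) u" if "take (length w) (drop i u) = w" for u
      using that by (metis add.commute append_take_drop_id drop_drop)
    show "inj_on (\<lambda>u. (take i u, drop (i + length w) u)) {u. length u = ?N \<and> adm u \<and> take (length w) (drop i u) = w}"
      by (rule inj_onI) (metis (mono_tags, lifting) Pair_inject mem_Collect_eq split)
    fix u assume "u \<in> {u. length u = ?N \<and> adm u \<and> take (length w) (drop i u) = w}"
    then have u: "length u = ?N" "adm u" "take (length w) (drop i u) = w" by auto
    let ?a = "take i u" and ?b = "drop (i + length w) u"
    have eq: "u = ?a @ w @ ?b" using split[OF u(3)] .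
    have adm': "adm (?a @ w @ ?b)" "adm (w @ ?b)" using u(2) eq adm_append[of ?a "w @ ?b"] by auto
    have "s u \<le> K * (s ?a * s (w @ ?b))" using s_append_le[OF adm'(1)] eq by simp
    also have "\<dots> \<le> K * (s ?a * (K * (s w * s ?b)))"
      using s_append_le[OF adm'(2)] K s_nonneg by (intro mult_left_mono) auto
    finally have "s u \<le> K\<^sup>2 * s w * s ?a * s ?b" by (simp add: power2_eq_square mult_ac)
    then have "ennreal (s u) \<le> ennreal (K\<^sup>2 * s w) * ennreal (s ?a) * ennreal (s ?b)"
      using s_nonneg by (simp add: ennreal_mult[symmetric] ennreal_leI)
    then show "(if take (length w) (drop i u) = w then weight ?N u else 0)
      \<le> (ennreal (K\<^sup>2 * s w) * weight i (fst (?a, ?b))) * weight k (snd (?a, ?b))"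
      using u by (simp add: weight_def)
  qed (auto simp: weight_def s_zero)
  also have "\<dots> = ennreal (K\<^sup>2 * s w) * (Z i * Z k)"
    unfolding Z_def by (rule nn_integral_count_space_product)
  finally show ?thesis .
qed

text \<open>A left and a right part that fit \<open>w\<close> separately can be glued along it,
  since \<open>w\<close> is nonempty. Restricting to fitting parts costs \<open>C\<^sub>1\<close> on
  each side, and the two joints cost \<open>K\<close> each.\<close>

lemma occurrence_ge:
  assumes w: "adm w" "w \<noteq> []"
  shows "ennreal (s w) * (Z i * Z k) \<le> ennreal (K\<^sup>2 * C\<^sub>1\<^sup>2) * occurrence (i + length w + k) i w"
proof -
  let ?N = "i + length w + k"
  let ?l = "\<lambda>v. if adm (v @ w) then weight i v else 0" and ?r = "\<lambda>v. if adm (w @ v) then weight k v else 0"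
  have "ennreal (s w) * (left_sum i w * right_sum k w) = (\<integral>\<^sup>+p. (ennreal (s w) * ?l (fst p)) * ?r (snd p) \<partial>count_space UNIV)"
    unfolding left_sum_def right_sum_def by (rule nn_integral_count_space_product[symmetric])
  also have "\<dots> \<le> (\<integral>\<^sup>+u. ennreal (K\<^sup>2) * (if take (length w) (drop i u) = w then weight ?N u else 0) \<partial>count_space UNIV)"
  proof (rule nn_integral_count_space_inj[where h = "\<lambda>p. fst p @ w @ snd p"
        and A = "{p. length (fst p) = i \<and> length (snd p) = k \<and> adm (fst p @ w) \<and> adm (w @ snd p)}"])
    show "inj_on (\<lambda>p. fst p @ w @ snd p) {p. length (fst p) = i \<and> length (snd p) = k \<and> adm (fst p @ w) \<and> adm (w @ snd p)}"
      by (auto simp: inj_on_def)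
    fix p assume "p \<in> {p. length (fst p) = i \<and> length (snd p) = k \<and> adm (fst p @ w) \<and> adm (w @ snd p)}"
    then have p: "length (fst p) = i" "length (snd p) = k" "adm (fst p @ w)" "adm (w @ snd p)" by auto
    let ?a = "fst p" and ?b = "snd p"
    have "s ?a * (s w * s ?b) \<le> s ?a * (K * s (w @ ?b))"
      using s_append_ge[OF p(4)] s_nonneg by (intro mult_left_mono) auto
    also have "\<dots> = K * (s ?a * s (w @ ?b))" by simp
    also have "\<dots> \<le> K * (K * s (?a @ w @ ?b))"
      using s_append_ge[OF adm_glue[OF w(2) p(3,4)]] K by (intro mult_left_mono) auto
    finally have "s w * s ?a * s ?b \<le> K\<^sup>2 * s (?a @ w @ ?b)" by (simp add: power2_eq_square mult_ac)
    then have "ennreal (s w) * ennreal (s ?a) * ennreal (s ?b) \<le> ennreal (K\<^sup>2) * ennreal (s (?a @ w @ ?b))"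
      using s_nonneg by (simp add: ennreal_mult[symmetric] ennreal_leI)
    then show "(ennreal (s w) * ?l ?a) * ?r ?b \<le> ennreal (K\<^sup>2) *
        (if take (length w) (drop i (?a @ w @ ?b)) = w then weight ?N (?a @ w @ ?b) else 0)"
      using p by (simp add: weight_def)
  qed (auto simp: weight_def)
  also have "\<dots> = ennreal (K\<^sup>2) * occurrence ?N i w" by (simp add: nn_integral_cmult occurrence_def)
  finally have 1: "ennreal (s w) * (left_sum i w * right_sum k w) \<le> ennreal (K\<^sup>2) * occurrence ?N i w" .
  have "ennreal (s w) * (Z i * Z k) \<le> ennreal (s w) * ((ennreal C\<^sub>1 * left_sum i w) * (ennreal C\<^sub>1 * right_sum k w))"
    by (intro mult_left_mono mult_mono Z_le_left_sum Z_le_right_sum w) auto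
  also have "\<dots> = ennreal (C\<^sub>1\<^sup>2) * (ennreal (s w) * (left_sum i w * right_sum k w))"
    using C1_nonneg by (simp add: power2_eq_square ennreal_mult mult_ac)
  also have "\<dots> \<le> ennreal (C\<^sub>1\<^sup>2) * (ennreal (K\<^sup>2) * occurrence ?N i w)"
    using 1 by (intro mult_left_mono) auto
  also have "\<dots> = ennreal (K\<^sup>2 * C\<^sub>1\<^sup>2) * occurrence ?N i w"
    by (simp add: ennreal_mult mult_ac)
  finally show ?thesis .
qed

end

section \<open>Random words, averaged masses and their limits\<close>

lemma bounded_sequences_convergent_subsequence:
  fixes f :: "nat \<Rightarrow> 'b \<Rightarrow> real"
  assumes A: "countable A" and bounds: "\<And>k a. a \<in> A \<Longrightarrow> f k a \<in> {0..1}"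
  obtains r where "strict_mono r" "\<And>a. a \<in> A \<Longrightarrow> convergent (\<lambda>k. f (r k) a)"
proof (cases "A = {}")
  case True
  then show ?thesis using that[of id] by (simp add: strict_mono_def)
next
  case False
  define g where "g k i = f k (from_nat_into A i)" for k i
  have "compact (PiE UNIV (\<lambda>_::nat. {0..1::real}))"
    using compactin_PiE[of "\<lambda>_::nat. euclidean :: real topology" UNIV "\<lambda>_. {0..1}"]
    by (simp add: euclidean_product_topology)
  then have "seq_compact (PiE UNIV (\<lambda>_::nat. {0..1::real}))" by (rule compact_imp_seq_compact)
  moreover have "g k \<in> PiE UNIV (\<lambda>_::nat. {0..1})" for k
    using bounds[OF from_nat_into[OF False]] unfolding g_def PiE_UNIV_domain by blast
  ultimately obtain l r where lr: "strict_mono r" "(g \<circ> r) \<longlonglongrightarrow> l"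
    unfolding seq_compact_def by blast
  have "(\<lambda>k. g (r k) i) \<longlonglongrightarrow> l i" for i
  proof -
    have "isCont (\<lambda>h :: nat \<Rightarrow> real. h i) l"
      using continuous_on_product_coordinates[of i] continuous_on_eq_continuous_at[OF open_UNIV] by blast
    then show ?thesis using isCont_tendsto_compose lr(2) unfolding comp_def by blast
  qed
  then have "convergent (\<lambda>k. f (r k) a)" if "a \<in> A" for a
    using from_nat_into_surj[OF A that] unfolding g_def convergent_def by metis
  then show ?thesis using that lr(1) by blast
qed

locale countable_word_weights = word_weights adm s K \<Lambda>
  for adm :: "'a list \<Rightarrow> bool" and s K \<Lambda> +
  fixes S :: "'a set"
  assumes countable_letters: "countable S"
    and adm_letters: "\<And>w. adm w \<Longrightarrow> set w \<subseteq> S"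
    and words_exist: "\<And>n. \<exists>w. adm w \<and> length w = n"
begin

lemma Z_pos: "z n > 0"
proof -
  obtain w where w: "adm w" "length w = n" using words_exist by blast
  have "ennreal (s w) = (\<integral>\<^sup>+v. weight n v * indicator {w} v \<partial>count_space UNIV)"
    using w by (subst nn_integral_count_space'[of "{w}"]) (auto simp: weight_def)
  also have "\<dots> \<le> Z n" unfolding Z_def by (intro nn_integral_mono) (auto simp: indicator_def)
  finally show ?thesis using s_pos[OF w(1)] z_nonneg[of n] unfolding Z_eq by (simp add: ennreal_le_iff)
qed

lemma z_add_le: "z (i + j) \<le> K * (z i * z j)"
  using Z_add_le[of i j] K z_nonneg unfolding Z_eq by (simp add: ennreal_mult[symmetric] ennreal_le_iff)

lemma z_mult_le: "z i * z j \<le> K * C\<^sub>1 * z (i + j)"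
  using Z_mult_le[of i j] K z_nonneg C1_nonneg unfolding Z_eq by (simp add: ennreal_mult[symmetric] ennreal_le_iff)

lemma C1_pos: "C\<^sub>1 > 0"
proof -
  have "0 < z 0 * z 0" using Z_pos by simp
  also have "\<dots> \<le> K * C\<^sub>1 * z 0" using z_mult_le[of 0 0] by simp
  finally show ?thesis using C1_nonneg by (cases "C\<^sub>1 = 0") auto
qed

text \<open>The constant arises in two ways: \<open>K\<^sup>2\<close> from cutting out an occurrence
  times \<open>(K * C\<^sub>1)\<^sup>2\<close> from multiplying three partition sums, or
  \<open>K\<^sup>2 * C\<^sub>1\<^sup>2\<close> from gluing times \<open>K\<^sup>2\<close> from
  splitting one partition sum into three.\<close>

definition C\<^sub>2 :: real where "C\<^sub>2 = K ^ 4 * C\<^sub>1\<^sup>2"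

lemma C2_pos: "C\<^sub>2 > 0"
  using K C1_pos by (simp add: C\<^sub>2_def)

definition word_pmf :: "nat \<Rightarrow> 'a list pmf" where
  "word_pmf n = embed_pmf (\<lambda>w. if length w = n then s w / z n else 0)"

lemma pmf_word_pmf: "pmf (word_pmf n) w = (if length w = n then s w / z n else 0)"
  unfolding word_pmf_def
proof (rule pmf_embed_pmf)
  show "(\<integral>\<^sup>+w. ennreal (if length w = n then s w / z n else 0) \<partial>count_space UNIV) = 1"
  proof -
    have "ennreal (if length w = n then s w / z n else 0) = weight n w * ennreal (1 / z n)" for w :: "'a list"
      using s_nonneg z_nonneg by (simp add: weight_def ennreal_mult[symmetric])
    then have "(\<integral>\<^sup>+w. ennreal (if length w = n then s w / z n else 0) \<partial>count_space UNIV) = Z n * ennreal (1 / z n)"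
      by (simp add: nn_integral_multc Z_def)
    then show ?thesis using Z_pos[of n] by (simp add: Z_eq ennreal_mult[symmetric])
  qed
qed (auto simp: s_nonneg z_nonneg)

lemma set_word_pmf: "set_pmf (word_pmf n) \<subseteq> {w. adm w \<and> length w = n}"
  using s_zero by (auto simp: set_pmf_eq pmf_word_pmf split: if_splits)

definition hit :: "nat \<Rightarrow> nat \<Rightarrow> 'a list \<Rightarrow> real" where
  "hit n i w = measure (measure_pmf (word_pmf n)) {u. take (length w) (drop i u) = w}"

lemma occurrence_eq: "occurrence n i w = ennreal (z n * hit n i w)"
proof -
  have eq: "(if take (length w) (drop i u) = w then weight n u else 0)
      = ennreal (z n) * (ennreal (pmf (word_pmf n) u) * indicator {u. take (length w) (drop i u) = w} u)" for u
    using Z_pos[of n] s_nonneg by (auto simp: weight_def pmf_word_pmf ennreal_mult[symmetric] indicator_def)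
  have "occurrence n i w = ennreal (z n) * (\<integral>\<^sup>+u. ennreal (pmf (word_pmf n) u) * indicator {u. take (length w) (drop i u) = w} u \<partial>count_space UNIV)"
    unfolding occurrence_def eq by (rule nn_integral_cmult) simp
  also have "(\<integral>\<^sup>+u. ennreal (pmf (word_pmf n) u) * indicator {u. take (length w) (drop i u) = w} u \<partial>count_space UNIV)
      = (\<integral>\<^sup>+u. indicator {u. take (length w) (drop i u) = w} u \<partial>measure_pmf (word_pmf n))"
    by (simp only: nn_integral_measure_pmf)
  also have "\<dots> = ennreal (hit n i w)"
    by (simp add: hit_def measure_pmf.emeasure_eq_measure)
  finally show ?thesis using z_nonneg by (simp add: ennreal_mult hit_def)
qed

lemma hit_bounds: "0 \<le> hit n i w" "hit n i w \<le> 1"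
  by (auto simp: hit_def)

text \<open>With \<open>n = i + length w + k\<close>, the product of the partition sums of the three
  pieces is comparable to \<open>z n\<close>. The bound is thus uniform in the position and in the
  total length, and it survives averaging and limits.\<close>

lemma hit_le:
  assumes "i + length w \<le> n"
  shows "hit n i w \<le> C\<^sub>2 * s w / z (length w)"
proof -
  obtain k where n: "n = i + length w + k" using assms le_Suc_ex by blast
  let ?j = "length w"
  have "ennreal (z n * hit n i w) \<le> ennreal (K\<^sup>2 * s w * (z i * z k))"
    using occurrence_le[of i w k] z_nonneg s_nonneg unfolding n occurrence_eq Z_eq by (simp add: ennreal_mult[symmetric])
  then have 1: "z n * hit n i w \<le> K\<^sup>2 * s w * (z i * z k)"
    using z_nonneg s_nonneg by (simp add: ennreal_le_iff)
  have "z i * z ?j * z k \<le> K * C\<^sub>1 * z (i + ?j) * z k" using z_mult_le z_nonneg by (intro mult_right_mono) auto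
  also have "\<dots> = K * C\<^sub>1 * (z (i + ?j) * z k)" by simp
  also have "\<dots> \<le> K * C\<^sub>1 * (K * C\<^sub>1 * z n)"
    unfolding n using z_mult_le K C1_nonneg by (intro mult_left_mono) auto
  finally have 2: "z i * z k * z ?j \<le> (K * C\<^sub>1)\<^sup>2 * z n" by (simp add: power2_eq_square mult_ac)
  have "z n * (hit n i w * z ?j) \<le> K\<^sup>2 * s w * (z i * z k) * z ?j"
    using mult_right_mono[OF 1 z_nonneg[of ?j]] by (simp add: mult.assoc)
  also have "\<dots> = K\<^sup>2 * s w * (z i * z k * z ?j)" by simp
  also have "\<dots> \<le> K\<^sup>2 * s w * ((K * C\<^sub>1)\<^sup>2 * z n)"
    using 2 s_nonneg by (intro mult_left_mono) auto
  also have "\<dots> = z n * (C\<^sub>2 * s w)" by (simp add: C\<^sub>2_def power2_eq_square power4_eq_xxxx mult_ac)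
  finally have "hit n i w * z ?j \<le> C\<^sub>2 * s w" using Z_pos[of n] by simp
  then show ?thesis using Z_pos[of ?j] by (simp add: field_simps)
qed

lemma hit_ge:
  assumes "i + length w \<le> n" and w: "adm w" "w \<noteq> []"
  shows "s w / (C\<^sub>2 * z (length w)) \<le> hit n i w"
proof -
  obtain k where n: "n = i + length w + k" using assms(1) le_Suc_ex by blast
  let ?j = "length w"
  have "ennreal (s w * (z i * z k)) \<le> ennreal (K\<^sup>2 * C\<^sub>1\<^sup>2 * (z n * hit n i w))"
    using occurrence_ge[OF w, of i k] z_nonneg s_nonneg hit_bounds unfolding n occurrence_eq Z_eq
    by (simp add: ennreal_mult[symmetric])
  then have 1: "s w * (z i * z k) \<le> K\<^sup>2 * C\<^sub>1\<^sup>2 * (z n * hit n i w)"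
    using z_nonneg hit_bounds by (simp add: ennreal_le_iff)
  have "z n \<le> K * (z (i + ?j) * z k)" unfolding n by (rule z_add_le)
  also have "\<dots> \<le> K * (K * (z i * z ?j) * z k)"
    using z_add_le K z_nonneg by (intro mult_left_mono mult_right_mono) auto
  finally have 2: "z n \<le> K\<^sup>2 * (z i * z k) * z ?j" by (simp add: power2_eq_square mult_ac)
  have "s w * z n \<le> s w * (K\<^sup>2 * (z i * z k) * z ?j)" using 2 s_nonneg by (intro mult_left_mono) auto
  also have "\<dots> = K\<^sup>2 * z ?j * (s w * (z i * z k))" by simp
  also have "\<dots> \<le> K\<^sup>2 * z ?j * (K\<^sup>2 * C\<^sub>1\<^sup>2 * (z n * hit n i w))"
    using 1 z_nonneg by (intro mult_left_mono) auto
  also have "\<dots> = (C\<^sub>2 * z ?j * hit n i w) * z n" by (simp add: C\<^sub>2_def power2_eq_square power4_eq_xxxx mult_ac)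
  finally have "s w \<le> C\<^sub>2 * z ?j * hit n i w" using Z_pos[of n] by simp
  then show ?thesis using Z_pos[of ?j] C2_pos by (simp add: field_simps)
qed

lemma hit_Nil: "hit n i [] = 1"
  by (simp add: hit_def)

lemma hit_not_adm:
  assumes "\<not> adm w"
  shows "hit n i w = 0"
proof -
  have "take (length w) (drop i u) \<noteq> w" if "adm u" for u
  proof
    assume eq: "take (length w) (drop i u) = w"
    have "adm (drop i u)" using adm_append[of "take i u" "drop i u"] that by simp
    then have "adm (w @ drop (length w) (drop i u))" using append_take_drop_id[of "length w" "drop i u"] eq by simp
    then show False using adm_append assms by blast
  qed
  then have "set_pmf (word_pmf n) \<inter> {u. take (length w) (drop i u) = w} = {}" using set_word_pmf by blast
  then show ?thesis by (simp add: hit_def measure_pmf_zero_iff)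
qed

text \<open>Countable additivity for a word event that is split by one extra letter. The general
  \<open>g\<close>, \<open>i\<close>, \<open>j\<close> cover a letter appended on the right and one
  put in front, where the position changes as well.\<close>

lemma hit_sum:
  assumes disj: "\<And>a b u. take (length (g a)) (drop i u) = g a \<Longrightarrow> take (length (g b)) (drop i u) = g b \<Longrightarrow> a = b"
    and split: "\<And>u. adm u \<Longrightarrow> length u = n \<Longrightarrow>
      take (length w) (drop j u) = w \<longleftrightarrow> (\<exists>a\<in>S. take (length (g a)) (drop i u) = g a)"
  shows "(\<integral>\<^sup>+a. ennreal (hit n i (g a)) \<partial>count_space S) = ennreal (hit n j w)"
proof -
  let ?E = "\<lambda>a. {u. take (length (g a)) (drop i u) = g a}"
  have "ennreal (hit n j w) = emeasure (measure_pmf (word_pmf n)) {u. take (length w) (drop j u) = w}"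
    by (simp add: hit_def measure_pmf.emeasure_eq_measure)
  also have "\<dots> = emeasure (measure_pmf (word_pmf n)) (\<Union>a\<in>S. ?E a)"
    using set_word_pmf split by (intro emeasure_eq_AE) (auto simp: AE_measure_pmf_iff)
  also have "\<dots> = (\<integral>\<^sup>+a. emeasure (measure_pmf (word_pmf n)) (?E a) \<partial>count_space S)"
    using countable_letters disj by (intro emeasure_UN_countable) (auto simp: disjoint_family_on_def)
  finally show ?thesis by (simp add: hit_def measure_pmf.emeasure_eq_measure)
qed

lemma hit_extend_right:
  assumes "i + length w < n"
  shows "(\<integral>\<^sup>+a. ennreal (hit n i (w @ [a])) \<partial>count_space S) = ennreal (hit n i w)"
proof (rule hit_sum)
  fix u assume u: "adm u" "length u = n"
  have eq: "take (Suc (length w)) (drop i u) = take (length w) (drop i u) @ [u ! (i + length w)]"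
    using assms u by (subst take_Suc_conv_app_nth) auto
  have "u ! (i + length w) \<in> S" using adm_letters[OF u(1)] u(2) assms by auto
  then show "take (length w) (drop i u) = w \<longleftrightarrow> (\<exists>a\<in>S. take (length (w @ [a])) (drop i u) = w @ [a])"
    by (simp add: eq)
qed simp

lemma hit_extend_left:
  assumes "i + length w < n"
  shows "(\<integral>\<^sup>+a. ennreal (hit n i (a # w)) \<partial>count_space S) = ennreal (hit n (Suc i) w)"
proof (rule hit_sum)
  fix u assume u: "adm u" "length u = n"
  have eq: "drop i u = u ! i # drop (Suc i) u"
    using assms u by (simp add: Cons_nth_drop_Suc)
  have "u ! i \<in> S" using adm_letters[OF u(1)] u(2) assms by auto
  then show "take (length w) (drop (Suc i) u) = w \<longleftrightarrow> (\<exists>a\<in>S. take (length (a # w)) (drop i u) = a # w)"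
    by (simp add: eq)
next
  fix a b u
  show "take (length (a # w)) (drop i u) = a # w \<Longrightarrow> take (length (b # w)) (drop i u) = b # w \<Longrightarrow> a = b" by simp
qed

text \<open>For words of length at most \<open>n\<close>, every position below \<open>n\<close>
  leaves room in a word of length \<open>2 * n\<close> for the word and one further letter.\<close>

definition average :: "nat \<Rightarrow> 'a list \<Rightarrow> real" where
  "average n w = (\<Sum>i<n. hit (2 * n) i w) / n"

lemma average_bounds: "0 \<le> average n w" "average n w \<le> 1"
proof -
  show "0 \<le> average n w" unfolding average_def by (intro divide_nonneg_nonneg sum_nonneg hit_bounds) simp
  have "(\<Sum>i<n. hit (2 * n) i w) \<le> (\<Sum>i<n. 1)" by (intro sum_mono hit_bounds)
  then show "average n w \<le> 1" by (cases "n = 0") (auto simp: average_def field_simps)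
qed

lemma average_le:
  assumes "length w \<le> n" "n \<ge> 1"
  shows "average n w \<le> C\<^sub>2 * s w / z (length w)"
proof -
  have "(\<Sum>i<n. hit (2 * n) i w) \<le> (\<Sum>i<n. C\<^sub>2 * s w / z (length w))"
    using assms by (intro sum_mono hit_le) auto
  then show ?thesis using assms by (simp add: average_def field_simps)
qed

lemma average_ge:
  assumes "length w \<le> n" "n \<ge> 1" "adm w" "w \<noteq> []"
  shows "s w / (C\<^sub>2 * z (length w)) \<le> average n w"
proof -
  have "(\<Sum>i<n. s w / (C\<^sub>2 * z (length w))) \<le> (\<Sum>i<n. hit (2 * n) i w)"
    using assms by (intro sum_mono hit_ge) auto
  then show ?thesis using assms(2) by (simp add: average_def pos_le_divide_eq mult.commute)
qed

lemma average_Nil: "n \<ge> 1 \<Longrightarrow> average n [] = 1"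
  by (simp add: average_def hit_Nil)

lemma average_not_adm: "\<not> adm w \<Longrightarrow> average n w = 0"
  by (simp add: average_def hit_not_adm)

lemma average_eq: "ennreal (average n w) = ennreal (1 / n) * (\<Sum>i<n. ennreal (hit (2 * n) i w))"
  using hit_bounds by (simp add: average_def ennreal_mult[symmetric] sum_nonneg)

lemma average_extend_right:
  assumes "length w \<le> n"
  shows "(\<integral>\<^sup>+a. ennreal (average n (w @ [a])) \<partial>count_space S) = ennreal (average n w)"
proof -
  have "(\<integral>\<^sup>+a. ennreal (average n (w @ [a])) \<partial>count_space S)
      = ennreal (1 / n) * (\<integral>\<^sup>+a. (\<Sum>i<n. ennreal (hit (2 * n) i (w @ [a]))) \<partial>count_space S)"
    unfolding average_eq by (rule nn_integral_cmult) simp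
  also have "(\<integral>\<^sup>+a. (\<Sum>i<n. ennreal (hit (2 * n) i (w @ [a]))) \<partial>count_space S) = (\<Sum>i<n. ennreal (hit (2 * n) i w))"
    using assms by (subst nn_integral_sum) (auto intro!: sum.cong hit_extend_right)
  finally show ?thesis by (simp add: average_eq)
qed

text \<open>A letter in front moves every position by one, and the averages telescope: only the two
  extreme positions remain. This defect is what disappears in the limit and yields
  invariance.\<close>

lemma average_extend_left:
  assumes "length w \<le> n"
  shows "(\<integral>\<^sup>+a. ennreal (average n (a # w)) \<partial>count_space S)
    = ennreal (average n w + (hit (2 * n) n w - hit (2 * n) 0 w) / n)"
proof -
  have "(\<integral>\<^sup>+a. ennreal (average n (a # w)) \<partial>count_space S)
      = ennreal (1 / n) * (\<integral>\<^sup>+a. (\<Sum>i<n. ennreal (hit (2 * n) i (a # w))) \<partial>count_space S)"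
    unfolding average_eq by (rule nn_integral_cmult) simp
  also have "(\<integral>\<^sup>+a. (\<Sum>i<n. ennreal (hit (2 * n) i (a # w))) \<partial>count_space S) = (\<Sum>i<n. ennreal (hit (2 * n) (Suc i) w))"
    using assms by (subst nn_integral_sum) (auto intro!: sum.cong hit_extend_left)
  also have "ennreal (1 / n) * \<dots> = ennreal ((\<Sum>i<n. hit (2 * n) (Suc i) w) / n)"
    using hit_bounds by (simp add: ennreal_mult[symmetric] sum_nonneg)
  also have "(\<Sum>i<n. hit (2 * n) (Suc i) w) = (\<Sum>i<n. hit (2 * n) i w) + hit (2 * n) n w - hit (2 * n) 0 w"
    using sum_lessThan_telescope[of "\<lambda>i. hit (2 * n) i w" n] by (simp add: sum_subtractf)
  finally show ?thesis by (simp add: average_def add_divide_distrib diff_divide_distrib add_diff_eq)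
qed

text \<open>A subsequence converges at all words simultaneously, as there are countably many. The
  marginal identities are sums over infinitely many letters; they survive the limit by dominated
  convergence with a multiple of the summable \<open>s [a]\<close>.\<close>

lemma limit_masses:
  obtains m :: "'a list \<Rightarrow> real" where
    "m [] = 1" "\<And>w. \<not> adm w \<Longrightarrow> m w = 0" "\<And>w. m w \<ge> 0"
    "\<And>w. m w \<le> C\<^sub>2 * s w / z (length w)"
    "\<And>w. adm w \<Longrightarrow> w \<noteq> [] \<Longrightarrow> s w / (C\<^sub>2 * z (length w)) \<le> m w"
    "\<And>w. (\<integral>\<^sup>+a. ennreal (m (w @ [a])) \<partial>count_space S) = ennreal (m w)"
    "\<And>w. (\<integral>\<^sup>+a. ennreal (m (a # w)) \<partial>count_space S) = ennreal (m w)"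
proof -
  have "countable (lists S)" using countable_letters by simp
  moreover have "average k w \<in> {0..1}" for k w using average_bounds by simp
  ultimately obtain r where r: "strict_mono r" "\<And>w. w \<in> lists S \<Longrightarrow> convergent (\<lambda>k. average (r k) w)"
    using bounded_sequences_convergent_subsequence[of "lists S" average] by blast
  have conv: "convergent (\<lambda>k. average (r k) w)" for w
  proof (cases "adm w")
    case True
    then show ?thesis using adm_letters[OF True] by (intro r) auto
  qed (simp add: average_not_adm convergent_const)
  define m where "m w = lim (\<lambda>k. average (r k) w)" for w
  have lim: "(\<lambda>k. average (r k) w) \<longlonglongrightarrow> m w" for w
    using conv unfolding m_def by (simp add: convergent_LIMSEQ_iff)
  have rk: "r k \<ge> k" for k by (rule seq_suble[OF r(1)])
  have upper: "m w \<le> C\<^sub>2 * s w / z (length w)" for w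
  proof (rule LIMSEQ_le_const2[OF lim], intro exI allI impI)
    fix k assume "k \<ge> Suc (length w)"
    then show "average (r k) w \<le> C\<^sub>2 * s w / z (length w)" using rk[of k] by (intro average_le) auto
  qed
  have lower: "s w / (C\<^sub>2 * z (length w)) \<le> m w" if "adm w" "w \<noteq> []" for w
  proof (rule LIMSEQ_le_const[OF lim], intro exI allI impI)
    fix k assume "k \<ge> Suc (length w)"
    then show "s w / (C\<^sub>2 * z (length w)) \<le> average (r k) w" using rk[of k] that by (intro average_ge) auto
  qed
  have Nil: "m [] = 1"
  proof (rule LIMSEQ_unique[OF lim])
    have "\<forall>\<^sub>F k in sequentially. average (r k) [] = 1"
      using eventually_ge_at_top[of 1] by eventually_elim (use rk in \<open>auto intro!: average_Nil intro: order_trans\<close>)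
    then show "(\<lambda>k. average (r k) []) \<longlonglongrightarrow> 1" by (rule tendsto_eventually)
  qed
  have zero: "m w = 0" if "\<not> adm w" for w
    using LIMSEQ_unique[OF lim[of w]] that by (simp add: average_not_adm)
  have nonneg: "m w \<ge> 0" for w
    by (rule LIMSEQ_le_const[OF lim]) (use average_bounds in auto)
  \<comment> \<open>The index shift by \<open>l\<close> makes \<open>average_le\<close> available
    from the first term on, so that the domination holds for all \<open>k\<close>.\<close>
  have dominated: "(\<lambda>k. \<integral>\<^sup>+a. ennreal (average (r (k + l)) (g a)) \<partial>count_space S) \<longlonglongrightarrow> (\<integral>\<^sup>+a. ennreal (m (g a)) \<partial>count_space S)"
    if len: "\<And>a. length (g a) = l" and l: "l \<ge> 1" and sg: "\<And>a. s (g a) \<le> B * s [a]" and B: "B \<ge> 0" for g :: "'a \<Rightarrow> 'a list" and l B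
  proof (rule nn_integral_dominated_convergence[where w = "\<lambda>a. ennreal (C\<^sub>2 * B / z l) * ennreal (s [a])"])
    have "(\<integral>\<^sup>+a. ennreal (s [a]) \<partial>count_space S) = (\<integral>\<^sup>+a. ennreal (s [a]) \<partial>count_space UNIV)"
      using adm_letters s_zero by (intro nn_integral_count_space_eq) (auto, metis ennreal_0 insert_subset list.set(2))
    then show "(\<integral>\<^sup>+a. ennreal (C\<^sub>2 * B / z l) * ennreal (s [a]) \<partial>count_space S) < \<infinity>"
      using letters_summable by (simp add: nn_integral_cmult ennreal_mult_less_top)
    show "AE a in count_space S. ennreal (average (r (j + l)) (g a)) \<le> ennreal (C\<^sub>2 * B / z l) * ennreal (s [a])" for j
    proof (rule AE_I2)
      fix a
      have "average (r (j + l)) (g a) \<le> C\<^sub>2 * s (g a) / z l"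
        using average_le[of "g a" "r (j + l)"] rk[of "j + l"] len l by simp
      also have "\<dots> \<le> C\<^sub>2 * (B * s [a]) / z l"
        using sg C2_pos z_nonneg by (intro divide_right_mono mult_left_mono) auto
      finally have "average (r (j + l)) (g a) \<le> C\<^sub>2 * B / z l * s [a]" by simp
      then show "ennreal (average (r (j + l)) (g a)) \<le> ennreal (C\<^sub>2 * B / z l) * ennreal (s [a])"
        using C2_pos B z_nonneg s_nonneg by (simp add: ennreal_mult[symmetric] ennreal_leI)
    qed
    show "AE a in count_space S. (\<lambda>k. ennreal (average (r (k + l)) (g a))) \<longlonglongrightarrow> ennreal (m (g a))"
      using LIMSEQ_ignore_initial_segment[OF lim] by (intro AE_I2 tendsto_ennrealI)
  qed auto
  have s_le: "s (u @ v) \<le> K * (s u * s v)" for u v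
    using s_append_le[of u v] s_zero[of "u @ v"] K s_nonneg by (cases "adm (u @ v)") auto
  have right: "(\<integral>\<^sup>+a. ennreal (m (w @ [a])) \<partial>count_space S) = ennreal (m w)" for w
  proof (rule LIMSEQ_unique[OF dominated[where l = "Suc (length w)" and B = "K * s w"]])
    have "(\<integral>\<^sup>+a. ennreal (average (r (k + Suc (length w))) (w @ [a])) \<partial>count_space S) = ennreal (average (r (k + Suc (length w))) w)" for k
      using rk[of "k + Suc (length w)"] by (intro average_extend_right) auto
    then show "(\<lambda>k. \<integral>\<^sup>+a. ennreal (average (r (k + Suc (length w))) (w @ [a])) \<partial>count_space S) \<longlonglongrightarrow> ennreal (m w)"
      using LIMSEQ_ignore_initial_segment[OF lim, of "Suc (length w)" w] by (simp add: tendsto_ennrealI)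
  qed (use s_le[of w] K s_nonneg in \<open>auto simp: mult.assoc\<close>)
  have left: "(\<integral>\<^sup>+a. ennreal (m (a # w)) \<partial>count_space S) = ennreal (m w)" for w
  proof (rule LIMSEQ_unique[OF dominated[where l = "Suc (length w)" and B = "K * s w"]])
    let ?q = "\<lambda>k. r (k + Suc (length w))"
    let ?e = "\<lambda>k. (hit (2 * ?q k) (?q k) w - hit (2 * ?q k) 0 w) / ?q k"
    have "(\<lambda>k. ?e k) \<longlonglongrightarrow> 0"
    proof (rule Lim_null_comparison)
      show "(\<lambda>k. 1 / real (Suc k)) \<longlonglongrightarrow> 0" by (rule LIMSEQ_Suc[OF lim_1_over_n])
      show "\<forall>\<^sub>F k in sequentially. norm (?e k) \<le> 1 / real (Suc k)"
      proof (intro always_eventually allI)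
        fix k
        have "\<bar>hit (2 * ?q k) (?q k) w - hit (2 * ?q k) 0 w\<bar> \<le> 1"
          using hit_bounds[of "2 * ?q k" "?q k" w] hit_bounds[of "2 * ?q k" 0 w] by linarith
        moreover have "Suc k \<le> ?q k" using rk[of "k + Suc (length w)"] by linarith
        ultimately show "norm (?e k) \<le> 1 / real (Suc k)"
          by (auto simp: abs_divide intro!: frac_le)
      qed
    qed
    then have "(\<lambda>k. average (?q k) w + ?e k) \<longlonglongrightarrow> m w + 0"
      using LIMSEQ_ignore_initial_segment[OF lim, of "Suc (length w)" w] by (intro tendsto_add)
    moreover have "(\<integral>\<^sup>+a. ennreal (average (?q k) (a # w)) \<partial>count_space S) = ennreal (average (?q k) w + ?e k)" for k
      using rk[of "k + Suc (length w)"] by (intro average_extend_left) auto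
    ultimately show "(\<lambda>k. \<integral>\<^sup>+a. ennreal (average (?q k) (a # w)) \<partial>count_space S) \<longlonglongrightarrow> ennreal (m w)"
      by (simp add: tendsto_ennrealI)
    show "s (a # w) \<le> K * s w * s [a]" for a using s_le[of "[a]" w] by (simp add: mult_ac)
  qed (use K s_nonneg in auto)
  show ?thesis by (rule that[OF Nil zero nonneg upper lower right left])
qed

text \<open>Both \<open>ln z\<^sub>n + const\<close> and \<open>const - ln z\<^sub>n\<close> are subadditive.\<close>

lemma z_growth:
  obtains P D where "D \<ge> 0" "\<And>n. z n \<le> exp (P * n + D)" "\<And>n. exp (P * n - D) \<le> z n"
proof -
  \<comment> \<open>The larger of the two logarithmic errors serves both inequalities, so that one
    additive constant makes both sequences subadditive.\<close>
  define D where "D = max (ln K) (ln (K * C\<^sub>1))"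
  define a where "a n = ln (z n)" for n
  have D0: "D \<ge> 0" using K by (simp add: D_def le_max_iff_disj)
  have up: "a (i + j) \<le> a i + a j + D" for i j
  proof -
    have "ln (z (i + j)) \<le> ln (K * (z i * z j))" using z_add_le Z_pos K by simp
    then show ?thesis using Z_pos[of i] Z_pos[of j] K by (simp add: a_def ln_mult D_def)
  qed
  have low: "a i + a j \<le> a (i + j) + D" for i j
  proof -
    have "ln (z i * z j) \<le> ln (K * C\<^sub>1 * z (i + j))" using z_mult_le Z_pos K C1_pos by simp
    then show ?thesis using Z_pos[of i] Z_pos[of j] Z_pos[of "i + j"] K C1_pos
      by (simp add: a_def ln_mult[of "K * C\<^sub>1"] ln_mult[of "z i"] D_def)
  qed
  \<comment> \<open>Crude linear bounds by induction serve only to meet the lower bound required by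
    \<open>fekete\<close>.\<close>
  have lin_up: "a n + D \<le> a 0 + D + n * (a 1 + D)" and lin_low: "n * (a 1 - D) + a 0 - D \<le> a n - D" for n
    by (induction n) (use up[of 1] low[of 1] in \<open>auto simp: algebra_simps, (smt (verit))+\<close>)
  have a0: "a 0 \<le> D" using low[of 0 0] by simp
  have sub1: "(a (m + n) + D) \<le> (a m + D) + (a n + D)" for m n using up[of m n] by simp
  have low1: "n * (a 1 - D) \<le> a n + D" for n using lin_low[of n] up[of 0 0] by simp
  obtain P where P: "(\<lambda>n. (a n + D) / n) \<longlonglongrightarrow> P" "\<And>n. n * P \<le> a n + D"
    using fekete[of "\<lambda>n. a n + D" "a 1 - D"] sub1 low1 by blast
  have sub2: "(D - a (m + n)) \<le> (D - a m) + (D - a n)" for m n using low[of m n] by simp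
  have low2: "n * (- (a 1 + D)) \<le> D - a n" for n
    using lin_up[of n] a0 by (simp add: algebra_simps)
  obtain P' where P': "(\<lambda>n. (D - a n) / n) \<longlonglongrightarrow> P'" "\<And>n. n * P' \<le> D - a n"
    using fekete[of "\<lambda>n. D - a n" "- (a 1 + D)"] sub2 low2 by blast
  have "(\<lambda>n. (a n + D) / n + (D - a n) / n) \<longlonglongrightarrow> P + P'" by (intro tendsto_add P P')
  moreover have "(\<lambda>n. (a n + D) / n + (D - a n) / n) = (\<lambda>n. 2 * D * (1 / real n))"
    by (rule ext) (simp add: add_divide_distrib[symmetric])
  moreover have "(\<lambda>n. 2 * D * (1 / real n)) \<longlonglongrightarrow> 2 * D * 0" by (intro tendsto_intros lim_1_over_n)
  \<comment> \<open>The two sequences add up to \<open>2 * D / n\<close>, so their limits are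
    opposite; the two infimum bounds then enclose \<open>ln (z n)\<close> within \<open>D\<close> of
    \<open>P * n\<close>.\<close>
  ultimately have "P + P' = 0" using LIMSEQ_unique by fastforce
  then have "P' = - P" by simp
  have ea: "z n = exp (a n)" for n using Z_pos[of n] by (simp add: a_def)
  show ?thesis
  proof (rule that[OF D0])
    show "z n \<le> exp (P * n + D)" for n
      using P'(2)[of n] \<open>P' = - P\<close> by (simp add: ea mult.commute)
    show "exp (P * n - D) \<le> z n" for n
      using P(2)[of n] by (simp add: ea mult.commute)
  qed
qed

end

section \<open>From masses of words to an invariant measure\<close>

primrec path :: "('a list \<Rightarrow> 'a) \<Rightarrow> nat \<Rightarrow> 'a list" where
  "path f 0 = []"
| "path f (Suc n) = path f n @ [f (path f n)]"

lemma length_path [simp]: "length (path f n) = n"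
  by (induction n) auto

lemma prefix_word_path: "prefix_word n (\<lambda>i. f (path f i)) = path f n"
  by (induction n) auto

text \<open>The event involves \<open>f\<close> only at the proper prefixes of \<open>w\<close>.
  These are pairwise different, so for independent values of \<open>f\<close> its probability is a
  product.\<close>

lemma path_eq_iff: "path f n = w \<longleftrightarrow> length w = n \<and> (\<forall>i<n. f (take i w) = w ! i)"
proof (induction n arbitrary: w)
  case (Suc n)
  show ?case
  proof
    assume w: "path f (Suc n) = w"
    then have "take n w = path f n" "length w = Suc n" by auto
    then have *: "\<forall>i<n. f (take i (take n w)) = take n w ! i" using Suc by metis
    have "f (take i w) = w ! i" if "i < Suc n" for i
      using that * w by (cases "i = n") (auto simp: nth_append)
    then show "length w = Suc n \<and> (\<forall>i<Suc n. f (take i w) = w ! i)" using \<open>length w = Suc n\<close> by blast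
  next
    assume w: "length w = Suc n \<and> (\<forall>i<Suc n. f (take i w) = w ! i)"
    then have "path f n = take n w" using Suc[of "take n w"] by auto
    then show "path f (Suc n) = w" using w by (simp add: take_Suc_conv_app_nth[symmetric])
  qed
qed auto

context countable_shift
begin

definition adm :: "'a list \<Rightarrow> bool" where
  "adm w \<longleftrightarrow> w = [] \<or> w \<in> all_words S T"

lemma adm_iff: "adm w \<longleftrightarrow> set w \<subseteq> S \<and> successively (\<lambda>a b. T a b = 1) w"
proof (cases "w = []")
  case False
  then have "length w \<ge> 1" by (cases w) auto
  then show ?thesis
    using False by (simp add: adm_def all_words_iff words_def successively_conv_nth less_diff_conv)
qed (simp add: adm_def)

lemma adm_words: "w \<in> W n \<longleftrightarrow> adm w \<and> length w = n \<and> n \<ge> 1"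
  by (auto simp: adm_def all_words_iff words_def)

lemma adm_append: "adm (u @ v) \<Longrightarrow> adm u \<and> adm v"
  by (simp add: adm_iff successively_append_iff)

lemma adm_glue: "w \<noteq> [] \<Longrightarrow> adm (u @ w) \<Longrightarrow> adm (w @ v) \<Longrightarrow> adm (u @ w @ v)"
  by (auto simp: adm_iff successively_append_iff)

lemma adm_prefix_word: "x \<in> X \<Longrightarrow> adm (prefix_word n x)"
  using prefix_in_words[of x n] by (cases "n = 0") (simp_all add: adm_words adm_def del: map_eq_conv)

lemma adm_cyl_nonempty: "adm w \<Longrightarrow> cyl w \<noteq> {}"
  using cyl_nonempty[of w "length w"] X_nonempty by (cases "w = []") (auto simp: adm_def all_words_iff)

lemma adm_if_cyl_nonempty: "x \<in> cyl w \<Longrightarrow> adm w"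
  using adm_prefix_word[of x "length w"] by (auto simp: cyl_iff)

lemma countable_adm: "countable {w. adm w}"
proof (rule countable_subset)
  show "{w. adm w} \<subseteq> lists S" by (auto simp: adm_iff)
  show "countable (lists S)" using countable_alphabet by simp
qed

text \<open>The points are read off from independent letters \<open>f w\<close>, one for each word \<open>w\<close>, by following
  the path that appends \<open>f w\<close> to \<open>w\<close>.\<close>

lemma measure_of_masses:
  fixes m :: "'a list \<Rightarrow> real"
  assumes Nil: "m [] = 1" and zero: "\<And>w. \<not> adm w \<Longrightarrow> m w = 0" and pos: "\<And>w. adm w \<Longrightarrow> m w > 0"
    and extend: "\<And>w. (\<integral>\<^sup>+a. ennreal (m (w @ [a])) \<partial>count_space S) = ennreal (m w)"
  obtains \<mu> where "prob_space \<mu>" "sets \<mu> = sets \<B>" "\<And>w. measure \<mu> (cyl w) = m w"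
proof -
  have nonneg: "m w \<ge> 0" for w using zero[of w] pos[of w] by (cases "adm w") auto
  \<comment> \<open>The value at inadmissible words is arbitrary; it only has to be a distribution
    for the product measure to exist.\<close>
  define kern where "kern w = (if adm w then embed_pmf (\<lambda>a. m (w @ [a]) / m w) else return_pmf undefined)" for w
  have kern: "pmf (kern w) a = m (w @ [a]) / m w" if w: "adm w" for w a
  proof -
    have "(\<integral>\<^sup>+a. ennreal (m (w @ [a]) / m w) \<partial>count_space UNIV) = (\<integral>\<^sup>+a. ennreal (m (w @ [a]) / m w) \<partial>count_space S)"
      using zero by (intro nn_integral_count_space_eq) (auto simp: adm_iff)
    also have "\<dots> = (\<integral>\<^sup>+a. ennreal (m (w @ [a])) * ennreal (1 / m w) \<partial>count_space S)"
      using nonneg by (intro nn_integral_cong) (simp add: ennreal_mult[symmetric])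
    also have "\<dots> = 1"
      using pos[OF w] by (subst nn_integral_multc) (auto simp: extend ennreal_mult[symmetric])
    finally show ?thesis
      unfolding kern_def using w nonneg by (simp, subst pmf_embed_pmf) auto
  qed
  define \<Omega> where "\<Omega> = PiM UNIV (\<lambda>w. measure_pmf (kern w))"
  interpret product_prob_space "\<lambda>w. measure_pmf (kern w)" UNIV
    by (intro product_prob_spaceI measure_pmf.prob_space_axioms)
  interpret \<Omega>: prob_space \<Omega> unfolding \<Omega>_def by (rule prob_space_PiM) (rule measure_pmf.prob_space_axioms)
  have space_\<Omega>: "space \<Omega> = UNIV" by (simp add: \<Omega>_def space_PiM)
  have coord: "(\<lambda>f. f w) \<in> \<Omega> \<rightarrow>\<^sub>M count_space UNIV" for w
    unfolding \<Omega>_def using measurable_component_singleton[of w UNIV "\<lambda>w. measure_pmf (kern w)"] by simp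
  have coord_sets: "{f. f w \<in> A} \<in> sets \<Omega>" for w A
    using measurable_sets[OF coord, of A w] by (simp add: space_\<Omega> vimage_def)
  have path_sets: "{f. path f n = w} \<in> sets \<Omega>" for n w
  proof -
    have "{f. f (take i w) \<in> {w ! i}} \<in> sets \<Omega>" for i by (rule coord_sets)
    then have "{f \<in> space \<Omega>. \<forall>i\<in>{..<n}. f (take i w) = w ! i} \<in> sets \<Omega>"
      by (intro sets.sets_Collect_finite_All) (auto simp: space_\<Omega>)
    then show ?thesis by (cases "length w = n") (auto simp: path_eq_iff space_\<Omega> lessThan_def)
  qed
  have path_prob: "measure \<Omega> {f. path f (length w) = w} = m w" if w: "adm w" for w
  proof -
    let ?n = "length w"
    let ?J = "(\<lambda>i. take i w) ` {..<?n}"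
    have inj: "inj_on (\<lambda>i. take i w) {..<?n}"
      by (rule inj_onI) (metis length_take lessThan_iff min.absorb4)
    have "{f. path f ?n = w} = {f \<in> space \<Omega>. \<forall>v\<in>?J. f v \<in> {w ! length v}}"
      by (auto simp: path_eq_iff space_\<Omega>)
    then have "emeasure \<Omega> {f. path f ?n = w} = (\<Prod>v\<in>?J. emeasure (measure_pmf (kern v)) {w ! length v})"
      unfolding \<Omega>_def by (simp only:) (rule emeasure_PiM_Collect, auto)
    also have "\<dots> = (\<Prod>i<?n. ennreal (pmf (kern (take i w)) (w ! i)))"
      by (subst prod.reindex[OF inj]) (auto simp: emeasure_pmf_single intro!: prod.cong)
    also have "\<dots> = (\<Prod>i<?n. ennreal (m (take (Suc i) w) / m (take i w)))"
    proof (rule prod.cong[OF refl])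
      fix i assume i: "i \<in> {..<?n}"
      have "adm (take i w)" using adm_append[of "take i w" "drop i w"] w by simp
      then show "ennreal (pmf (kern (take i w)) (w ! i)) = ennreal (m (take (Suc i) w) / m (take i w))"
        using i by (simp add: kern take_Suc_conv_app_nth)
    qed
    also have "\<dots> = ennreal (\<Prod>i<?n. m (take (Suc i) w) / m (take i w))"
      using nonneg by (intro prod_ennreal) auto
    \<comment> \<open>The conditional probabilities telescope from \<open>m [] = 1\<close> to
      \<open>m w\<close>.\<close>
    also have "(\<Prod>i<?n. m (take (Suc i) w) / m (take i w)) = m w"
    proof -
      have "(\<Prod>i<k. m (take (Suc i) w) / m (take i w)) = m (take k w)" if "k \<le> ?n" for k
        using that
      proof (induction k)
        case (Suc k)
        have "adm (take k w)" using adm_append[of "take k w" "drop k w"] w by simp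
        then show ?case using Suc pos[of "take k w"] by simp
      qed (simp add: Nil)
      then show ?thesis by simp
    qed
    finally show ?thesis using nonneg by (simp add: measure_def)
  qed
  \<comment> \<open>Almost every family of letters lies in the supports of all the countably many
    kernels. There the path stays admissible; elsewhere \<open>Y\<close> takes the value
    \<open>x0\<close>, so that it always lies in the shift.\<close>
  define good where "good = {f. \<forall>w\<in>{w. adm w}. f w \<in> set_pmf (kern w)}"
  have good_sets: "good \<in> sets \<Omega>"
  proof -
    have "(\<Union>w\<in>{w. adm w}. {f. f w \<in> - set_pmf (kern w)}) \<in> sets \<Omega>"
      by (intro sets.countable_UN'[OF countable_adm] image_subsetI coord_sets)
    then have "space \<Omega> - (\<Union>w\<in>{w. adm w}. {f. f w \<in> - set_pmf (kern w)}) \<in> sets \<Omega>"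
      by (rule sets.compl_sets)
    moreover have "space \<Omega> - (\<Union>w\<in>{w. adm w}. {f. f w \<in> - set_pmf (kern w)}) = good"
      by (auto simp: good_def space_\<Omega>)
    ultimately show ?thesis by simp
  qed
  have "AE f in \<Omega>. f w \<in> set_pmf (kern w)" for w
  proof (rule \<Omega>.AE_in_set_eq_1[THEN iffD2, OF coord_sets, simplified])
    have "emeasure \<Omega> {f \<in> space \<Omega>. f w \<in> set_pmf (kern w)} = emeasure (measure_pmf (kern w)) (set_pmf (kern w))"
      unfolding \<Omega>_def by (rule emeasure_PiM_Collect_single) auto
    then show "measure \<Omega> {f. f w \<in> set_pmf (kern w)} = 1"
      by (simp add: space_\<Omega> measure_def emeasure_pmf)
  qed
  then have AE_good: "AE f in \<Omega>. f \<in> good"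
    unfolding good_def mem_Collect_eq by (subst AE_ball_countable[OF countable_adm]) simp
  have good_path: "adm (path f n)" if f: "f \<in> good" for f n
  proof (induction n)
    case (Suc n)
    then have "f (path f n) \<in> set_pmf (kern (path f n))" using f by (simp add: good_def)
    then have "m (path f (Suc n)) \<noteq> 0" using kern[OF Suc] by (auto simp: set_pmf_eq)
    then show ?case using zero by blast
  qed (simp add: adm_def)
  obtain x0 where x0: "x0 \<in> X" using X_nonempty by blast
  define Y where "Y f = (if f \<in> good then (\<lambda>i. f (path f i)) else x0)" for f
  have Y_X: "Y f \<in> X" for f
  proof (cases "f \<in> good")
    case True
    have pre: "prefix_word n (Y f) = path f n" for n using True by (simp add: Y_def prefix_word_path)
    then have *: "prefix_word (Suc (Suc i)) (Y f) \<in> W (Suc (Suc i))" for i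
      unfolding adm_words pre using good_path[OF True, of "Suc (Suc i)"] length_path[of f "Suc (Suc i)"]
      by (simp del: path.simps)
    have "Y f i \<in> S \<and> T (Y f i) (Y f (Suc i)) = 1" for i
      using *[of i] by (auto simp: words_def nth_append)
    then show ?thesis by (simp add: markov_shift_def)
  qed (simp add: Y_def x0)
  have Y_cyl: "Y -` cyl w = (good \<inter> {f. path f (length w) = w}) \<union> (if x0 \<in> cyl w then - good else {})" for w
    using Y_X by (auto simp: cyl_iff Y_def prefix_word_path split: if_splits) (metis prefix_word_path Y_def)+
  have Y [measurable]: "Y \<in> \<Omega> \<rightarrow>\<^sub>M \<B>"
  proof (rule measurable_sigma_sets[OF sets_borel_cyl])
    show "insert {} (cyl ` lists S) \<subseteq> Pow X" using cyl_subset by auto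
    have "- good \<in> sets \<Omega>" using sets.compl_sets[OF good_sets] by (simp add: space_\<Omega> Compl_eq_Diff_UNIV)
    then show "Y -` A \<inter> space \<Omega> \<in> sets \<Omega>" if "A \<in> insert {} (cyl ` lists S)" for A
      using that good_sets path_sets by (auto simp: Y_cyl)
  qed (use Y_X in auto)
  show ?thesis
  proof (rule that)
    show "prob_space (distr \<Omega> \<B> Y)" by (rule \<Omega>.prob_space_distr) measurable
    show "measure (distr \<Omega> \<B> Y) (cyl w) = m w" for w
    proof (cases "adm w")
      case True
      have "measure (distr \<Omega> \<B> Y) (cyl w) = measure \<Omega> (Y -` cyl w \<inter> space \<Omega>)"
        by (rule measure_distr) measurable
      also have "\<dots> = measure \<Omega> {f. path f (length w) = w}"
      proof (rule \<Omega>.finite_measure_eq_AE)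
        show "AE f in \<Omega>. (f \<in> Y -` cyl w \<inter> space \<Omega>) = (f \<in> {f. path f (length w) = w})"
          using AE_good by eventually_elim (auto simp: Y_cyl space_\<Omega>)
        show "Y -` cyl w \<inter> space \<Omega> \<in> sets \<Omega>" using measurable_sets[OF Y cyl_sets] .
      qed (rule path_sets)
      finally show ?thesis using path_prob[OF True] by simp
    next
      case False
      then have "cyl w = {}" using adm_if_cyl_nonempty by blast
      then show ?thesis using zero[OF False] by simp
    qed
  qed simp
qed

text \<open>The preimage of a cylinder is the disjoint union of the cylinders of
  \<open>a # w\<close>, so consistency on the left is invariance on a generator.\<close>

lemma shift_invariant_of_masses:
  fixes m :: "'a list \<Rightarrow> real"
  assumes \<mu>: "prob_space \<mu>" "sets \<mu> = sets \<B>" "\<And>w. measure \<mu> (cyl w) = m w"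
    and extend: "\<And>w. (\<integral>\<^sup>+a. ennreal (m (a # w)) \<partial>count_space S) = ennreal (m w)"
  shows "shift_invariant_measure S T \<mu>"
proof (rule shift_invariant_measureI[OF \<mu>(1,2)])
  interpret prob_space \<mu> by (rule \<mu>)
  fix w
  have "left_shift -` cyl w \<inter> X = (\<Union>a\<in>S. cyl (a # w))"
  proof (intro equalityI subsetI)
    fix x assume "x \<in> left_shift -` cyl w \<inter> X"
    then have "x \<in> X" "\<And>i. i < length w \<Longrightarrow> x (Suc i) = w ! i" by (auto simp: cylinder_def left_shift_def)
    then have "x \<in> cyl (x 0 # w)" "x 0 \<in> S" by (auto simp: cylinder_def nth_Cons markov_shift_def split: nat.split)
    then show "x \<in> (\<Union>a\<in>S. cyl (a # w))" by blast
  next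
    fix x assume "x \<in> (\<Union>a\<in>S. cyl (a # w))"
    then have "x \<in> X" "\<And>i. i < Suc (length w) \<Longrightarrow> \<exists>a. x i = (a # w) ! i" "\<exists>a. x \<in> cyl (a # w)"
      by (auto simp: cylinder_def)
    then show "x \<in> left_shift -` cyl w \<inter> X"
      using shift_in_X by (auto simp: cylinder_def left_shift_def)
  qed
  then have "emeasure \<mu> (left_shift -` cyl w \<inter> X) = (\<integral>\<^sup>+a. emeasure \<mu> (cyl (a # w)) \<partial>count_space S)"
    using countable_alphabet \<mu>(2)
    by (simp only:) (intro emeasure_UN_countable, auto simp: disjoint_family_on_def cyl_iff)
  also have "\<dots> = ennreal (measure \<mu> (cyl w))"
    by (simp add: emeasure_eq_measure \<mu>(3) extend)
  finally show "measure \<mu> (left_shift -` cyl w \<inter> X) = measure \<mu> (cyl w)"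
    by (simp add: measure_def)
qed

text \<open>In the full shift, where the empty connector is allowed, any single letter serves
  instead; otherwise the given connectors are already nonempty.\<close>

lemma finitely_irreducible_connectors:
  assumes "finitely_irreducible S T"
  obtains \<Lambda> where "finite \<Lambda>" "\<Lambda> \<subseteq> all_words S T"
    "\<And>u v. u \<in> all_words S T \<Longrightarrow> v \<in> all_words S T \<Longrightarrow> \<exists>l\<in>\<Lambda>. u @ l @ v \<in> all_words S T"
proof (cases "\<forall>i\<in>S. \<forall>j\<in>S. T i j = 1")
  case True
  obtain a where a: "a \<in> S" using nonempty_alphabet by blast
  have all: "w \<in> all_words S T \<longleftrightarrow> w \<noteq> [] \<and> set w \<subseteq> S" for w
  proof -
    have "T (w ! i) (w ! (i + 1)) = 1" if "set w \<subseteq> S" "i + 1 < length w" for i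
    proof -
      have "w ! i \<in> S" "w ! (i + 1) \<in> S" using that by (auto intro!: subsetD[OF that(1)] nth_mem)
      then show ?thesis using True by blast
    qed
    then show ?thesis by (cases "w = []") (auto simp: all_words_iff words_def Suc_le_eq)
  qed
  show ?thesis by (rule that[of "{[a]}"]) (use a in \<open>auto simp: all\<close>)
next
  case False
  then have eq: "all_words S T \<union> (if \<forall>i\<in>S. \<forall>j\<in>S. T i j = 1 then {[]} else {}) = all_words S T"
    unfolding if_not_P[OF False] by simp
  show ?thesis using assms that unfolding finitely_irreducible_def eq by blast
qed

text \<open>If two points share \<open>n\<close> letters, their \<open>i\<close>-th iterates share
  \<open>n - i\<close>; reversing the order of summation bounds the distortion by a partial sum of
  the variations. The variations also tend to zero, which makes \<open>\<phi>\<close> continuous and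
  hence measurable.\<close>

lemma potential_variation:
  assumes "summable_variations S T \<phi>"
  obtains V where "\<And>n x y. x \<in> X \<Longrightarrow> y \<in> X \<Longrightarrow> prefix_word n x = prefix_word n y \<Longrightarrow>
      birkhoff_sum n \<phi> x - birkhoff_sum n \<phi> y \<le> V"
    "\<phi> \<in> borel_measurable \<B>"
proof -
  define v where "v n = (SUP w\<in>W (Suc n). SUP x\<in>cyl w. SUP y\<in>cyl w. ereal (\<phi> x - \<phi> y))" for n
  have le_v: "ereal (\<phi> x - \<phi> y) \<le> v n"
    if "x \<in> X" "y \<in> X" "prefix_word (Suc n) x = prefix_word (Suc n) y" for x y n
  proof -
    have w: "prefix_word (Suc n) x \<in> W (Suc n)" "x \<in> cyl (prefix_word (Suc n) x)" "y \<in> cyl (prefix_word (Suc n) x)"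
      using that prefix_in_words[of x "Suc n"] cyl_prefix[of x "Suc n"] cyl_prefix[of y "Suc n"] by (simp_all only:)
    have "ereal (\<phi> x - \<phi> y) \<le> (SUP y\<in>cyl (prefix_word (Suc n) x). ereal (\<phi> x - \<phi> y))"
      by (rule SUP_upper[OF w(3)])
    also have "\<dots> \<le> (SUP x'\<in>cyl (prefix_word (Suc n) x). SUP y\<in>cyl (prefix_word (Suc n) x). ereal (\<phi> x' - \<phi> y))"
      by (rule SUP_upper[OF w(2)])
    also have "\<dots> \<le> v n" unfolding v_def by (rule SUP_upper[OF w(1)])
    finally show ?thesis .
  qed
  obtain x0 where x0: "x0 \<in> X" using X_nonempty by blast
  have v0: "v n \<ge> 0" for n using le_v[OF x0 x0 refl, of n] by (simp add: zero_ereal_def)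
  have "suminf v < \<infinity>" using assms unfolding summable_variations_def v_def .
  moreover have "suminf v \<ge> 0" using v0 by (intro suminf_nonneg) (auto intro: summable_ereal_pos)
  ultimately obtain V where V: "suminf v = ereal V" by (cases "suminf v") auto
  have sum_v: "(\<Sum>j<n. v j) \<le> ereal V" for n
    using sum_le_suminf[of v "{..<n}"] v0 V by (auto intro: summable_ereal_pos)
  have "birkhoff_sum n \<phi> x - birkhoff_sum n \<phi> y \<le> V"
    if xy: "x \<in> X" "y \<in> X" "prefix_word n x = prefix_word n y" for n x y
  proof -
    \<comment> \<open>The index \<open>n - Suc i\<close> reflects that \<open>v j\<close> is the
      variation over \<open>Suc j\<close> letters.\<close>
    have le: "ereal (\<phi> ((left_shift ^^ i) x) - \<phi> ((left_shift ^^ i) y)) \<le> v (n - Suc i)" if i: "i < n" for i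
    proof (rule le_v)
      have n: "n = i + Suc (n - Suc i)" using i by simp
      have "drop i (prefix_word (i + Suc (n - Suc i)) x) = drop i (prefix_word (i + Suc (n - Suc i)) y)"
        using xy(3) n by metis
      then show "prefix_word (Suc (n - Suc i)) ((left_shift ^^ i) x) = prefix_word (Suc (n - Suc i)) ((left_shift ^^ i) y)"
        by (simp only: drop_prefix_word)
    qed (use xy shift_iterate_in_X in auto)
    have "ereal (birkhoff_sum n \<phi> x - birkhoff_sum n \<phi> y) = (\<Sum>i<n. ereal (\<phi> ((left_shift ^^ i) x) - \<phi> ((left_shift ^^ i) y)))"
      by (simp add: birkhoff_sum_def sum_subtractf)
    also have "\<dots> \<le> (\<Sum>i<n. v (n - Suc i))" using le by (intro sum_mono) auto
    also have "\<dots> = (\<Sum>j<n. v j)" by (rule sum.nat_diff_reindex)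
    also have "\<dots> \<le> ereal V" by (rule sum_v)
    finally show ?thesis by simp
  qed
  moreover have "\<phi> \<in> borel_measurable \<B>"
    unfolding borel_measurable_iff_less
  proof
    fix a
    have "openin (shift_topology S T) {x \<in> X. \<phi> x < a}"
      unfolding openin_shift_iff
    proof (intro conjI ballI)
      fix x assume "x \<in> {x \<in> X. \<phi> x < a}"
      then have x: "x \<in> X" "\<phi> x < a" by auto
      define e where "e = a - \<phi> x"
      have e: "e > 0" using x by (simp add: e_def)
      \<comment> \<open>Otherwise the partial sums of the variations would exceed
        \<open>V\<close>.\<close>
      have "\<exists>n. v n < ereal e"
      proof (rule ccontr)
        assume "\<not> (\<exists>n. v n < ereal e)"
        then have "v n \<ge> ereal e" for n by (simp add: not_less)
        then have "(\<Sum>j<n. ereal e) \<le> ereal V" for n :: nat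
          using sum_mono[of "{..<n}" "\<lambda>_::nat. ereal e" v] sum_v[of n] by (meson order_trans)
        then have "real n * e \<le> V" for n by simp
        moreover obtain n :: nat where "V < real n * e" using reals_Archimedean3[OF e] by blast
        ultimately show False by (meson not_less)
      qed
      then obtain n where n: "v n < ereal e" by blast
      have "\<phi> y < a" if "y \<in> cyl (prefix_word (Suc n) x)" for y
      proof -
        have y: "y \<in> X" "prefix_word (Suc n) y = prefix_word (Suc n) x" using that by (auto simp: cyl_iff)
        have "ereal (\<phi> y - \<phi> x) < ereal e" using le_v[OF y(1) x(1) y(2)] n by (rule order_le_less_trans)
        then show ?thesis by (simp add: e_def)
      qed
      then show "\<exists>n. cyl (prefix_word n x) \<subseteq> {x \<in> X. \<phi> x < a}" using cyl_subset by blast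
    qed auto
    then show "{w \<in> space \<B>. \<phi> w < a} \<in> sets \<B>" using openin_sets by simp
  qed
  ultimately show ?thesis using that by blast
qed

text \<open>One point is fixed in each cylinder to evaluate the weight of its word. Bounded
  distortion makes this choice harmless and the weights quasi-multiplicative, and the limit masses
  then satisfy the Gibbs inequalities.\<close>

lemma exists_gibbs_measure:
  assumes irr: "finite \<Lambda>" "\<Lambda> \<subseteq> all_words S T"
      "\<And>u v. u \<in> all_words S T \<Longrightarrow> v \<in> all_words S T \<Longrightarrow> \<exists>l\<in>\<Lambda>. u @ l @ v \<in> all_words S T"
    and summ: "summable_potential S T \<phi>"
    and var: "\<And>n x y. x \<in> X \<Longrightarrow> y \<in> X \<Longrightarrow> prefix_word n x = prefix_word n y \<Longrightarrow>
      birkhoff_sum n \<phi> x - birkhoff_sum n \<phi> y \<le> V"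
  obtains \<mu> c P where "shift_invariant_measure S T \<mu>" "c \<ge> 1"
    "\<And>n x. n \<ge> 1 \<Longrightarrow> x \<in> X \<Longrightarrow> measure \<mu> (cyl (prefix_word n x)) \<le> c * exp (- P * n + birkhoff_sum n \<phi> x)"
    "\<And>n x. n \<ge> 1 \<Longrightarrow> x \<in> X \<Longrightarrow> exp (- P * n + birkhoff_sum n \<phi> x) \<le> c * measure \<mu> (cyl (prefix_word n x))"
proof -
  obtain x0 where x0: "x0 \<in> X" using X_nonempty by blast
  have V0: "V \<ge> 0" using var[OF x0 x0 refl, of 0] by simp
  define pt where "pt w = (SOME x. x \<in> cyl w)" for w
  have pt: "pt w \<in> X" "prefix_word (length w) (pt w) = w" if "adm w" for w
  proof -
    have "pt w \<in> cyl w" unfolding pt_def using adm_cyl_nonempty[OF that] by (simp add: some_in_eq)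
    then show "pt w \<in> X" "prefix_word (length w) (pt w) = w" by (auto simp: cyl_iff)
  qed
  define s where "s w = (if adm w then exp (birkhoff_sum (length w) \<phi> (pt w)) else 0)" for w
  have s_near: "s w \<le> exp V * exp (birkhoff_sum (length w) \<phi> x)" "exp (birkhoff_sum (length w) \<phi> x) \<le> exp V * s w"
    if w: "adm w" and x: "x \<in> X" "prefix_word (length w) x = w" for w x
  proof -
    have "birkhoff_sum (length w) \<phi> (pt w) - birkhoff_sum (length w) \<phi> x \<le> V"
      "birkhoff_sum (length w) \<phi> x - birkhoff_sum (length w) \<phi> (pt w) \<le> V"
      using pt[OF w] x by (intro var; simp)+
    then show "s w \<le> exp V * exp (birkhoff_sum (length w) \<phi> x)" "exp (birkhoff_sum (length w) \<phi> x) \<le> exp V * s w"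
      using w by (simp_all add: s_def exp_add[symmetric])
  qed
  have s_nonneg: "s w \<ge> 0" for w by (simp add: s_def)
  have split: "s (u @ v) = exp (birkhoff_sum (length u) \<phi> (pt (u @ v))) * exp (birkhoff_sum (length v) \<phi> ((left_shift ^^ length u) (pt (u @ v))))"
    "prefix_word (length u) (pt (u @ v)) = u" "prefix_word (length v) ((left_shift ^^ length u) (pt (u @ v))) = v"
    "pt (u @ v) \<in> X" "(left_shift ^^ length u) (pt (u @ v)) \<in> X"
    if uv: "adm (u @ v)" for u v
  proof -
    show "s (u @ v) = exp (birkhoff_sum (length u) \<phi> (pt (u @ v))) * exp (birkhoff_sum (length v) \<phi> ((left_shift ^^ length u) (pt (u @ v))))"
      using uv by (simp add: s_def birkhoff_sum_add exp_add)
    have "prefix_word (length u) (pt (u @ v)) @ prefix_word (length v) ((left_shift ^^ length u) (pt (u @ v))) = u @ v"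
      using pt(2)[OF uv] by (simp only: length_append prefix_word_add)
    then show "prefix_word (length u) (pt (u @ v)) = u" "prefix_word (length v) ((left_shift ^^ length u) (pt (u @ v))) = v"
      by (simp_all add: append_eq_append_conv)
    show "pt (u @ v) \<in> X" by (rule pt[OF uv])
    then show "(left_shift ^^ length u) (pt (u @ v)) \<in> X" by (rule shift_iterate_in_X)
  qed
  \<comment> \<open>Splitting a word moves two base points, one for each factor, hence two factors
    \<open>exp V\<close>.\<close>
  interpret ww: countable_word_weights adm s "exp V * exp V" \<Lambda> S
  proof
    show "adm []" by (simp add: adm_def)
    show "adm (u @ v) \<Longrightarrow> adm u \<and> adm v" for u v by (rule adm_append)
    show "w \<noteq> [] \<Longrightarrow> adm (u @ w) \<Longrightarrow> adm (w @ v) \<Longrightarrow> adm (u @ w @ v)" for u w v by (rule adm_glue)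
    show "finite \<Lambda>" by (rule irr)
    show "l \<in> \<Lambda> \<Longrightarrow> adm l" for l using irr(2) by (auto simp: adm_def)
    show "\<exists>l\<in>\<Lambda>. adm (u @ l @ v)" if uv: "adm u" "adm v" for u v
    proof -
      have a0: "prefix_word 1 x0 \<in> all_words S T"
        using prefix_in_words[OF x0, of 1] by (simp add: all_words_iff)
      \<comment> \<open>Irreducibility concerns nonempty words; an empty end is replaced by a
        one-letter word, which is cut off again afterwards.\<close>
      define u' where "u' = (if u = [] then prefix_word 1 x0 else u)"
      define v' where "v' = (if v = [] then prefix_word 1 x0 else v)"
      have "u' \<in> all_words S T" "v' \<in> all_words S T" using uv a0 by (auto simp: u'_def v'_def adm_def)
      then obtain l where l: "l \<in> \<Lambda>" "adm (u' @ l @ v')" using irr(3) unfolding adm_def by blast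
      have "adm (u @ l @ v')" using l(2) adm_append[of u' "l @ v'"] by (cases "u = []") (auto simp: u'_def)
      then have "adm (u @ l @ v)" using adm_append[of "u @ l" v'] by (cases "v = []") (auto simp: v'_def)
      then show ?thesis using l by blast
    qed
    show "adm w \<Longrightarrow> s w > 0" "\<not> adm w \<Longrightarrow> s w = 0" for w by (auto simp: s_def)
    show "s [] = 1" by (simp add: s_def adm_def birkhoff_sum_def)
    show "exp V * exp V \<ge> 1" using V0 by (simp add: exp_add[symmetric])
    show "s (u @ v) \<le> exp V * exp V * (s u * s v)" if uv: "adm (u @ v)" for u v
    proof -
      note sp = split[OF uv]
      have "s (u @ v) \<le> (exp V * s u) * (exp V * s v)"
        unfolding sp(1) using adm_append[OF uv] sp s_nonneg by (intro mult_mono s_near(2)) auto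
      then show ?thesis by (simp add: mult_ac)
    qed
    show "s u * s v \<le> exp V * exp V * s (u @ v)" if uv: "adm (u @ v)" for u v
    proof -
      note sp = split[OF uv]
      have "s u * s v \<le> (exp V * exp (birkhoff_sum (length u) \<phi> (pt (u @ v)))) *
          (exp V * exp (birkhoff_sum (length v) \<phi> ((left_shift ^^ length u) (pt (u @ v)))))"
        using adm_append[OF uv] sp s_nonneg by (intro mult_mono s_near(1)) auto
      then show ?thesis unfolding sp(1) by (simp add: mult_ac)
    qed
    show "(\<integral>\<^sup>+a. ennreal (s [a]) \<partial>count_space UNIV) < \<infinity>"
    proof -
      have "(\<integral>\<^sup>+a. ennreal (s [a]) \<partial>count_space UNIV) = (\<integral>\<^sup>+a. ennreal (s [a]) \<partial>count_space S)"
        by (intro nn_integral_count_space_eq) (auto simp: s_def adm_iff)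
      also have "\<dots> \<le> (\<integral>\<^sup>+a. (SUP x\<in>cyl [a]. ennreal (exp (\<phi> x))) \<partial>count_space S)"
      proof (rule nn_integral_mono)
        fix a assume "a \<in> space (count_space S)"
        then have a: "adm [a]" by (simp add: adm_iff)
        have "pt [a] \<in> cyl [a]" using pt[OF a] by (simp add: cyl_iff)
        then show "ennreal (s [a]) \<le> (SUP x\<in>cyl [a]. ennreal (exp (\<phi> x)))"
          using a by (intro SUP_upper2[of "pt [a]"]) (auto simp: s_def birkhoff_sum_def)
      qed
      also have "\<dots> < \<infinity>" using summ by (simp add: summable_potential_iff)
      finally show ?thesis .
    qed
    show "countable S" by (rule countable_alphabet)
    show "adm w \<Longrightarrow> set w \<subseteq> S" for w by (simp add: adm_iff)
    show "\<exists>w. adm w \<and> length w = n" for n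
      using adm_prefix_word[OF x0, of n] by (intro exI[of _ "prefix_word n x0"]) simp
  qed
  obtain m where m: "m [] = 1" "\<And>w. \<not> adm w \<Longrightarrow> m w = 0" "\<And>w. m w \<ge> 0"
    "\<And>w. m w \<le> ww.C\<^sub>2 * s w / ww.z (length w)"
    "\<And>w. adm w \<Longrightarrow> w \<noteq> [] \<Longrightarrow> s w / (ww.C\<^sub>2 * ww.z (length w)) \<le> m w"
    "\<And>w. (\<integral>\<^sup>+a. ennreal (m (w @ [a])) \<partial>count_space S) = ennreal (m w)"
    "\<And>w. (\<integral>\<^sup>+a. ennreal (m (a # w)) \<partial>count_space S) = ennreal (m w)"
    by (rule ww.limit_masses) (rule that)
  have m_pos: "m w > 0" if w: "adm w" for w
  proof (cases "w = []")
    case False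
    have "0 < s w / (ww.C\<^sub>2 * ww.z (length w))"
      using w ww.C2_pos ww.Z_pos by (simp add: s_def)
    then show ?thesis using m(5)[OF w False] by linarith
  qed (simp add: m)
  obtain \<mu> where \<mu>: "prob_space \<mu>" "sets \<mu> = sets \<B>" "\<And>w. measure \<mu> (cyl w) = m w"
    using measure_of_masses[OF m(1,2) m_pos m(6)] by blast
  have inv: "shift_invariant_measure S T \<mu>" by (rule shift_invariant_of_masses[OF \<mu> m(7)])
  obtain P D where D: "D \<ge> 0" "\<And>n. ww.z n \<le> exp (P * n + D)" "\<And>n. exp (P * n - D) \<le> ww.z n"
    by (rule ww.z_growth) (rule that)
  \<comment> \<open>The factor \<open>ww.C\<^sub>2\<close> comes from the limit masses,
    \<open>exp V\<close> from the change of base point, and \<open>exp D\<close> from replacing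
    \<open>ww.z n\<close> by \<open>exp (P * n)\<close>.\<close>
  define c where "c = max 1 (ww.C\<^sub>2 * exp (V + D))"
  have c: "c \<ge> 1" "ww.C\<^sub>2 * exp (V + D) \<le> c" by (auto simp: c_def)
  show ?thesis
  proof (rule that[OF inv c(1)])
    fix n :: nat and x assume n: "n \<ge> 1" and x: "x \<in> X"
    define w where "w = prefix_word n x"
    have w: "adm w" "length w = n" "w \<noteq> []" "prefix_word (length w) x = w"
      using adm_prefix_word[OF x] n by (auto simp: w_def)
    note near = s_near[OF w(1) x w(4)]
    have zp: "ww.z n > 0" by (rule ww.Z_pos)
    have "m w \<le> ww.C\<^sub>2 * s w / ww.z n" using m(4)[of w] w by simp
    also have "\<dots> \<le> ww.C\<^sub>2 * (exp V * exp (birkhoff_sum n \<phi> x)) / exp (P * n - D)"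
      using near(1) w D(3)[of n] ww.C2_pos zp s_nonneg by (intro frac_le mult_left_mono mult_nonneg_nonneg) auto
    also have "\<dots> = ww.C\<^sub>2 * exp (V + D) * exp (- P * n + birkhoff_sum n \<phi> x)"
      by (simp add: exp_add exp_diff exp_minus divide_simps)
    also have "\<dots> \<le> c * exp (- P * n + birkhoff_sum n \<phi> x)" using c by (intro mult_right_mono) auto
    finally show "measure \<mu> (cyl (prefix_word n x)) \<le> c * exp (- P * n + birkhoff_sum n \<phi> x)"
      using \<mu>(3)[of w] by (simp add: w_def)
    have "exp (- P * n + birkhoff_sum n \<phi> x) = exp (birkhoff_sum n \<phi> x) * exp D / exp (P * n + D)"
      by (simp add: exp_add exp_diff exp_minus divide_simps)
    also have "\<dots> \<le> (exp V * s w) * exp D / ww.z n"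
      using near(2) w D(2)[of n] zp s_nonneg by (intro frac_le mult_right_mono mult_nonneg_nonneg) auto
    also have "\<dots> = ww.C\<^sub>2 * exp (V + D) * (s w / (ww.C\<^sub>2 * ww.z n))"
      using ww.C2_pos by (simp add: exp_add)
    also have "\<dots> \<le> ww.C\<^sub>2 * exp (V + D) * m w"
      using m(5)[OF w(1,3)] w ww.C2_pos by (intro mult_left_mono) auto
    also have "\<dots> \<le> c * m w" using c m(3) by (intro mult_right_mono) auto
    finally show "exp (- P * n + birkhoff_sum n \<phi> x) \<le> c * measure \<mu> (cyl (prefix_word n x))"
      using \<mu>(3)[of w] by (simp add: w_def)
  qed
qed

end

theorem theorem1p1:
  fixes S :: "'a set" and T :: "'a \<Rightarrow> 'a \<Rightarrow> nat" and \<phi> :: "(nat \<Rightarrow> 'a) \<Rightarrow> real"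
  assumes "countable S" and "infinite S"
    and "transition_matrix S T"
    and "finitely_irreducible S T"
    and "summable_potential S T \<phi>"
    and "summable_variations S T \<phi>"
    and "beta_infinity S T \<phi> < 1"
  shows "\<exists>\<mu>. (\<forall>\<nu>. minimizer S T \<phi> \<nu> \<longleftrightarrow> \<nu> = \<mu>) \<and>
             (\<forall>\<nu>. invariant_gibbs_state S T \<phi> \<nu> \<longleftrightarrow> \<nu> = \<mu>) \<and>
             (\<forall>\<nu>. equilibrium_state S T \<phi> \<nu> \<longleftrightarrow> \<nu> = \<mu>)"
proof -
  interpret countable_shift S T
    using assms(1-3) by unfold_locales auto
  obtain \<Lambda> where \<Lambda>: "finite \<Lambda>" "\<Lambda> \<subseteq> all_words S T"
    "\<And>u v. u \<in> all_words S T \<Longrightarrow> v \<in> all_words S T \<Longrightarrow> \<exists>l\<in>\<Lambda>. u @ l @ v \<in> all_words S T"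
    using finitely_irreducible_connectors[OF assms(4)] by blast
  obtain V where var: "\<And>n x y. x \<in> X \<Longrightarrow> y \<in> X \<Longrightarrow> prefix_word n x = prefix_word n y \<Longrightarrow>
      birkhoff_sum n \<phi> x - birkhoff_sum n \<phi> y \<le> V" and meas: "\<phi> \<in> borel_measurable \<B>"
    using potential_variation[OF assms(6)] by blast
  obtain \<beta> where \<beta>: "\<beta> < 1" "summable_potential S T (\<lambda>x. \<beta> * \<phi> x)"
    using assms(7) unfolding beta_infinity_def INF_less_iff by (auto simp: one_ereal_def)
  obtain \<mu> c P where \<mu>: "shift_invariant_measure S T \<mu>" "c \<ge> 1"
    "\<And>n x. n \<ge> 1 \<Longrightarrow> x \<in> X \<Longrightarrow> measure \<mu> (cyl (prefix_word n x)) \<le> c * exp (- P * n + birkhoff_sum n \<phi> x)"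
    "\<And>n x. n \<ge> 1 \<Longrightarrow> x \<in> X \<Longrightarrow> exp (- P * n + birkhoff_sum n \<phi> x) \<le> c * measure \<mu> (cyl (prefix_word n x))"
    using exists_gibbs_measure[OF \<Lambda> assms(5) var] by blast
  \<comment> \<open>Stated for arbitrary \<open>\<nu>\<close>, \<open>c\<close>, \<open>P\<close>,
    since a second invariant Gibbs state brings its own constants. The set of minimizers does not
    depend on them, so the two states are the same measure.\<close>
  have gibbs: "irreducible_gibbs_measure S T \<nu> \<phi> c P \<beta> \<Lambda>"
    if "shift_invariant_measure S T \<nu>" "c \<ge> 1"
      "\<And>n x. n \<ge> 1 \<Longrightarrow> x \<in> X \<Longrightarrow> measure \<nu> (cyl (prefix_word n x)) \<le> c * exp (- P * n + birkhoff_sum n \<phi> x)"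
      "\<And>n x. n \<ge> 1 \<Longrightarrow> x \<in> X \<Longrightarrow> exp (- P * n + birkhoff_sum n \<phi> x) \<le> c * measure \<nu> (cyl (prefix_word n x))"
    for \<nu> c P
    using that assms(2,5) meas \<beta> \<Lambda>
    by (intro irreducible_gibbs_measure.intro irreducible_gibbs_measure_axioms.intro
        gibbs_measure.intro gibbs_measure_axioms.intro) auto
  interpret \<mu>: irreducible_gibbs_measure S T \<mu> \<phi> c P \<beta> \<Lambda>
    by (rule gibbs[OF \<mu>])
  have "invariant_gibbs_state S T \<phi> \<nu> \<longleftrightarrow> \<nu> = \<mu>" for \<nu>
  proof
    assume \<nu>: "invariant_gibbs_state S T \<phi> \<nu>"
    then obtain c' P' where c': "c' \<ge> 1" and b: "\<And>n x. n \<ge> 1 \<Longrightarrow> x \<in> X \<Longrightarrow>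
        inverse c' \<le> measure \<nu> (cyl (prefix_word n x)) / exp (- P' * real n + birkhoff_sum n \<phi> x) \<and>
        measure \<nu> (cyl (prefix_word n x)) / exp (- P' * real n + birkhoff_sum n \<phi> x) \<le> c'"
      unfolding invariant_gibbs_state_def gibbs_state_def by blast
    have "prob_space \<nu>" "\<nu> \<in> invariant_measures S T"
      using \<nu> by (auto simp: invariant_gibbs_state_def gibbs_state_def prob_measures_iff)
    then have inv: "shift_invariant_measure S T \<nu>"
      by (intro shift_invariant_measure.intro shift_invariant_measure_axioms.intro countable_shift_axioms)
    have div: "m \<le> c' * e \<and> e \<le> c' * m" if "inverse c' \<le> m / e \<and> m / e \<le> c'" "e > 0" for m e :: real
      using that c' by (simp add: field_simps)
    note bb = div[OF b exp_gt_zero]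
    interpret \<nu>: irreducible_gibbs_measure S T \<nu> \<phi> c' P' \<beta> \<Lambda>
      by (rule gibbs[OF inv c' bb[THEN conjunct1] bb[THEN conjunct2]])
    show "\<nu> = \<mu>" using \<mu>.minimizer_iff \<nu>.minimizer_iff by blast
  next
    assume \<nu>: "\<nu> = \<mu>"
    have "inverse c \<le> m / e \<and> m / e \<le> c" if "m \<le> c * e" "e \<le> c * m" "e > 0" for m e :: real
      using that \<mu>(2) by (simp add: field_simps)
    then have "gibbs_state S T \<phi> \<mu>"
      unfolding gibbs_state_def using \<mu>(2-4) \<mu>.prob_space_axioms
      by (intro conjI exI[of _ c] exI[of _ P]) (auto simp: prob_measures_iff)
    then show "invariant_gibbs_state S T \<phi> \<nu>"
      using \<nu> \<mu>.invariant by (simp add: invariant_gibbs_state_def)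
  qed
  then show ?thesis using \<mu>.minimizer_iff \<mu>.equilibrium_state_iff by blast
qed

end
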